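(* Let $u:F\to\mathbb{R}$ be such that $e^uR^{\dagger}\in\tilde P(\Theta)$. Then: (1) The map $f_u$ is quasiconformal if and only if $\sup_{\phi\psi\in E^*}|u_\phi-u_\psi|<\infty$. (2) If $u$ has finite combinatorial Dirichlet energy, $\sum_{\phi\psi\in E^*}|u_\phi-u_\psi|^2<\infty$ (i.e. $u\in P(\Theta,R^\dagger)$), then the Beltrami differential of $f_u$ is $L^2$-integrable with respect to the hyperbolic metric on $\mathbb{D}$. Conversely, if the Beltrami differential of $f_u$ is $L^2$-integrable in the hyperbolic metric and the uniformized circle pattern admits a uniform (positive) lower bound on its hyperbolic radii, then $u$ has finite combinatorial Dirichlet energy.
   Context: Setting. $(V,E,F)$ is a cell decomposition of a topological open disk $\Omega$ whose 1-skeleton $G=(V,E)$ has one infinite end, has uniformly bounded vertex degrees and face degrees, and is transient (simple random walk escapes to infinity with positive probability). $(V^*,E^*,F^* )$ is the dual cell decomposition, with $V^*\cong F$, $E^*\cong E$, $F^*\cong V$; $\phi\psi\in E^*$ is the dual edge crossing the edge $ij$ with adjacent faces $\phi,\psi$. For some small constant $\epsilon_0>0$, $\Theta:E^*\to(\epsilon_0,\pi-\epsilon_0)$, $\Theta_{\phi\psi}=\Theta_{\psi\phi}$, satisfies: (A1) $\sum_{\phi\psi\in\gamma}\Theta_{\phi\psi}=2\pi$ for every closed loop $\gamma$ in the dual graph bounding exactly one dual face; (A2) $\sum_{\phi\psi\in\gamma}\Theta_{\phi\psi}>2\pi+\epsilon_0$ for every closed loop $\gamma$ in the dual graph bounding more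 than one dual face. Circle patterns. $\tilde P(\Theta)$ is the set of $R:F\to\mathbb{R}_{>0}$ that are the Euclidean radii of a circle pattern in the plane (possibly not globally embedded) with intersection angles $\Theta$; equivalently, for every $\phi\in F$, $\sum_{\psi\sim\phi}\cot^{-1}\big(\frac{R_\phi-R_\psi\cos\Theta_{\phi\psi}}{R_\psi\sin\Theta_{\phi\psi}}\big)=\pi$, with $\cot^{-1}$ valued in $(0,\pi)$. For each dual edge $\phi\psi$ crossing $ij$, take the Euclidean kite with vertices $\phi,i,\psi,j$, sides $R_\phi$ at $\phi$, $R_\psi$ at $\psi$, consisting of two congruent triangles $\phi\psi i$ and $\phi\psi j$ with angle $\Theta_{\phi\psi}$ at $i$ and $j$. For $R\in\tilde P(\Theta)$ gluing the kites yields a smooth flat metric $\sigma(\Theta,R)$ on $\Omega$, in which the points $i\in V$ are intersection points of circles and the points $\phi\in F$ are circumcenters. $R^\dagger\in\tilde P(\Theta)$ is a fixed function for which the developing map (local isometry) $(\Omega,\sigma(\Theta,R^\dagger))\to\mathbb{R}^2$ is an isometry onto the open unit disk $\mathbb{D}$ (the uniformized circle pattern; it exists by the known discrete uniformization theorem); we identify $\mathbb{D}\cong(\Omega,\sigma(\Theta,R^\dagger))$. The map $f_u$. For $u:F\to\mathbb{R}$ with $e^uR^\dagger\in\tilde P(\Theta)$, $f_u:\mathbb{D}\cong(\Omega,\sigma(\Theta,R^\dagger))\to(\Omega,\sigma(\Theta,e^uR^\dagger))$ is the piecewise linear map sending circumcenters to corresponding circumcenters and intersection points to corresponding intersection points,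 and affine on each of the triangles $\phi\psi i$ and $\phi\psi j$ for every edge $ij$ with adjacent faces $\phi,\psi$. Its Beltrami differential is $\mu(f_u)=\partial_{\bar z}f_u/\partial_zf_u$ (in local isometric coordinates). Conventions. $\mu$ is $L^2$-integrable in the hyperbolic metric if $\iint_{\mathbb{D}}|\mu(z)|^2\frac{dx\,dy}{(1-|z|^2)^2}<\infty$. The hyperbolic radius of a circle of the uniformized pattern (each circumdisk is compactly contained in $\mathbb{D}$) is its radius in the Poincaré metric of $\mathbb{D}$. $P(\Theta,R^\dagger)$ is the set of $u$ with $\sum_{\phi\psi}|u_\phi-u_\psi|^2<\infty$ and $e^uR^\dagger\in\tilde P(\Theta)$. *)

theory Defs
  imports "HOL-Probability.Probability" "HOL-Combinatorics.Orbits"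
begin

section \<open>Cell decompositions\<close>

text \<open>
  An oriented locally finite cell decomposition is encoded by its oriented edges ("darts"), which
  are all the elements of the type \<open>'d\<close>. For a dart \<open>d\<close>, \<open>opp d\<close> is the same edge traversed
  backwards and \<open>nxt d\<close> is the dart that follows \<open>d\<close> on the boundary of the face on the left of
  \<open>d\<close>. Then \<open>nxt (opp d)\<close> is the dart with the same origin as \<open>d\<close> that comes next in clockwise
  order. So edges, faces and vertices are the orbits of \<open>opp\<close>, \<open>nxt\<close> and \<open>nxt \<circ> opp\<close>, and each is
  represented by the set of darts in the orbit. Multiple edges and loops are not excluded.
\<close>

record 'd cell_map =
  opp :: "'d \<Rightarrow> 'd"
  nxt :: "'d \<Rightarrow> 'd"

definition edge :: "'d cell_map \<Rightarrow> 'd \<Rightarrow> 'd set" where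
  "edge M d = {d, opp M d}"

definition origin :: "'d cell_map \<Rightarrow> 'd \<Rightarrow> 'd set" where
  "origin M d = orbit (nxt M \<circ> opp M) d"

definition target :: "'d cell_map \<Rightarrow> 'd \<Rightarrow> 'd set" where
  "target M d = origin M (opp M d)"

definition left_face :: "'d cell_map \<Rightarrow> 'd \<Rightarrow> 'd set" where
  "left_face M d = orbit (nxt M) d"

definition right_face :: "'d cell_map \<Rightarrow> 'd \<Rightarrow> 'd set" where
  "right_face M d = left_face M (opp M d)"

definition vertices :: "'d cell_map \<Rightarrow> 'd set set" where
  "vertices M = range (origin M)"

definition edges :: "'d cell_map \<Rightarrow> 'd set set" where
  "edges M = range (edge M)"

definition faces :: "'d cell_map \<Rightarrow> 'd set set" where
  "faces M = range (left_face M)"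

definition bounded_degrees :: "'d cell_map \<Rightarrow> bool" where
  "bounded_degrees M \<longleftrightarrow>
     (\<exists>N. (\<forall>v\<in>vertices M. finite v \<and> card v \<le> N) \<and> (\<forall>\<phi>\<in>faces M. finite \<phi> \<and> card \<phi> \<le> N))"

text \<open>The 1-skeleton has exactly one infinite end: removing finitely many vertices always leaves
  exactly one infinite component.\<close>

definition adjacent_off :: "'d cell_map \<Rightarrow> 'd set set \<Rightarrow> 'd set \<Rightarrow> 'd set \<Rightarrow> bool" where
  "adjacent_off M K v w \<longleftrightarrow> v \<notin> K \<and> w \<notin> K \<and> (\<exists>d. origin M d = v \<and> target M d = w)"

definition components_off :: "'d cell_map \<Rightarrow> 'd set set \<Rightarrow> 'd set set set" where
  "components_off M K = {{w. (adjacent_off M K)\<^sup>*\<^sup>* v w} | v. v \<in> vertices M - K}"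

definition one_ended :: "'d cell_map \<Rightarrow> bool" where
  "one_ended M \<longleftrightarrow>
     (\<forall>K. finite K \<and> K \<subseteq> vertices M \<longrightarrow> (\<exists>!C. C \<in> components_off M K \<and> infinite C))"

definition step_prob :: "'d cell_map \<Rightarrow> 'd set \<Rightarrow> 'd set \<Rightarrow> real" where
  "step_prob M v w = real (card {d. origin M d = v \<and> target M d = w}) / real (card v)"

text \<open>The law on vertex sequences of the simple random walk started at \<open>v\<close>.\<close>

definition random_walk_law :: "'d cell_map \<Rightarrow> 'd set \<Rightarrow> (nat \<Rightarrow> 'd set) measure \<Rightarrow> bool" where
  "random_walk_law M v P \<longleftrightarrow>
     prob_space P \<and>
     sets P = sets (Pi\<^sub>M UNIV (\<lambda>_::nat. count_space (vertices M))) \<and>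
     (\<forall>n x. (\<forall>k. x k \<in> vertices M) \<longrightarrow>
        measure P {\<omega> \<in> space P. \<forall>k\<le>n. \<omega> k = x k} =
          (if x 0 = v then \<Prod>k<n. step_prob M (x k) (x (Suc k)) else 0))"

definition transient :: "'d cell_map \<Rightarrow> bool" where
  "transient M \<longleftrightarrow>
     (\<forall>v\<in>vertices M. \<exists>P. random_walk_law M v P \<and>
        measure P {\<omega> \<in> space P. \<forall>w\<in>vertices M. finite {n. \<omega> n = w}} > 0)"


section \<open>The flat surface glued from kites\<close>

text \<open>
  The triangle of a dart \<open>d\<close> from \<open>i\<close> to \<open>j\<close> has its vertices at \<open>i\<close> and at the centres of the
  right and the left face of \<open>d\<close>. It is placed in the plane with \<open>i\<close> at the origin, in
  counterclockwise order; the angle at \<open>i\<close> is \<open>\<Theta>\<close>. The triangles of \<open>d\<close> and \<open>opp d\<close> together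
  form the kite of the edge. The radii are indexed by faces and the angles by edges
  (equivalently, dual edges).
\<close>

definition right_corner :: "'d cell_map \<Rightarrow> ('d set \<Rightarrow> real) \<Rightarrow> 'd \<Rightarrow> complex" where
  "right_corner M R d = of_real (R (right_face M d))"

definition left_corner ::
    "'d cell_map \<Rightarrow> ('d set \<Rightarrow> real) \<Rightarrow> ('d set \<Rightarrow> real) \<Rightarrow> 'd \<Rightarrow> complex" where
  "left_corner M \<Theta> R d = of_real (R (left_face M d)) * cis (\<Theta> (edge M d))"

definition dart_triangle ::
    "'d cell_map \<Rightarrow> ('d set \<Rightarrow> real) \<Rightarrow> ('d set \<Rightarrow> real) \<Rightarrow> 'd \<Rightarrow> complex set" where
  "dart_triangle M \<Theta> R d = convex hull {0, right_corner M R d, left_corner M \<Theta> R d}"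

text \<open>
  Gluing of the disjoint union of the triangles: the sides between face centres of \<open>d\<close> and
  \<open>opp d\<close>, and the right side of \<open>d\<close> with the left side of the clockwise next dart.
\<close>

definition glue_generators ::
    "'d cell_map \<Rightarrow> ('d set \<Rightarrow> real) \<Rightarrow> ('d set \<Rightarrow> real) \<Rightarrow> (('d \<times> complex) \<times> ('d \<times> complex)) set" where
  "glue_generators M \<Theta> R =
     {((d, (1 - t) *\<^sub>R right_corner M R d + t *\<^sub>R left_corner M \<Theta> R d),
       (opp M d, (1 - t) *\<^sub>R left_corner M \<Theta> R (opp M d) + t *\<^sub>R right_corner M R (opp M d)))
      | d t. 0 \<le> t \<and> t \<le> 1} \<union>
     {((d, t *\<^sub>R right_corner M R d),
       (nxt M (opp M d), t *\<^sub>R left_corner M \<Theta> R (nxt M (opp M d))))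
      | d t. 0 \<le> t \<and> t \<le> 1}"

definition glue ::
    "'d cell_map \<Rightarrow> ('d set \<Rightarrow> real) \<Rightarrow> ('d set \<Rightarrow> real) \<Rightarrow> (('d \<times> complex) \<times> ('d \<times> complex)) set" where
  "glue M \<Theta> R = (glue_generators M \<Theta> R \<union> (glue_generators M \<Theta> R)\<inverse>)\<^sup>*"

definition surface_pt ::
    "'d cell_map \<Rightarrow> ('d set \<Rightarrow> real) \<Rightarrow> ('d set \<Rightarrow> real) \<Rightarrow> 'd \<Rightarrow> complex \<Rightarrow> ('d \<times> complex) set" where
  "surface_pt M \<Theta> R d w = glue M \<Theta> R `` {(d, w)}"

definition surface_carrier ::
    "'d cell_map \<Rightarrow> ('d set \<Rightarrow> real) \<Rightarrow> ('d set \<Rightarrow> real) \<Rightarrow> ('d \<times> complex) set set" where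
  "surface_carrier M \<Theta> R = Sigma UNIV (dart_triangle M \<Theta> R) // glue M \<Theta> R"

text \<open>The quotient topology; with the flat metric of the triangles (see \<open>isometric_chart\<close>) this is
  the surface \<open>(\<Omega>, \<sigma>(\<Theta>, R))\<close>.\<close>

definition surface ::
    "'d cell_map \<Rightarrow> ('d set \<Rightarrow> real) \<Rightarrow> ('d set \<Rightarrow> real) \<Rightarrow> ('d \<times> complex) set topology" where
  "surface M \<Theta> R =
     topology (\<lambda>U. U \<subseteq> surface_carrier M \<Theta> R \<and>
       openin (subtopology (prod_topology (discrete_topology UNIV) euclidean)
                 (Sigma UNIV (dart_triangle M \<Theta> R))) (\<Union>U))"

lemma equiv_glue: "equiv UNIV (glue M \<Theta> R)"
  unfolding glue_def
  by (intro equivI refl_rtrancl sym_rtrancl trans_rtrancl) (auto simp: sym_Un_converse)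

lemma openin_surface:
  "openin (surface M \<Theta> R) U \<longleftrightarrow> U \<subseteq> surface_carrier M \<Theta> R \<and>
     openin (subtopology (prod_topology (discrete_topology UNIV) euclidean)
               (Sigma UNIV (dart_triangle M \<Theta> R))) (\<Union>U)"
proof -
  let ?X = "subtopology (prod_topology (discrete_topology UNIV) euclidean)
              (Sigma UNIV (dart_triangle M \<Theta> R))"
  have sub: "surface_carrier M \<Theta> R \<subseteq> UNIV // glue M \<Theta> R"
    unfolding surface_carrier_def quotient_def by blast
  have Int: "\<Union>(A \<inter> B) = \<Union>A \<inter> \<Union>B"
    if "A \<subseteq> surface_carrier M \<Theta> R" "B \<subseteq> surface_carrier M \<Theta> R" for A B
  proof -
    have "a = b" if "a \<in> A" "b \<in> B" "x \<in> a" "x \<in> b" for a b x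
    proof -
      have "a \<in> UNIV // glue M \<Theta> R" "b \<in> UNIV // glue M \<Theta> R"
        using that \<open>A \<subseteq> _\<close> \<open>B \<subseteq> _\<close> sub by blast+
      then show ?thesis
        using quotient_disj[OF equiv_glue] that by blast
    qed
    then show ?thesis by blast
  qed
  have "istopology (\<lambda>U. U \<subseteq> surface_carrier M \<Theta> R \<and> openin ?X (\<Union>U))"
    unfolding istopology_def
  proof (intro conjI allI impI)
    fix \<K> assume *: "\<forall>K\<in>\<K>. K \<subseteq> surface_carrier M \<Theta> R \<and> openin ?X (\<Union>K)"
    then show "\<Union>\<K> \<subseteq> surface_carrier M \<Theta> R" by blast
    have "openin ?X (\<Union>(Union ` \<K>))"
      using * by (intro openin_Union) auto
    moreover have "\<Union>(Union ` \<K>) = \<Union>(\<Union>\<K>)" by blast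
    ultimately show "openin ?X (\<Union>(\<Union>\<K>))" by simp
  qed (auto simp: Int)
  then show ?thesis
    unfolding surface_def by simp
qed

text \<open>
  Topologically the glued surface does not depend on the shapes of the triangles; the condition
  that the cell complex is an open disk is stated with unit squares as kites.
\<close>

definition cell_decomposition_of_disk :: "'d cell_map \<Rightarrow> bool" where
  "cell_decomposition_of_disk M \<longleftrightarrow>
     (\<forall>d. opp M (opp M d) = d \<and> opp M d \<noteq> d) \<and> bij (nxt M) \<and>
     surface M (\<lambda>_. pi / 2) (\<lambda>_. 1) homeomorphic_space top_of_set (ball (0::complex) 1)"


section \<open>Circle patterns\<close>

text \<open>
  A closed loop in the dual graph, given by the darts it crosses (always from right to left), and
  the condition that it bounds the dual faces in \<open>W\<close>, running counterclockwise around them.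
\<close>

definition dual_loop :: "'d cell_map \<Rightarrow> 'd list \<Rightarrow> bool" where
  "dual_loop M \<gamma> \<longleftrightarrow>
     \<gamma> \<noteq> [] \<and> distinct \<gamma> \<and>
     (\<forall>k<length \<gamma>. left_face M (\<gamma> ! k) = right_face M (\<gamma> ! (Suc k mod length \<gamma>)))"

definition loop_bounds :: "'d cell_map \<Rightarrow> 'd list \<Rightarrow> 'd set set \<Rightarrow> bool" where
  "loop_bounds M \<gamma> W \<longleftrightarrow>
     dual_loop M \<gamma> \<and> finite W \<and> W \<subseteq> vertices M \<and>
     set \<gamma> = {d. origin M d \<in> W \<and> target M d \<notin> W}"

definition admissible_angles :: "'d cell_map \<Rightarrow> real \<Rightarrow> ('d set \<Rightarrow> real) \<Rightarrow> bool" where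
  "admissible_angles M \<epsilon>\<^sub>0 \<Theta> \<longleftrightarrow>
     (\<forall>e\<in>edges M. \<epsilon>\<^sub>0 < \<Theta> e \<and> \<Theta> e < pi - \<epsilon>\<^sub>0) \<and>
     (\<forall>\<gamma> W. loop_bounds M \<gamma> W \<and> card W = 1 \<longrightarrow> (\<Sum>d\<leftarrow>\<gamma>. \<Theta> (edge M d)) = 2 * pi) \<and>
     (\<forall>\<gamma> W. loop_bounds M \<gamma> W \<and> card W > 1 \<longrightarrow> (\<Sum>d\<leftarrow>\<gamma>. \<Theta> (edge M d)) > 2 * pi + \<epsilon>\<^sub>0)"

text \<open>The inverse of the cotangent with values in \<open>(0, \<pi>)\<close>.\<close>

definition arccot :: "real \<Rightarrow> real" where
  "arccot x = pi / 2 - arctan x"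

text \<open>A face \<open>\<phi>\<close> is the set of darts that have \<open>\<phi>\<close> on their left.\<close>

definition pattern_radii :: "'d cell_map \<Rightarrow> ('d set \<Rightarrow> real) \<Rightarrow> ('d set \<Rightarrow> real) set" where
  "pattern_radii M \<Theta> =
     {R. (\<forall>\<phi>\<in>faces M. R \<phi> > 0) \<and>
         (\<forall>\<phi>\<in>faces M.
            (\<Sum>d\<in>\<phi>. arccot ((R \<phi> - R (right_face M d) * cos (\<Theta> (edge M d))) /
                           (R (right_face M d) * sin (\<Theta> (edge M d))))) = pi)}"

text \<open>The developing map identifies the surface isometrically with the unit disk.\<close>

definition uniformizing ::
    "'d cell_map \<Rightarrow> ('d set \<Rightarrow> real) \<Rightarrow> ('d set \<Rightarrow> real) \<Rightarrow> (('d \<times> complex) set \<Rightarrow> complex) \<Rightarrow> bool" where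
  "uniformizing M \<Theta> R dev \<longleftrightarrow>
     homeomorphic_map (surface M \<Theta> R) (top_of_set (ball 0 1)) dev \<and>
     (\<forall>d. \<exists>a b. cmod a = 1 \<and>
        (\<forall>w\<in>dart_triangle M \<Theta> R d. dev (surface_pt M \<Theta> R d w) = a * w + b))"

definition rescale :: "('d set \<Rightarrow> real) \<Rightarrow> ('d set \<Rightarrow> real) \<Rightarrow> 'd set \<Rightarrow> real" where
  "rescale u R \<phi> = exp (u \<phi>) * R \<phi>"

text \<open>
  The piecewise linear map \<open>f\<^sub>u\<close> from the unit disk, identified with \<open>(\<Omega>, \<sigma>(\<Theta>, R))\<close> by \<open>dev\<close>, to
  \<open>(\<Omega>, \<sigma>(\<Theta>, e\<^sup>u R))\<close>. In a triangle, \<open>s\<close> and \<open>t\<close> are the barycentric coordinates belonging to the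
  centres of the right and the left face.
\<close>

definition pl_map ::
    "'d cell_map \<Rightarrow> ('d set \<Rightarrow> real) \<Rightarrow> ('d set \<Rightarrow> real) \<Rightarrow> (('d \<times> complex) set \<Rightarrow> complex) \<Rightarrow>
     ('d set \<Rightarrow> real) \<Rightarrow> complex \<Rightarrow> ('d \<times> complex) set" where
  "pl_map M \<Theta> R dev u z =
     (THE X. \<exists>d s t. 0 \<le> s \<and> 0 \<le> t \<and> s + t \<le> 1 \<and>
        z = dev (surface_pt M \<Theta> R d (s *\<^sub>R right_corner M R d + t *\<^sub>R left_corner M \<Theta> R d)) \<and>
        X = surface_pt M \<Theta> (rescale u R) d
              (s *\<^sub>R right_corner M (rescale u R) d + t *\<^sub>R left_corner M \<Theta> (rescale u R) d))"

text \<open>\<open>|u\<^sub>\<phi> - u\<^sub>\<psi>|\<close> for the dual edge \<open>\<phi>\<psi>\<close> crossing \<open>e\<close>; it does not depend on the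
  orientation chosen for \<open>e\<close>.\<close>

definition dual_diff :: "'d cell_map \<Rightarrow> ('d set \<Rightarrow> real) \<Rightarrow> 'd set \<Rightarrow> real" where
  "dual_diff M u e = (let d = (SOME d. d \<in> e) in \<bar>u (left_face M d) - u (right_face M d)\<bar>)"

definition finite_dirichlet_energy :: "'d cell_map \<Rightarrow> ('d set \<Rightarrow> real) \<Rightarrow> bool" where
  "finite_dirichlet_energy M u \<longleftrightarrow> (\<lambda>e. (dual_diff M u e)\<^sup>2) summable_on edges M"


section \<open>Quasiconformal maps and Beltrami differentials\<close>

text \<open>
  Local isometric coordinates: homeomorphisms onto open subsets of the plane that are given by an
  orientation preserving rigid motion on the part of every triangle they cover.
\<close>

definition isometric_chart ::
    "'d cell_map \<Rightarrow> ('d set \<Rightarrow> real) \<Rightarrow> ('d set \<Rightarrow> real) \<Rightarrow>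
     ('d \<times> complex) set set \<Rightarrow> (('d \<times> complex) set \<Rightarrow> complex) \<Rightarrow> bool" where
  "isometric_chart M \<Theta> R U \<zeta> \<longleftrightarrow>
     openin (surface M \<Theta> R) U \<and>
     (\<exists>W. open W \<and> homeomorphic_map (subtopology (surface M \<Theta> R) U) (top_of_set W) \<zeta>) \<and>
     (\<forall>d. \<exists>a b. cmod a = 1 \<and>
        (\<forall>w\<in>dart_triangle M \<Theta> R d. surface_pt M \<Theta> R d w \<in> U \<longrightarrow> \<zeta> (surface_pt M \<Theta> R d w) = a * w + b))"

definition partial_x :: "(complex \<Rightarrow> complex) \<Rightarrow> complex \<Rightarrow> complex" where
  "partial_x g z = vector_derivative (\<lambda>t. g (z + of_real t)) (at 0)"

definition partial_y :: "(complex \<Rightarrow> complex) \<Rightarrow> complex \<Rightarrow> complex" where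
  "partial_y g z = vector_derivative (\<lambda>t. g (z + \<i> * of_real t)) (at 0)"

definition d_z :: "(complex \<Rightarrow> complex) \<Rightarrow> complex \<Rightarrow> complex" where
  "d_z g z = (partial_x g z - \<i> * partial_y g z) / 2"

definition d_zbar :: "(complex \<Rightarrow> complex) \<Rightarrow> complex \<Rightarrow> complex" where
  "d_zbar g z = (partial_x g z + \<i> * partial_y g z) / 2"

text \<open>The quotient does not depend on the choice of the coordinate \<open>\<zeta>\<close> near \<open>f z\<close>, since
  two of them differ by an orientation preserving rigid motion.\<close>

definition beltrami ::
    "'d cell_map \<Rightarrow> ('d set \<Rightarrow> real) \<Rightarrow> ('d set \<Rightarrow> real) \<Rightarrow>
     (complex \<Rightarrow> ('d \<times> complex) set) \<Rightarrow> complex \<Rightarrow> complex" where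
  "beltrami M \<Theta> R f z =
     (let \<zeta> = (SOME \<zeta>. \<exists>U. isometric_chart M \<Theta> R U \<zeta> \<and> f z \<in> U)
      in d_zbar (\<zeta> \<circ> f) z / d_z (\<zeta> \<circ> f) z)"

definition ac_on_interval :: "real \<Rightarrow> real \<Rightarrow> (real \<Rightarrow> complex) \<Rightarrow> bool" where
  "ac_on_interval a b g \<longleftrightarrow>
     (\<forall>\<epsilon>>0. \<exists>\<delta>>0. \<forall>I. finite I \<and> (\<forall>(s, t)\<in>I. a \<le> s \<and> s \<le> t \<and> t \<le> b) \<and>
        pairwise (\<lambda>(s, t) (s', t'). {s<..<t} \<inter> {s'<..<t'} = {}) I \<and>
        (\<Sum>(s, t)\<in>I. t - s) < \<delta> \<longrightarrow> (\<Sum>(s, t)\<in>I. cmod (g t - g s)) < \<epsilon>)"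

text \<open>Absolute continuity on almost all horizontal and vertical lines.\<close>

definition acl_on :: "complex set \<Rightarrow> (complex \<Rightarrow> complex) \<Rightarrow> bool" where
  "acl_on D g \<longleftrightarrow>
     (\<forall>a b a' b'. cbox (Complex a a') (Complex b b') \<subseteq> D \<longrightarrow>
        (AE y in lborel. y \<in> {a'..b'} \<longrightarrow> ac_on_interval a b (\<lambda>x. g (Complex x y))) \<and>
        (AE x in lborel. x \<in> {a..b} \<longrightarrow> ac_on_interval a' b' (\<lambda>y. g (Complex x y))))"

text \<open>
  The analytic definition of quasiconformality, for maps from the unit disk onto
  \<open>(\<Omega>, \<sigma>(\<Theta>, R))\<close>: homeomorphisms that in local coordinates are absolutely continuous on lines
  with \<open>|\<mu>| \<le> k < 1\<close> almost everywhere.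
\<close>

definition quasiconformal ::
    "'d cell_map \<Rightarrow> ('d set \<Rightarrow> real) \<Rightarrow> ('d set \<Rightarrow> real) \<Rightarrow> (complex \<Rightarrow> ('d \<times> complex) set) \<Rightarrow> bool" where
  "quasiconformal M \<Theta> R f \<longleftrightarrow>
     homeomorphic_map (top_of_set (ball 0 1)) (surface M \<Theta> R) f \<and>
     (\<exists>k. 0 \<le> k \<and> k < 1 \<and>
        (\<forall>U \<zeta>. isometric_chart M \<Theta> R U \<zeta> \<longrightarrow>
           acl_on {z \<in> ball 0 1. f z \<in> U} (\<zeta> \<circ> f) \<and>
           (AE z in lborel. z \<in> ball 0 1 \<and> f z \<in> U \<longrightarrow>
              cmod (d_zbar (\<zeta> \<circ> f) z) \<le> k * cmod (d_z (\<zeta> \<circ> f) z))))"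

definition hyperbolic_L2 :: "(complex \<Rightarrow> complex) \<Rightarrow> bool" where
  "hyperbolic_L2 \<mu> \<longleftrightarrow>
     set_integrable lebesgue (ball 0 1) (\<lambda>z. (cmod (\<mu> z))\<^sup>2 / (1 - (cmod z)\<^sup>2)\<^sup>2)"

text \<open>Distance in the Poincare metric of the unit disk (curvature \<open>-1\<close>).\<close>

definition poincare_dist :: "complex \<Rightarrow> complex \<Rightarrow> real" where
  "poincare_dist z w =
     arcosh (1 + 2 * (cmod (z - w))\<^sup>2 / ((1 - (cmod z)\<^sup>2) * (1 - (cmod w)\<^sup>2)))"

definition hyperbolic_circle :: "complex \<Rightarrow> real \<Rightarrow> complex set" where
  "hyperbolic_circle p \<rho> = {z \<in> ball 0 1. poincare_dist p z = \<rho>}"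

text \<open>The circles of the pattern in the disk; in the triangle of \<open>d\<close>, the centre of the left face of
  \<open>d\<close> is the left corner.\<close>

definition pattern_circle ::
    "'d cell_map \<Rightarrow> ('d set \<Rightarrow> real) \<Rightarrow> ('d set \<Rightarrow> real) \<Rightarrow> (('d \<times> complex) set \<Rightarrow> complex) \<Rightarrow>
     'd \<Rightarrow> complex set" where
  "pattern_circle M \<Theta> R dev d =
     sphere (dev (surface_pt M \<Theta> R d (left_corner M \<Theta> R d))) (R (left_face M d))"

definition hyperbolic_radii_bounded_below ::
    "'d cell_map \<Rightarrow> ('d set \<Rightarrow> real) \<Rightarrow> ('d set \<Rightarrow> real) \<Rightarrow> (('d \<times> complex) set \<Rightarrow> complex) \<Rightarrow> bool" where
  "hyperbolic_radii_bounded_below M \<Theta> R dev \<longleftrightarrow>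
     (\<exists>\<rho>\<^sub>0>0. \<forall>d. \<exists>p\<in>ball 0 1. \<exists>\<rho>\<ge>\<rho>\<^sub>0. pattern_circle M \<Theta> R dev d = hyperbolic_circle p \<rho>)"

end

theory Submission
  imports Defs
begin

text \<open>
  On the triangle of a dart the map is linear. With \<open>\<delta>\<close> the difference of \<open>u\<close> across the edge,
  \<open>\<bar>\<mu>\<bar>\<^sup>2 / (1 - \<bar>\<mu>\<bar>\<^sup>2) = (cosh \<delta> - 1) / (2 sin\<^sup>2 \<Theta>)\<close>, which gives the first claim; for the second it
  remains to bound the hyperbolic areas of the triangles from above, and from below if the hyperbolic
  radii are bounded below.

  For the upper bound, let \<open>Q\<close> be the squared distance from a point to the apex of the triangle that
  contains it. The centre side of a kite lies on the bisector of its two apices, so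
  \<open>Q(z) - \<bar>z\<bar>\<^sup>2\<close> is locally, hence globally, concave on the disk; thus the triangles with a common apex
  form its Voronoi cell, and no vertex lies inside a circumdisk. Vertices accumulate at every boundary
  point by local finiteness, so every circumdisk lies in the unit disk. Two circles in the disk which
  meet at an angle bounded below do so at a distance from the boundary comparable with the smaller
  radius, and integrating the hyperbolic density against the resulting linear lower bound for
  \<open>1 - \<bar>z\<bar>\<close> gives a uniform bound.
\<close>

section \<open>Gluing triangles\<close>

text \<open>The developing map is known only as a homeomorphism that is rigid on each triangle, so
  how placed triangles touch must be read off from the gluing relation. In barycentric coordinates
  the generators of that relation do not mention the radii; this classifies all contacts and also
  makes the piecewise linear map well defined.

  The delicate points for concavity are the circumcentres: triangles meeting there need not share an
  edge, and the bisector comparison does not relate them directly. There are only countably many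
  circumcentres, so almost every segment from an apex misses them, and continuity covers the
  remaining segments.

  The angle enters the area bound through 1 - cos(\<Theta> / 2). If an apex is very close to the
  boundary, the unit vectors from it to the two centres both nearly oppose its position vector,
  while their sum has length 2 cos(\<Theta> / 2). The lower area bound uses that a circle of
  hyperbolic radius \<rho> has Euclidean radius at least tanh(\<rho> / 2) times the boundary
  distance of its Euclidean centre.\<close>

lemma self_in_finite_orbit:
  assumes "inj f" "finite (orbit f x)"
  shows "x \<in> orbit f x"
proof -
  \<comment> \<open>\<open>orbit f x\<close> starts at \<open>f x\<close>, so \<open>x\<close>
    itself has to be recovered: \<open>f\<close> permutes the finite orbit, hence \<open>f x\<close>
    has a preimage there, which by injectivity is \<open>x\<close>.\<close>
  have "f ` orbit f x \<subseteq> orbit f x"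
    by (auto intro: orbit.step)
  then have "f ` orbit f x = orbit f x"
    using assms by (intro endo_inj_surj) (auto intro: inj_on_subset)
  then obtain y where "y \<in> orbit f x" "f y = f x"
    by (metis orbit.base imageE)
  then show ?thesis
    using assms(1) by (metis injD)
qed

lemma orbit_image_step:
  assumes "inj f" "finite (orbit f x)"
  shows "orbit f (f x) = orbit f x"
proof -
  have x: "x \<in> orbit f x" by (rule self_in_finite_orbit[OF assms])
  show ?thesis
    using orbit_subset orbit_swap[OF x orbit.base] orbit_trans by (metis subsetI subset_antisym)
qed

section \<open>Barycentric coordinates in a dart triangle\<close>

definition bary ::
    "'d cell_map \<Rightarrow> ('d set \<Rightarrow> real) \<Rightarrow> ('d set \<Rightarrow> real) \<Rightarrow> 'd \<Rightarrow> real \<Rightarrow> real \<Rightarrow> complex" where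
  "bary M \<Theta> R d s t = s *\<^sub>R right_corner M R d + t *\<^sub>R left_corner M \<Theta> R d"

text \<open>The right corner is real, so the imaginary part alone determines the weight of the left
  corner; \<open>coord_r\<close> removes the left contribution from the real part.\<close>

definition coord_l ::
    "'d cell_map \<Rightarrow> ('d set \<Rightarrow> real) \<Rightarrow> ('d set \<Rightarrow> real) \<Rightarrow> 'd \<Rightarrow> complex \<Rightarrow> real" where
  "coord_l M \<Theta> R d w = Im w / (R (left_face M d) * sin (\<Theta> (edge M d)))"

definition coord_r ::
    "'d cell_map \<Rightarrow> ('d set \<Rightarrow> real) \<Rightarrow> ('d set \<Rightarrow> real) \<Rightarrow> 'd \<Rightarrow> complex \<Rightarrow> real" where
  "coord_r M \<Theta> R d w =
     (Re w - Im w * (cos (\<Theta> (edge M d)) / sin (\<Theta> (edge M d)))) / R (right_face M d)"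

definition open_triangle ::
    "'d cell_map \<Rightarrow> ('d set \<Rightarrow> real) \<Rightarrow> ('d set \<Rightarrow> real) \<Rightarrow> 'd \<Rightarrow> complex set" where
  "open_triangle M \<Theta> R d =
     {w. 0 < coord_r M \<Theta> R d w \<and> 0 < coord_l M \<Theta> R d w \<and> coord_r M \<Theta> R d w + coord_l M \<Theta> R d w < 1}"

lemma continuous_on_coord:
  "continuous_on S (coord_r M \<Theta> R d)" "continuous_on S (coord_l M \<Theta> R d)"
  unfolding coord_r_def coord_l_def divide_inverse by (intro continuous_intros)+

lemma open_open_triangle: "open (open_triangle M \<Theta> R d)"
  unfolding open_triangle_def by (intro open_Collect_conj open_Collect_less continuous_intros continuous_on_coord)

locale cell_complex =
  fixes M :: "'d cell_map" and \<Theta> :: "'d set \<Rightarrow> real"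
  assumes opp_opp [simp]: "opp M (opp M d) = d"
    and bij_nxt: "bij (nxt M)"
    and finite_origin: "finite (origin M d)"
    and finite_left_face: "finite (left_face M d)"
    and Theta_pos: "0 < \<Theta> (edge M d)"
    and Theta_less_pi: "\<Theta> (edge M d) < pi"
begin

lemma inj_opp: "inj (opp M)" by (metis injI opp_opp)

lemma opp_inject [simp]: "opp M d = opp M e \<longleftrightarrow> d = e" by (metis opp_opp)

lemma inj_nxt: "inj (nxt M)" using bij_nxt by (rule bij_is_inj)

lemma inj_star: "inj (nxt M \<circ> opp M)"
  using inj_nxt inj_opp by (rule inj_compose)

lemma edge_opp [simp]: "edge M (opp M d) = edge M d"
  by (auto simp: edge_def)

lemma right_face_opp [simp]: "right_face M (opp M d) = left_face M d"
  by (simp add: right_face_def)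

lemma left_face_opp: "left_face M (opp M d) = right_face M d"
  by (simp add: right_face_def)

lemma self_in_origin: "d \<in> origin M d"
  unfolding origin_def using inj_star finite_origin[of d, unfolded origin_def]
  by (rule self_in_finite_orbit)

lemma self_in_left_face: "d \<in> left_face M d"
  unfolding left_face_def using inj_nxt finite_left_face[of d, unfolded left_face_def]
  by (rule self_in_finite_orbit)

lemma origin_nxt_opp [simp]: "origin M (nxt M (opp M d)) = origin M d"
  unfolding origin_def
  using orbit_image_step[OF inj_star finite_origin[of d, unfolded origin_def]] by simp

lemma left_face_nxt [simp]: "left_face M (nxt M d) = left_face M d"
  unfolding left_face_def
  using orbit_image_step[OF inj_nxt finite_left_face[of d, unfolded left_face_def]] .

lemma finite_same_origin: "finite {e. origin M e = V}"
proof (cases "\<exists>d. origin M d = V")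
  case True
  then have "{e. origin M e = V} \<subseteq> V" "finite V"
    using self_in_origin finite_origin by auto
  then show ?thesis by (rule finite_subset)
qed auto

lemma finite_same_left_face: "finite {e. left_face M e = F}"
proof (cases "\<exists>d. left_face M d = F")
  case True
  then have "{e. left_face M e = F} \<subseteq> F" "finite F"
    using self_in_left_face finite_left_face by auto
  then show ?thesis by (rule finite_subset)
qed auto

lemma finite_same_right_face: "finite {e. right_face M e = F}"
proof -
  have "{e. right_face M e = F} \<subseteq> opp M ` {e. left_face M e = F}"
    by (auto simp: image_iff) (metis left_face_opp opp_opp)
  then show ?thesis
    using finite_same_left_face finite_subset by blast
qed

lemma sin_Theta_pos: "sin (\<Theta> (edge M d)) > 0"
  by (simp add: Theta_pos Theta_less_pi sin_gt_zero)

end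

locale kite_surface = cell_complex M \<Theta> for M :: "'d cell_map" and \<Theta> +
  fixes R :: "'d set \<Rightarrow> real"
  assumes R_pos: "R (left_face M d) > 0"
begin

abbreviation "rc \<equiv> right_corner M R"
abbreviation "lc \<equiv> left_corner M \<Theta> R"
abbreviation "T \<equiv> dart_triangle M \<Theta> R"
abbreviation "T' \<equiv> open_triangle M \<Theta> R"
abbreviation "pt \<equiv> surface_pt M \<Theta> R"
abbreviation "B \<equiv> bary M \<Theta> R"
abbreviation "cr \<equiv> coord_r M \<Theta> R"
abbreviation "cl \<equiv> coord_l M \<Theta> R"

lemma R_pos_right: "R (right_face M d) > 0"
  by (simp add: R_pos right_face_def)

lemma Re_bary: "Re (B d s t) = s * R (right_face M d) + t * R (left_face M d) * cos (\<Theta> (edge M d))"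
  and Im_bary: "Im (B d s t) = t * R (left_face M d) * sin (\<Theta> (edge M d))"
  by (simp_all add: bary_def right_corner_def left_corner_def)

lemma coord_bary [simp]: "cr d (B d s t) = s" "cl d (B d s t) = t"
  using R_pos[of d] R_pos_right[of d] sin_Theta_pos[of d]
  by (simp_all add: coord_r_def coord_l_def Re_bary Im_bary field_simps)

lemma bary_coord [simp]: "B d (cr d w) (cl d w) = w"
  using R_pos[of d] R_pos_right[of d] sin_Theta_pos[of d]
  by (intro complex_eqI) (simp_all add: coord_r_def coord_l_def Re_bary Im_bary field_simps)

lemma bary_inject [simp]: "B d s t = B d s' t' \<longleftrightarrow> s = s' \<and> t = t'"
  by (metis coord_bary)

lemma bary_cases: obtains s t where "w = B d s t"
  by (metis bary_coord)

lemma bary_0 [simp]: "B d 0 0 = 0" by (simp add: bary_def)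

lemma rc_bary: "rc d = B d 1 0" and lc_bary: "lc d = B d 0 1"
  by (simp_all add: bary_def)

lemma bary_in_T [simp]: "B d s t \<in> T d \<longleftrightarrow> 0 \<le> s \<and> 0 \<le> t \<and> s + t \<le> 1"
proof
  assume "B d s t \<in> T d"
  then obtain u v w where "0 \<le> u" "0 \<le> v" "0 \<le> w" "u + v + w = 1" "B d s t = v *\<^sub>R rc d + w *\<^sub>R lc d"
    unfolding dart_triangle_def convex_hull_3 by auto
  then show "0 \<le> s \<and> 0 \<le> t \<and> s + t \<le> 1"
    using bary_inject[of d s t v w] unfolding bary_def by simp
next
  assume *: "0 \<le> s \<and> 0 \<le> t \<and> s + t \<le> 1"
  show "B d s t \<in> T d"
    unfolding dart_triangle_def convex_hull_3 bary_def
    using * by (intro CollectI exI[of _ "1 - s - t"] exI[of _ s] exI[of _ t]) auto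
qed

lemma T_eq: "T d = {w. 0 \<le> cr d w \<and> 0 \<le> cl d w \<and> cr d w + cl d w \<le> 1}"
  using bary_in_T[of d] by (metis (mono_tags, lifting) Collect_cong Collect_mem_eq bary_coord)

lemma bary_in_T' [simp]: "B d s t \<in> T' d \<longleftrightarrow> 0 < s \<and> 0 < t \<and> s + t < 1"
  by (simp add: open_triangle_def)

lemma T'_subset: "T' d \<subseteq> T d"
  by (auto simp: T_eq open_triangle_def)

lemma compact_T: "compact (T d)" and convex_T: "convex (T d)"
  unfolding dart_triangle_def by (auto intro: finite_imp_compact_convex_hull)

lemma closed_T: "closed (T d)" by (simp add: compact_T compact_imp_closed)

text \<open>Barycentric form of the generators. Passing to \<open>opp M d\<close> exchanges the two
  centres, hence the swapped weights; the right side of \<open>d\<close> becomes the left side of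
  the clockwise next dart. The weights do not involve the radii, so the same steps exist for every
  choice of radii.\<close>

inductive gstep :: "'d \<times> complex \<Rightarrow> 'd \<times> complex \<Rightarrow> bool" where
  centre: "0 \<le> t \<Longrightarrow> t \<le> 1 \<Longrightarrow> gstep (d, B d (1 - t) t) (opp M d, B (opp M d) t (1 - t))"
| side: "0 \<le> t \<Longrightarrow> t \<le> 1 \<Longrightarrow> gstep (d, B d t 0) (nxt M (opp M d), B (nxt M (opp M d)) 0 t)"

lemma glue_generators_gstep: "(x, y) \<in> glue_generators M \<Theta> R \<longleftrightarrow> gstep x y"
proof
  assume "(x, y) \<in> glue_generators M \<Theta> R"
  then show "gstep x y"
    unfolding glue_generators_def
  proof (elim UnE CollectE exE conjE Pair_inject, goal_cases)
    case (1 d t)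
    then show ?case using centre[of t d] by (simp add: bary_def add.commute)
  next
    case (2 d t)
    then show ?case using side[of t d] by (simp add: bary_def)
  qed
next
  assume "gstep x y"
  then show "(x, y) \<in> glue_generators M \<Theta> R"
  proof cases
    case (centre t d)
    then show ?thesis unfolding glue_generators_def
      by (intro UnI1 CollectI exI[of _ d] exI[of _ t]) (simp add: bary_def add.commute)
  next
    case (side t d)
    then show ?thesis unfolding glue_generators_def
      by (intro UnI2 CollectI exI[of _ d] exI[of _ t]) (simp add: bary_def)
  qed
qed

lemma gstep_glue: "gstep x y \<Longrightarrow> (x, y) \<in> glue M \<Theta> R"
  unfolding glue_def by (auto simp: glue_generators_gstep)

text \<open>A gluing class lies in every set that meets it and that single generators neither leave
  nor enter. The bounds for classes below come from choosing such sets.\<close>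

lemma glue_saturated:
  assumes "(x, y) \<in> glue M \<Theta> R" "x \<in> C" "\<And>p q. gstep p q \<Longrightarrow> p \<in> C \<longleftrightarrow> q \<in> C"
  shows "y \<in> C"
  using assms(1) unfolding glue_def
proof (induction rule: rtrancl_induct)
  case base
  then show ?case by (rule assms(2))
next
  case (step y z)
  then have "gstep y z \<or> gstep z y"
    by (auto simp: glue_generators_gstep)
  then show ?case
    using assms(3)[of y z] assms(3)[of z y] step.IH by blast
qed

lemma glue_interior:
  assumes "((d, B d s t), y) \<in> glue M \<Theta> R" "0 < s" "0 < t" "s + t < 1"
  shows "y = (d, B d s t)"
proof -
  have "y \<in> {(d, B d s t)}"
    using assms(1)
  proof (rule glue_saturated)
    fix p q assume "gstep p q"
    then show "p \<in> {(d, B d s t)} \<longleftrightarrow> q \<in> {(d, B d s t)}"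
      using assms(2-) by cases auto
  qed simp
  then show ?thesis by simp
qed

text \<open>The centre generator needs s + t = 1. Points with positive apex weight are moved only by
  side generators, which preserve the origin vertex and the apex weight.\<close>

lemma glue_star:
  assumes "((d, B d s t), (e, w)) \<in> glue M \<Theta> R" "0 \<le> s" "0 \<le> t" "s + t < 1"
  shows "origin M e = origin M d \<and> cr e w + cl e w < 1"
proof -
  let ?C = "{(e, w). origin M e = origin M d \<and> 0 \<le> cr e w \<and> 0 \<le> cl e w \<and> cr e w + cl e w < 1}"
  have "(e, w) \<in> ?C"
    using assms(1)
  proof (rule glue_saturated)
    fix p q assume "gstep p q"
    then show "p \<in> ?C \<longleftrightarrow> q \<in> ?C"
      by cases auto
  qed (use assms in auto)
  then show ?thesis by simp
qed

text \<open>Both centre weights are positive, which rules out side generators; the centre generator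
  only exchanges the two listed points.\<close>

lemma glue_side:
  assumes "((d, B d (1 - t) t), y) \<in> glue M \<Theta> R" "0 < t" "t < 1"
  shows "y = (d, B d (1 - t) t) \<or> y = (opp M d, B (opp M d) t (1 - t))"
proof -
  let ?C = "{(d, B d (1 - t) t), (opp M d, B (opp M d) t (1 - t))}"
  have "y \<in> ?C"
    using assms(1)
  proof (rule glue_saturated)
    fix p q assume "gstep p q"
    then show "p \<in> ?C \<longleftrightarrow> q \<in> ?C"
    proof cases
      case (centre t' d')
      then show ?thesis
        by (cases "d' = d"; cases "d' = opp M d") auto
    next
      case (side t' d')
      then show ?thesis using assms(2,3) by auto
    qed
  qed simp
  then show ?thesis by blast
qed

text \<open>All corners at the circumcentre of \<open>F\<close>, seen from darts on either side. It
  serves as a saturated bound for gluing classes; that it is a single class is not claimed.\<close>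

definition corner_class :: "'d set \<Rightarrow> ('d \<times> complex) set" where
  "corner_class F = {(d, rc d) | d. right_face M d = F} \<union> {(d, lc d) | d. left_face M d = F}"

lemma glue_corner:
  assumes "(x, y) \<in> glue M \<Theta> R" "x \<in> corner_class F"
  shows "y \<in> corner_class F"
  using assms
proof (rule glue_saturated)
  fix p q assume "gstep p q"
  then show "p \<in> corner_class F \<longleftrightarrow> q \<in> corner_class F"
  proof cases
    case (centre t d)
    have "p \<in> corner_class F \<longleftrightarrow> (t = 0 \<and> right_face M d = F) \<or> (t = 1 \<and> left_face M d = F)"
      unfolding corner_class_def rc_bary lc_bary centre by auto
    moreover have "q \<in> corner_class F \<longleftrightarrow> (t = 0 \<and> right_face M d = F) \<or> (t = 1 \<and> left_face M d = F)"
      unfolding corner_class_def rc_bary lc_bary centre by (auto simp: left_face_opp)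
    ultimately show ?thesis by simp
  next
    case (side t d)
    have "p \<in> corner_class F \<longleftrightarrow> (t = 1 \<and> right_face M d = F)"
      unfolding corner_class_def rc_bary lc_bary side by auto
    moreover have "q \<in> corner_class F \<longleftrightarrow> (t = 1 \<and> right_face M d = F)"
      unfolding corner_class_def rc_bary lc_bary side by (auto simp: left_face_opp)
    ultimately show ?thesis by simp
  qed
qed

lemma glue_T:
  assumes "(x, y) \<in> glue M \<Theta> R" "x \<in> Sigma UNIV T"
  shows "y \<in> Sigma UNIV T"
  using assms
proof (rule glue_saturated)
  fix p q assume "gstep p q"
  then show "p \<in> Sigma UNIV T \<longleftrightarrow> q \<in> Sigma UNIV T"
    by cases auto
qed

text \<open>A generous finite bound for the darts whose triangles can touch that of
  \<open>d\<close>.\<close>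

definition nbrs :: "'d \<Rightarrow> 'd set" where
  "nbrs d = {e. origin M e = origin M d} \<union> {opp M d, d} \<union>
     {e. right_face M e = right_face M d} \<union> {e. left_face M e = right_face M d} \<union>
     {e. right_face M e = left_face M d} \<union> {e. left_face M e = left_face M d}"

lemma finite_nbrs: "finite (nbrs d)"
  unfolding nbrs_def
  by (intro finite_UnI finite_same_origin finite_same_left_face finite_same_right_face) auto

text \<open>The weights of the point decide the kind of contact: positive apex weight, relative
  interior of the centre side (same or opposite dart), or a circumcentre.\<close>

lemma glue_cases:
  assumes "((d, w), (e, w')) \<in> glue M \<Theta> R" "w \<in> T d"
  obtains "origin M e = origin M d" "cr d w + cl d w < 1" "cr e w' + cl e w' < 1"
  | t where "0 < t" "t < 1" "w = B d (1 - t) t" "e = d" "w' = w"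
  | t where "0 < t" "t < 1" "w = B d (1 - t) t" "e = opp M d" "w' = B e t (1 - t)"
  | F where "(d, w) \<in> corner_class F" "(e, w') \<in> corner_class F"
proof -
  obtain s t where w: "w = B d s t" by (rule bary_cases)
  with assms have st: "0 \<le> s" "0 \<le> t" "s + t \<le> 1" by auto
  consider "s + t < 1" | "s = 1 - t" "0 < t" "t < 1" | "s = 1" "t = 0" | "s = 0" "t = 1"
    using st by linarith
  then show thesis
  proof cases
    case 1
    then show thesis using glue_star[of d s t e w'] assms st w that(1) by simp
  next
    case 2
    then show thesis using glue_side[of d t "(e, w')"] assms(1) w that(2,3) by auto
  next
    case 3
    then have "(d, w) \<in> corner_class (right_face M d)"
      by (auto simp: w corner_class_def rc_bary)
    then show thesis using glue_corner assms(1) that(4) by blast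
  next
    case 4
    then have "(d, w) \<in> corner_class (left_face M d)"
      by (auto simp: w corner_class_def lc_bary)
    then show thesis using glue_corner assms(1) that(4) by blast
  qed
qed

lemma glue_nbrs:
  assumes "((d, w), (e, w')) \<in> glue M \<Theta> R" "w \<in> T d"
  shows "d \<in> nbrs e"
  using assms
  by (cases rule: glue_cases) (auto simp: nbrs_def corner_class_def)

end

section \<open>The uniformized surface and local finiteness\<close>

text \<open>The dart coordinate is discrete, so an open set may be prescribed independently in each
  triangle. This reduces the quotient topology to conditions on single triangles.\<close>

lemma openin_Sigma_discrete:
  fixes S :: "'d \<Rightarrow> 'a::topological_space set"
  shows "openin (subtopology (prod_topology (discrete_topology UNIV) euclidean) (Sigma UNIV S)) A \<longleftrightarrow>
     A \<subseteq> Sigma UNIV S \<and> (\<forall>d. openin (top_of_set (S d)) {w. (d, w) \<in> A})"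
proof (intro iffI conjI allI)
  assume "openin (subtopology (prod_topology (discrete_topology UNIV) euclidean) (Sigma UNIV S)) A"
  then obtain V where V: "openin (prod_topology (discrete_topology UNIV) euclidean) V"
    and A: "A = V \<inter> Sigma UNIV S"
    by (auto simp: openin_subtopology)
  show "A \<subseteq> Sigma UNIV S" using A by blast
  fix d :: 'd
  have "continuous_map euclidean (prod_topology (discrete_topology UNIV) euclidean) (\<lambda>w. (d, w))"
    by (intro continuous_map_pairedI) auto
  then have "openin euclidean {w \<in> topspace euclidean. (d, w) \<in> V}"
    using V by (rule openin_continuous_map_preimage)
  then show "openin (top_of_set (S d)) {w. (d, w) \<in> A}"
    unfolding A openin_open by (intro exI[of _ "{w. (d, w) \<in> V}"]) auto
next
  assume *: "A \<subseteq> Sigma UNIV S \<and> (\<forall>d. openin (top_of_set (S d)) {w. (d, w) \<in> A})"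
  then have "\<forall>d. \<exists>V. open V \<and> {w. (d, w) \<in> A} = S d \<inter> V"
    unfolding openin_open by blast
  then obtain V where V: "\<And>d. open (V d)" "\<And>d. {w. (d, w) \<in> A} = S d \<inter> V d"
    by metis
  have "openin (prod_topology (discrete_topology UNIV) euclidean) (\<Union>d. {d} \<times> V d)"
    using V(1) by (intro openin_Union) (auto simp: openin_prod_Times_iff)
  moreover have "A = (\<Union>d. {d} \<times> V d) \<inter> Sigma UNIV S"
    using * V(2) by (auto simp: set_eq_iff)
  ultimately show "openin (subtopology (prod_topology (discrete_topology UNIV) euclidean) (Sigma UNIV S)) A"
    by (auto simp: openin_subtopology)
qed

context kite_surface
begin

lemma pt_eq_iff: "pt d w = pt e w' \<longleftrightarrow> ((d, w), (e, w')) \<in> glue M \<Theta> R"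
  unfolding surface_pt_def by (rule eq_equiv_class_iff[OF equiv_glue]) auto

lemma surface_carrier_eq: "surface_carrier M \<Theta> R = {pt d w | d w. w \<in> T d}"
  unfolding surface_carrier_def surface_pt_def quotient_def by auto

lemma mem_Union_surface_iff:
  assumes "U \<subseteq> surface_carrier M \<Theta> R"
  shows "(d, w) \<in> \<Union>U \<longleftrightarrow> w \<in> T d \<and> pt d w \<in> U"
proof
  assume "(d, w) \<in> \<Union>U"
  then obtain e w' where *: "w' \<in> T e" "(d, w) \<in> pt e w'" "pt e w' \<in> U"
    using assms unfolding surface_carrier_eq by blast
  then have g: "((e, w'), (d, w)) \<in> glue M \<Theta> R" by (simp add: surface_pt_def)
  then have "pt e w' = pt d w" by (simp add: pt_eq_iff)
  then show "w \<in> T d \<and> pt d w \<in> U" using * glue_T[OF g] by simp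
next
  assume "w \<in> T d \<and> pt d w \<in> U"
  moreover have "(d, w) \<in> pt d w"
    unfolding surface_pt_def using equiv_class_self[OF equiv_glue] by blast
  ultimately show "(d, w) \<in> \<Union>U" by blast
qed

lemma openin_surface_iff:
  "openin (surface M \<Theta> R) U \<longleftrightarrow>
     U \<subseteq> surface_carrier M \<Theta> R \<and> (\<forall>d. openin (top_of_set (T d)) {w \<in> T d. pt d w \<in> U})"
proof -
  have "\<Union>U \<subseteq> Sigma UNIV T" if "U \<subseteq> surface_carrier M \<Theta> R"
    by (intro subrelI) (simp add: mem_Union_surface_iff[OF that] del: Union_iff)
  then show ?thesis
    unfolding openin_surface openin_Sigma_discrete by (auto simp: mem_Union_surface_iff simp del: Union_iff)
qed

lemma topspace_surface: "topspace (surface M \<Theta> R) = surface_carrier M \<Theta> R"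
proof -
  have "{w \<in> T d. pt d w \<in> surface_carrier M \<Theta> R} = T d" for d
    unfolding surface_carrier_eq by blast
  then have "openin (surface M \<Theta> R) (surface_carrier M \<Theta> R)"
    unfolding openin_surface_iff by simp
  moreover have "topspace (surface M \<Theta> R) \<subseteq> surface_carrier M \<Theta> R"
    using openin_topspace[of "surface M \<Theta> R"] unfolding openin_surface_iff by blast
  ultimately show ?thesis
    using openin_subset by blast
qed

lemma pt_in_carrier: "w \<in> T d \<Longrightarrow> pt d w \<in> surface_carrier M \<Theta> R"
  unfolding surface_carrier_eq by blast

text \<open>The side generator at parameter 0 carries apex to apex, and its iterates run through the
  whole vertex orbit.\<close>

lemma pt_0_eq:
  assumes "origin M e = origin M d"
  shows "pt e 0 = pt d 0"
proof -
  have "e \<in> orbit (nxt M \<circ> opp M) d"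
    using assms self_in_origin[of e] by (simp add: origin_def)
  then show ?thesis
  proof induction
    case base
    have "gstep (d, 0) (nxt M (opp M d), 0)" using side[of 0 d] by simp
    then have "pt d 0 = pt (nxt M (opp M d)) 0"
      by (simp add: gstep_glue pt_eq_iff)
    then show ?case by simp
  next
    case (step y)
    have "gstep (y, 0) (nxt M (opp M y), 0)" using side[of 0 y] by simp
    then have "pt y 0 = pt (nxt M (opp M y)) 0"
      by (simp add: gstep_glue pt_eq_iff)
    then show ?case using step by simp
  qed
qed

end

section \<open>Triangles placed in the disk\<close>

locale uniformized_surface = kite_surface M \<Theta> R for M :: "'d cell_map" and \<Theta> R +
  fixes dev :: "('d \<times> complex) set \<Rightarrow> complex"
  assumes uniformizing: "uniformizing M \<Theta> R dev"
begin

abbreviation "\<D> \<equiv> ball (0::complex) 1"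

definition apex :: "'d \<Rightarrow> complex" where "apex d = dev (pt d 0)"

definition rot :: "'d \<Rightarrow> complex" where
  "rot d = (SOME a. \<exists>b. cmod a = 1 \<and> (\<forall>w\<in>T d. dev (pt d w) = a * w + b))"

text \<open>The rigid motion of the whole plane that \<open>dev\<close> induces on the triangle of
  \<open>d\<close>. Its translation part is forced to be the image of the apex, so only the rotation
  is chosen.\<close>

definition place :: "'d \<Rightarrow> complex \<Rightarrow> complex" where "place d w = rot d * w + apex d"

definition tri :: "'d \<Rightarrow> complex set" where "tri d = place d ` T d"

definition otri :: "'d \<Rightarrow> complex set" where "otri d = place d ` T' d"

definition unplace :: "'d \<Rightarrow> complex \<Rightarrow> complex" where "unplace d z = (z - apex d) / rot d"

lemma dev_homeo: "homeomorphic_map (surface M \<Theta> R) (top_of_set \<D>) dev"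
  using uniformizing by (simp add: uniformizing_def)

lemma zero_in_T [simp]: "0 \<in> T d"
  using bary_in_T[of d 0 0] by simp

lemma rot_aux: "cmod (rot d) = 1 \<and> (\<forall>w\<in>T d. dev (pt d w) = place d w)"
proof -
  have "\<exists>b. cmod (rot d) = 1 \<and> (\<forall>w\<in>T d. dev (pt d w) = rot d * w + b)"
    unfolding rot_def using uniformizing
    by (intro someI_ex[of "\<lambda>a. \<exists>b. cmod a = 1 \<and> (\<forall>w\<in>T d. dev (pt d w) = a * w + b)"])
      (auto simp: uniformizing_def)
  then obtain b where "cmod (rot d) = 1" and b: "\<forall>w\<in>T d. dev (pt d w) = rot d * w + b" by blast
  moreover have "b = apex d"
    using b[rule_format, of 0] by (simp add: apex_def)
  ultimately show ?thesis by (simp add: place_def)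
qed

lemma cmod_rot [simp]: "cmod (rot d) = 1" using rot_aux by blast

lemma rot_nz [simp]: "rot d \<noteq> 0" using cmod_rot[of d] by fastforce

lemma dev_pt: "w \<in> T d \<Longrightarrow> dev (pt d w) = place d w" using rot_aux by blast

lemma unplace_place [simp]: "unplace d (place d w) = w"
  and place_unplace [simp]: "place d (unplace d z) = z"
  by (simp_all add: unplace_def place_def)

lemma place_inject [simp]: "place d w = place d w' \<longleftrightarrow> w = w'"
  by (metis unplace_place)

lemma place_0 [simp]: "place d 0 = apex d"
  by (simp add: place_def)

lemma tri_iff: "z \<in> tri d \<longleftrightarrow> unplace d z \<in> T d"
  unfolding tri_def by (auto intro: rev_image_eqI[of "unplace d z"])

lemma otri_iff: "z \<in> otri d \<longleftrightarrow> unplace d z \<in> T' d"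
  unfolding otri_def by (auto intro: rev_image_eqI[of "unplace d z"])

lemma dist_place: "cmod (place d w - place d w') = cmod (w - w')"
proof -
  have "place d w - place d w' = rot d * (w - w')" by (simp add: place_def algebra_simps)
  then show ?thesis by (simp add: norm_mult)
qed

lemma continuous_on_place: "continuous_on S (place d)"
proof -
  have "continuous_on S (\<lambda>w. rot d * w + apex d)" by (intro continuous_intros)
  then show ?thesis by (simp add: place_def [abs_def])
qed

lemma continuous_on_unplace: "continuous_on S (unplace d)"
proof -
  have "continuous_on S (\<lambda>z. (z - apex d) / rot d)" by (intro continuous_intros) auto
  then show ?thesis by (simp add: unplace_def [abs_def])
qed

lemma otri_subset: "otri d \<subseteq> tri d"
  using T'_subset by (auto simp: otri_def tri_def)

lemma open_otri: "open (otri d)"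
proof -
  have "otri d = unplace d -` T' d" by (auto simp: otri_iff)
  then show ?thesis
    by (simp add: open_open_triangle continuous_on_unplace open_vimage)
qed

lemma compact_tri: "compact (tri d)"
  unfolding tri_def by (intro compact_continuous_image compact_T continuous_on_place)

lemma closed_tri: "closed (tri d)"
  by (simp add: compact_tri compact_imp_closed)

lemma convex_tri: "convex (tri d)"
proof -
  have "tri d = (\<lambda>x. apex d + x) ` ((\<lambda>x. rot d * x) ` T d)"
    by (auto simp: tri_def place_def image_image add.commute)
  moreover have "linear ((*) (rot d))"
    by (intro linearI) (auto simp: algebra_simps)
  ultimately show ?thesis
    by (simp add: convex_T convex_linear_image convex_translation)
qed

lemma dev_image: "dev ` surface_carrier M \<Theta> R = \<D>"
  using homeomorphic_imp_surjective_map[OF dev_homeo] by (simp add: topspace_surface)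

lemma dev_inj: "inj_on dev (surface_carrier M \<Theta> R)"
  using homeomorphic_imp_injective_map[OF dev_homeo] by (simp add: topspace_surface)

lemma Union_tri: "(\<Union>d. tri d) = \<D>"
proof -
  have "(\<Union>d. tri d) = dev ` surface_carrier M \<Theta> R"
    unfolding surface_carrier_eq tri_def by (fastforce simp: dev_pt image_iff)
  then show ?thesis by (simp add: dev_image)
qed

lemma tri_subset: "tri d \<subseteq> \<D>"
  using Union_tri by blast

text \<open>Injectivity of \<open>dev\<close> turns coincidence of placed points into gluing, whose
  classes are already understood.\<close>

lemma place_eq_iff:
  assumes "w \<in> T d" "w' \<in> T e"
  shows "place d w = place e w' \<longleftrightarrow> ((d, w), (e, w')) \<in> glue M \<Theta> R"
proof -
  have "place d w = place e w' \<longleftrightarrow> pt d w = pt e w'"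
    using assms dev_pt dev_inj[THEN inj_on_eq_iff, of "pt d w" "pt e w'"] pt_in_carrier by metis
  then show ?thesis by (simp add: pt_eq_iff)
qed

text \<open>Since \<open>dev\<close> is a homeomorphism from the quotient, the disk carries the weak
  topology of its closed triangles. Local finiteness is not built in;
  \<open>finite_tri_compact\<close> extracts it from this.\<close>

lemma open_disk_iff:
  assumes "V \<subseteq> \<D>"
  shows "open V \<longleftrightarrow> (\<forall>d. openin (top_of_set (T d)) {w \<in> T d. place d w \<in> V})"
proof -
  have V: "V = dev ` {X \<in> surface_carrier M \<Theta> R. dev X \<in> V}"
    using assms unfolding dev_image[symmetric] by auto
  have "open V \<longleftrightarrow> openin (top_of_set \<D>) V"
    using assms by (simp add: openin_open_eq)
  also have "\<dots> \<longleftrightarrow> openin (surface M \<Theta> R) {X \<in> surface_carrier M \<Theta> R. dev X \<in> V}"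
    using homeomorphic_map_openness[OF dev_homeo, of "{X \<in> surface_carrier M \<Theta> R. dev X \<in> V}"]
    unfolding V[symmetric] topspace_surface by simp
  also have "\<dots> \<longleftrightarrow> (\<forall>d. openin (top_of_set (T d)) {w \<in> T d. place d w \<in> V})"
    unfolding openin_surface_iff by (auto simp: pt_in_carrier dev_pt cong: conj_cong)
  finally show ?thesis .
qed

lemma closed_disk_iff:
  assumes "C \<subseteq> \<D>"
  shows "closedin (top_of_set \<D>) C \<longleftrightarrow> (\<forall>d. closed (C \<inter> tri d))"
proof -
  have "closedin (top_of_set \<D>) C \<longleftrightarrow> open (\<D> - C)"
    using assms by (simp add: closedin_def openin_open_eq Diff_Diff_Int inf.absorb2)
  also have "\<dots> \<longleftrightarrow> (\<forall>d. openin (top_of_set (T d)) {w \<in> T d. place d w \<in> \<D> - C})"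
    by (rule open_disk_iff) auto
  also have "\<dots> \<longleftrightarrow> (\<forall>d. closed (C \<inter> tri d))"
  proof (rule all_cong1)
    fix d
    have "{w \<in> T d. place d w \<in> \<D> - C} = T d - {w \<in> T d. place d w \<in> C}"
      using tri_subset[of d] by (auto simp: tri_def)
    then have "openin (top_of_set (T d)) {w \<in> T d. place d w \<in> \<D> - C}
        \<longleftrightarrow> closedin (top_of_set (T d)) {w \<in> T d. place d w \<in> C}"
      by (simp add: closedin_def Collect_restrict)
    also have "\<dots> \<longleftrightarrow> closed {w \<in> T d. place d w \<in> C}"
      by (blast intro: closed_subset dest: closedin_closed_trans[OF _ closed_T])
    also have "\<dots> \<longleftrightarrow> closed (C \<inter> tri d)"
    proof
      assume "closed {w \<in> T d. place d w \<in> C}"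
      then have "closed (unplace d -` {w \<in> T d. place d w \<in> C})"
        by (intro closed_vimage continuous_on_place continuous_on_unplace)
      moreover have "unplace d -` {w \<in> T d. place d w \<in> C} = C \<inter> tri d"
        by (auto simp: tri_iff)
      ultimately show "closed (C \<inter> tri d)" by simp
    next
      assume "closed (C \<inter> tri d)"
      then have "closed (place d -` (C \<inter> tri d))"
        by (intro closed_vimage continuous_on_place continuous_on_unplace)
      moreover have "place d -` (C \<inter> tri d) = {w \<in> T d. place d w \<in> C}"
        by (auto simp: tri_iff)
      ultimately show "closed {w \<in> T d. place d w \<in> C}" by simp
    qed
    finally show "openin (top_of_set (T d)) {w \<in> T d. place d w \<in> \<D> - C} \<longleftrightarrow> closed (C \<inter> tri d)" .
  qed
  finally show ?thesis .
qed

lemma tri_cases: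
  assumes "z \<in> tri d" "z \<in> tri e"
  obtains "apex e = apex d"
  | t where "0 < t" "t < 1" "z = place d (B d (1 - t) t)" "e = opp M d" "z = place e (B e t (1 - t))"
  | F where "z \<in> {place d (rc d), place d (lc d)}"
      "(d, unplace d z) \<in> corner_class F" "(e, unplace e z) \<in> corner_class F"
proof -
  have g: "((d, unplace d z), (e, unplace e z)) \<in> glue M \<Theta> R"
    using assms place_eq_iff[of "unplace d z" d "unplace e z" e] by (auto simp: tri_iff)
  show thesis
  proof (rule glue_cases[OF g])
    show "unplace d z \<in> T d" using assms by (simp add: tri_iff)
  next
    assume "origin M e = origin M d"
    then have "apex e = apex d" using pt_0_eq[of e d] by (simp add: apex_def)
    then show thesis by (rule that(1))
  next
    fix t assume "e = d"
    then show thesis using that(1) by simp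
  next
    fix t assume "0 < t" "t < 1" "unplace d z = B d (1 - t) t" "e = opp M d" "unplace e z = B e t (1 - t)"
    then show thesis using that(2)[of t] by (metis place_unplace)
  next
    fix F assume F: "(d, unplace d z) \<in> corner_class F" "(e, unplace e z) \<in> corner_class F"
    then have "unplace d z \<in> {rc d, lc d}" by (auto simp: corner_class_def)
    then have "z \<in> {place d (rc d), place d (lc d)}"
      by (metis empty_iff insert_iff place_unplace)
    then show thesis using F that(3) by blast
  qed
qed

lemma otri_disjoint:
  assumes "z \<in> otri d" "z \<in> tri e"
  shows "e = d"
proof -
  have "z \<in> tri d" using assms otri_subset by blast
  then have g: "((d, unplace d z), (e, unplace e z)) \<in> glue M \<Theta> R"
    using assms place_eq_iff[of "unplace d z" d "unplace e z" e] by (auto simp: tri_iff)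
  obtain s t where st: "unplace d z = B d s t" by (rule bary_cases)
  then have "0 < s" "0 < t" "s + t < 1" using assms(1) by (auto simp: otri_iff)
  then show ?thesis using glue_interior g st by (metis Pair_inject)
qed

lemma tri_nbrs: "z \<in> tri d \<Longrightarrow> z \<in> tri e \<Longrightarrow> d \<in> nbrs e"
  using place_eq_iff[of "unplace d z" d "unplace e z" e] glue_nbrs
  by (auto simp: tri_iff)

text \<open>Points chosen in infinitely many triangles would form a closed discrete set, since each triangle
  meets only finitely many others.\<close>

lemma finite_tri_compact:
  assumes K: "compact K" "K \<subseteq> \<D>"
  shows "finite {d. tri d \<inter> K \<noteq> {}}"
proof (rule ccontr)
  assume inf: "infinite {d. tri d \<inter> K \<noteq> {}}"
  define S where "S = {d. tri d \<inter> K \<noteq> {}}"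
  have "\<forall>d\<in>S. \<exists>x. x \<in> tri d \<inter> K" by (auto simp: S_def)
  then obtain x where x: "\<And>d. d \<in> S \<Longrightarrow> x d \<in> tri d \<inter> K" by metis
  have fin: "finite (x ` S \<inter> tri e)" for e
  proof (rule finite_subset)
    show "x ` S \<inter> tri e \<subseteq> x ` nbrs e"
      using x tri_nbrs by blast
    show "finite (x ` nbrs e)" by (simp add: finite_nbrs)
  qed
  \<comment> \<open>Every subset is closed, not just the whole set: a limit point can then be
    deleted and would still have to belong.\<close>
  have closedin: "closedin (top_of_set \<D>) Y" if "Y \<subseteq> x ` S" for Y
  proof -
    have "x ` S \<subseteq> \<D>" using x K(2) by blast
    then have "Y \<subseteq> \<D>" using that by (rule order_trans[rotated])
    moreover have "finite (Y \<inter> tri e)" for e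
      by (rule finite_subset[OF _ fin[of e]]) (use that in blast)
    ultimately show ?thesis
      by (simp add: closed_disk_iff finite_imp_closed)
  qed
  have "infinite (x ` S)"
  proof
    assume "finite (x ` S)"
    then obtain y where "y \<in> x ` S" and i: "infinite {d \<in> S. x d = y}"
      using inf pigeonhole_infinite[of S x] unfolding S_def by auto
    then obtain e where e: "y \<in> tri e" using x by blast
    have "{d \<in> S. x d = y} \<subseteq> nbrs e"
      using x e tri_nbrs by blast
    then show False using i finite_nbrs finite_subset by blast
  qed
  moreover have "x ` S \<subseteq> K" using x by blast
  ultimately obtain l where l: "l \<in> K" "l islimpt (x ` S)"
    using K(1) by (metis compact_eq_Bolzano_Weierstrass)
  have "closedin (top_of_set \<D>) (x ` S - {l})" by (rule closedin) auto
  moreover have "l islimpt (x ` S - {l})"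
    using l(2) islimpt_punctured by blast
  moreover have "l \<in> \<D>" using l K by blast
  ultimately have "l \<in> x ` S - {l}"
    by (meson closedin_limpt)
  then show False by blast
qed

end

section \<open>Circumdisks lie in the unit disk\<close>

text \<open>An affine function touching g from above near each interior point expresses local
  concavity. If g 1 > 0, subtracting the chord leaves h with a negative interior minimum; there the
  touching affine function forces h to be locally constant, which is impossible at the leftmost
  minimiser.\<close>

lemma concave_from_local_majorants:
  fixes g :: "real \<Rightarrow> real"
  assumes cont: "continuous_on {0..1} g" and "g 0 = 0"
    and start: "\<epsilon>\<^sub>1 > 0" "\<And>t. 0 \<le> t \<Longrightarrow> t < \<epsilon>\<^sub>1 \<Longrightarrow> t \<le> 1 \<Longrightarrow> g t \<le> 0"
    and maj: "\<And>t\<^sub>0. 0 < t\<^sub>0 \<Longrightarrow> t\<^sub>0 < 1 \<Longrightarrow>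
        \<exists>k. \<exists>\<epsilon>>0. \<forall>t\<in>{0..1}. \<bar>t - t\<^sub>0\<bar> < \<epsilon> \<longrightarrow> g t \<le> g t\<^sub>0 + k * (t - t\<^sub>0)"
  shows "g 1 \<le> 0"
proof (rule ccontr)
  assume "\<not> g 1 \<le> 0"
  then have g1: "g 1 > 0" by simp
  define h where "h t = g t - t * g 1" for t
  have conth: "continuous_on {0..1} h"
    unfolding h_def by (intro continuous_intros cont)
  obtain m where m: "m \<in> {0..1}" "\<And>t. t \<in> {0..1} \<Longrightarrow> h m \<le> h t"
    using continuous_attains_inf[OF _ _ conth] by auto
  define \<tau> where "\<tau> = min (\<epsilon>\<^sub>1 / 2) 1"
  have "0 < \<tau>" "\<tau> < \<epsilon>\<^sub>1" "\<tau> \<le> 1" using start(1) by (auto simp: \<tau>_def)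
  then have "g \<tau> \<le> 0" "0 < \<tau> * g 1"
    using start(2)[of \<tau>] g1 by simp_all
  then have "h \<tau> < 0" by (simp add: h_def)
  then have hm: "h m < 0" using m(2)[of \<tau>] \<open>0 < \<tau>\<close> \<open>\<tau> \<le> 1\<close> by simp
  have h01: "h 0 = 0" "h 1 = 0" using \<open>g 0 = 0\<close> by (auto simp: h_def)
  define S where "S = {t \<in> {0..1}. h t = h m}"
  have "closed S"
  proof -
    have "S = {0..1} \<inter> h -` {h m}" by (auto simp: S_def)
    then show ?thesis
      using continuous_on_closed_vimage[THEN iffD1, OF _ conth] by (metis closed_atLeastAtMost closed_singleton inf_commute)
  qed
  moreover have "S \<noteq> {}" "bdd_below S" using m by (auto simp: S_def)
  ultimately have "Inf S \<in> S" by (simp add: closed_contains_Inf)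
  then obtain t\<^sub>0 where t0: "t\<^sub>0 \<in> S" "\<And>t. t \<in> S \<Longrightarrow> t\<^sub>0 \<le> t"
    using cInf_lower[OF _ \<open>bdd_below S\<close>] by blast
  then have "t\<^sub>0 \<in> {0..1}" and ht0: "h t\<^sub>0 = h m"
    by (simp_all add: S_def)
  moreover have "t\<^sub>0 \<noteq> 0" "t\<^sub>0 \<noteq> 1" using ht0 hm h01 by (metis less_irrefl)+
  ultimately have "0 < t\<^sub>0" "t\<^sub>0 < 1" by simp_all
  then obtain k \<epsilon> where "\<epsilon> > 0"
    and k: "\<And>t. t \<in> {0..1} \<Longrightarrow> \<bar>t - t\<^sub>0\<bar> < \<epsilon> \<Longrightarrow> g t \<le> g t\<^sub>0 + k * (t - t\<^sub>0)"
    using maj[of t\<^sub>0] by metis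
  define s where "s = min (\<epsilon> / 2) (min t\<^sub>0 (1 - t\<^sub>0))"
  have s: "0 < s" "s < \<epsilon>" "s \<le> t\<^sub>0" "s \<le> 1 - t\<^sub>0"
    using \<open>\<epsilon> > 0\<close> \<open>0 < t\<^sub>0\<close> \<open>t\<^sub>0 < 1\<close> by (auto simp: s_def)
  have "h (t\<^sub>0 + s) \<le> h t\<^sub>0 + (k - g 1) * s" "h (t\<^sub>0 - s) \<le> h t\<^sub>0 - (k - g 1) * s"
    using k[of "t\<^sub>0 + s"] k[of "t\<^sub>0 - s"] s by (auto simp: h_def algebra_simps)
  moreover have "h t\<^sub>0 \<le> h (t\<^sub>0 + s)" "h t\<^sub>0 \<le> h (t\<^sub>0 - s)"
    using m(2) s ht0 \<open>0 < t\<^sub>0\<close> \<open>t\<^sub>0 < 1\<close> by auto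
  ultimately have "h (t\<^sub>0 - s) = h t\<^sub>0" by linarith
  then have "t\<^sub>0 - s \<in> S" using s ht0 \<open>t\<^sub>0 < 1\<close> by (auto simp: S_def)
  then show False using t0(2) s by fastforce
qed

lemma cmod_diff_sq: "(cmod (z - a))\<^sup>2 = (cmod z)\<^sup>2 - 2 * (z \<bullet> a) + (cmod a)\<^sup>2"
  by (simp add: power2_norm_eq_inner inner_diff inner_commute)

text \<open>The quadratic terms cancel, so the difference of two squared distances is affine in z.
  Both the bisectors and the affine majorants of the Voronoi argument come from this.\<close>

lemma cmod_diff_sq_diff:
  "(cmod (z - a))\<^sup>2 - (cmod (z - b))\<^sup>2 = 2 * (z \<bullet> (b - a)) + (cmod a)\<^sup>2 - (cmod b)\<^sup>2"
  by (simp add: cmod_diff_sq inner_diff algebra_simps)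

section \<open>Each point is nearest to its own apex\<close>

context uniformized_surface
begin

lemma cmod_bary_sq:
  "(cmod (B d s t))\<^sup>2 = (s * R (right_face M d))\<^sup>2 + (t * R (left_face M d))\<^sup>2
     + 2 * (s * R (right_face M d)) * (t * R (left_face M d)) * cos (\<Theta> (edge M d))"
proof -
  have *: "(a + b * c)\<^sup>2 + (b * sn)\<^sup>2 = a\<^sup>2 + b\<^sup>2 + 2 * a * b * c" if "sn\<^sup>2 + c\<^sup>2 = 1" for a b c sn :: real
  proof -
    have "(a + b * c)\<^sup>2 + (b * sn)\<^sup>2 = a\<^sup>2 + b\<^sup>2 * (sn\<^sup>2 + c\<^sup>2) + 2 * a * b * c"
      by (simp add: power2_eq_square algebra_simps)
    then show ?thesis using that by simp
  qed
  show ?thesis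
    unfolding cmod_power2 Re_bary Im_bary by (rule *) (rule sin_cos_squared_add)
qed

lemma cmod_rc: "cmod (rc d) = R (right_face M d)"
  using R_pos_right[of d] by (simp add: right_corner_def)

lemma cmod_lc: "cmod (lc d) = R (left_face M d)"
  using R_pos[of d] by (simp add: left_corner_def norm_mult)

lemma dist_apex: "cmod (place d w - apex d) = cmod w"
  using dist_place[of d w 0] by simp

lemma place_opp:
  assumes "0 \<le> t" "t \<le> 1"
  shows "place (opp M d) (B (opp M d) t (1 - t)) = place d (B d (1 - t) t)"
  using place_eq_iff[of "B d (1 - t) t" d "B (opp M d) t (1 - t)" "opp M d"]
    gstep_glue[OF centre[OF assms]] assms by simp

lemma place_opp_rc: "place (opp M d) (rc (opp M d)) = place d (lc d)"
  and place_opp_lc: "place (opp M d) (lc (opp M d)) = place d (rc d)"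
  using place_opp[of 1 d] place_opp[of 0 d] by (simp_all add: rc_bary lc_bary)

lemma place_bary: "place d (B d s t) =
    s *\<^sub>R place d (rc d) + t *\<^sub>R place d (lc d) + (1 - s - t) *\<^sub>R apex d"
  by (simp add: place_def bary_def algebra_simps scaleR_conv_of_real)

lemma apex_in_tri: "apex d \<in> tri d"
  by (metis place_0 imageI tri_def zero_in_T)

lemma rc_in_tri: "place d (rc d) \<in> tri d" and lc_in_tri: "place d (lc d) \<in> tri d"
  unfolding tri_def rc_bary lc_bary by auto

text \<open>On a centre side both distances come from the law of cosines with the two radii in
  exchanged roles; at a circumcentre both equal the radius of its circle. So the distance to the
  apex is a well-defined function on the disk.\<close>

lemma apex_dist_eq:
  assumes "z \<in> tri d" "z \<in> tri e"
  shows "cmod (z - apex d) = cmod (z - apex e)"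
  using assms
proof (cases rule: tri_cases)
  case 1
  then show ?thesis by simp
next
  case (2 t)
  have "(cmod (B d (1 - t) t))\<^sup>2 = (cmod (B (opp M d) t (1 - t)))\<^sup>2"
    unfolding cmod_bary_sq by (simp add: left_face_opp)
  then have "cmod (B d (1 - t) t) = cmod (B (opp M d) t (1 - t))"
    by simp
  then show ?thesis
    using dist_apex[of d "B d (1 - t) t"] dist_apex[of e "B e t (1 - t)"] 2 by simp
next
  case (3 F)
  have "cmod (z - apex e) = R F" if "(e, unplace e z) \<in> corner_class F" for e
    using that dist_apex[of e "unplace e z"] by (auto simp: corner_class_def cmod_rc cmod_lc)
  then show ?thesis using 3 by simp
qed

text \<open>The centre side of a kite lies on the bisector of its two apices.\<close>

lemma apex_dist_le:
  assumes z: "z \<in> tri d" "z \<in> tri e" "z \<noteq> place d (rc d)" "z \<noteq> place d (lc d)"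
    and z': "z' \<in> tri e"
  shows "cmod (z' - apex e) \<le> cmod (z' - apex d)"
  using z(1,2)
proof (cases rule: tri_cases)
  case 1
  then show ?thesis by simp
next
  case (2 t)
  let ?P = "place e (rc e)" and ?Q = "place e (lc e)" and ?i = "apex d" and ?j = "apex e"
  obtain s' t' where st: "unplace e z' = B e s' t'" by (rule bary_cases)
  then have z'_eq: "z' = s' *\<^sub>R ?P + t' *\<^sub>R ?Q + (1 - s' - t') *\<^sub>R ?j"
    by (metis place_bary place_unplace)
  have st': "s' + t' \<le> 1" using st z' by (simp add: tri_iff)
  have "cmod (?P - ?i) = cmod (?P - ?j)"
    using apex_dist_eq[of ?P d e] lc_in_tri[of d] rc_in_tri[of e] place_opp_rc[of d] 2 by simp
  then have P: "2 * (?P \<bullet> (?j - ?i)) = (cmod ?j)\<^sup>2 - (cmod ?i)\<^sup>2"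
    using cmod_diff_sq_diff[of ?P ?i ?j] by simp
  have "cmod (?Q - ?i) = cmod (?Q - ?j)"
    using apex_dist_eq[of ?Q d e] rc_in_tri[of d] lc_in_tri[of e] place_opp_lc[of d] 2 by simp
  then have Q: "2 * (?Q \<bullet> (?j - ?i)) = (cmod ?j)\<^sup>2 - (cmod ?i)\<^sup>2"
    using cmod_diff_sq_diff[of ?Q ?i ?j] by simp
  have J: "2 * (?j \<bullet> (?j - ?i)) = (cmod (?j - ?i))\<^sup>2 + (cmod ?j)\<^sup>2 - (cmod ?i)\<^sup>2"
    using cmod_diff_sq_diff[of ?j ?i ?j] by simp
  have "2 * (z' \<bullet> (?j - ?i)) = s' * (2 * (?P \<bullet> (?j - ?i))) + t' * (2 * (?Q \<bullet> (?j - ?i)))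
      + (1 - s' - t') * (2 * (?j \<bullet> (?j - ?i)))"
    unfolding z'_eq inner_add_left inner_scaleR_left by (simp add: algebra_simps)
  also have "\<dots> = (cmod ?j)\<^sup>2 - (cmod ?i)\<^sup>2 + (1 - s' - t') * (cmod (?j - ?i))\<^sup>2"
    unfolding P Q J by (simp add: algebra_simps)
  \<comment> \<open>The affine difference vanishes at both centres of \<open>e\<close>, so only the
    apex weight \<open>1 - s' - t'\<close> survives.\<close>
  finally have "(cmod (z' - ?i))\<^sup>2 - (cmod (z' - ?j))\<^sup>2 = (1 - s' - t') * (cmod (?j - ?i))\<^sup>2"
    unfolding cmod_diff_sq_diff by simp
  moreover have "\<dots> \<ge> 0" using st' by simp
  ultimately have "(cmod (z' - ?j))\<^sup>2 \<le> (cmod (z' - ?i))\<^sup>2" by linarith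
  then show ?thesis by (rule power2_le_imp_le) simp
next
  case (3 F)
  then show ?thesis using z by blast
qed

lemma inj_otri: "inj otri"
proof (rule injI)
  fix d e assume "otri d = otri e"
  moreover have "place d (B d (1/3) (1/3)) \<in> otri d" by (simp add: otri_iff)
  ultimately have "place d (B d (1/3) (1/3)) \<in> otri d \<inter> tri e"
    using otri_subset by blast
  then show "d = e" using otri_disjoint by blast
qed

lemma countable_darts: "countable (UNIV :: 'd set)"
proof -
  have "countable (range otri)"
  proof (rule countable_disjoint_open_subsets)
    show "pairwise disjnt (range otri)"
      unfolding pairwise_def disjnt_def using otri_disjoint otri_subset by blast
  qed (auto simp: open_otri)
  then show ?thesis using countable_image_inj_on inj_otri by blast
qed

text \<open>Finitely many triangles meet a compact disk around z, and the union of those missing z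
  is closed, so a smaller disk avoids it. Local statements at z may thus be checked on the triangles
  containing z.\<close>

lemma disk_nbhd:
  assumes "z \<in> \<D>"
  obtains \<epsilon> where "\<epsilon> > 0" "\<And>z'. cmod (z' - z) < \<epsilon> \<Longrightarrow> \<exists>e. z \<in> tri e \<and> z' \<in> tri e"
proof -
  obtain r where r: "r > 0" "cball z r \<subseteq> \<D>"
    using assms open_contains_cball open_ball by blast
  have "finite {d. tri d \<inter> cball z r \<noteq> {}}"
    using r by (intro finite_tri_compact) auto
  then have fin: "finite {d. tri d \<inter> cball z r \<noteq> {} \<and> z \<notin> tri d}"
    by (rule finite_subset[rotated]) auto
  define K where "K = \<Union>(tri ` {d. tri d \<inter> cball z r \<noteq> {} \<and> z \<notin> tri d})"
  have "closed K" unfolding K_def using fin closed_tri by (intro closed_Union) auto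
  moreover have "z \<notin> K" by (auto simp: K_def)
  ultimately obtain \<delta> where \<delta>: "\<delta> > 0" "ball z \<delta> \<inter> K = {}"
    by (metis open_Compl open_contains_ball disjoint_eq_subset_Compl ComplI)
  show thesis
  proof (rule that)
    show "min r \<delta> > 0" using r \<delta> by simp
    fix z' assume *: "cmod (z' - z) < min r \<delta>"
    then have z': "z' \<in> cball z r" "z' \<in> ball z \<delta>" by (auto simp: dist_norm norm_minus_commute)
    then obtain e where e: "z' \<in> tri e" using r Union_tri by blast
    moreover have "z \<in> tri e"
    proof (rule ccontr)
      assume "z \<notin> tri e"
      then have "z' \<in> K" unfolding K_def using e z'(1) by (intro UnionI[of "tri e"]) blast+
      then show False using \<delta> z' by blast
    qed
    ultimately show "\<exists>e. z \<in> tri e \<and> z' \<in> tri e" by blast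
  qed
qed

text \<open>Its square is the function \<open>Q\<close>; by \<open>apex_dist_eq\<close> the chosen
  triangle does not matter.\<close>

definition apex_dist :: "complex \<Rightarrow> real" where
  "apex_dist z = cmod (z - apex (SOME d. z \<in> tri d))"

lemma apex_dist_tri:
  assumes "z \<in> tri d"
  shows "apex_dist z = cmod (z - apex d)"
  unfolding apex_dist_def using someI[of "\<lambda>d. z \<in> tri d", OF assms] assms by (rule apex_dist_eq)

lemma continuous_on_apex_dist: "continuous_on \<D> apex_dist"
  unfolding continuous_on_iff
proof (intro ballI allI impI)
  fix z \<epsilon> :: _ assume "z \<in> \<D>" "(0::real) < \<epsilon>"
  obtain \<delta> where \<delta>: "\<delta> > 0" "\<And>z'. cmod (z' - z) < \<delta> \<Longrightarrow> \<exists>e. z \<in> tri e \<and> z' \<in> tri e"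
    using disk_nbhd[OF \<open>z \<in> \<D>\<close>] by metis
  show "\<exists>\<delta>>0. \<forall>z'\<in>\<D>. dist z' z < \<delta> \<longrightarrow> dist (apex_dist z') (apex_dist z) < \<epsilon>"
  proof (intro exI[of _ "min \<delta> \<epsilon>"] conjI ballI impI)
    fix z' assume "dist z' z < min \<delta> \<epsilon>"
    then obtain e where "z \<in> tri e" "z' \<in> tri e" "cmod (z' - z) < \<epsilon>"
      using \<delta>(2) by (auto simp: dist_norm)
    then show "dist (apex_dist z') (apex_dist z) < \<epsilon>"
      using norm_triangle_ineq3[of "z' - apex e" "z - apex e"]
      by (simp add: apex_dist_tri dist_real_def)
  qed (use \<delta> \<open>0 < \<epsilon>\<close> in auto)
qed

definition centres :: "complex set" where
  "centres = (\<Union>d. {place d (rc d), place d (lc d)})"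

lemma apex_not_centre: "apex d \<noteq> place d (rc d)" "apex d \<noteq> place d (lc d)"
proof -
  have "place d 0 \<noteq> place d (rc d)" "place d 0 \<noteq> place d (lc d)"
    using bary_inject[of d 0 0 1 0] bary_inject[of d 0 0 0 1]
    unfolding place_inject rc_bary lc_bary by simp_all
  then show "apex d \<noteq> place d (rc d)" "apex d \<noteq> place d (lc d)" by auto
qed

text \<open>Along the segment from the apex to z, the square of \<open>apex_dist\<close> minus the
  squared distance to the apex starts at 0, is nonpositive near the start and has affine local
  majorants. Avoiding circumcentres lets \<open>apex_dist_le\<close> compare any two triangles that
  meet at an interior point of the segment.\<close>

lemma voronoi_generic:
  assumes z: "z \<in> \<D>"
    and avoid: "\<And>t. 0 < t \<Longrightarrow> t < 1 \<Longrightarrow> apex d + t *\<^sub>R (z - apex d) \<notin> centres"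
  shows "apex_dist z \<le> cmod (z - apex d)"
proof -
  define j where "j = apex d"
  define \<gamma> where "\<gamma> t = j + t *\<^sub>R (z - j)" for t
  define g where "g t = (apex_dist (\<gamma> t))\<^sup>2 - (cmod (\<gamma> t - j))\<^sup>2" for t
  have j: "j \<in> tri d" "j \<in> \<D>" using apex_in_tri[of d] tri_subset[of d] by (auto simp: j_def)
  have \<gamma>: "\<gamma> t \<in> \<D>" if "0 \<le> t" "t \<le> 1" for t
  proof -
    have "\<gamma> t = (1 - t) *\<^sub>R j + t *\<^sub>R z" by (simp add: \<gamma>_def algebra_simps)
    then show ?thesis using convexD_alt[OF convex_ball, of j 0 1 z t] j z that by simp
  qed
  have close: "\<exists>\<epsilon>'>0. \<forall>t. \<bar>t - t\<^sub>0\<bar> < \<epsilon>' \<longrightarrow> cmod (\<gamma> t - \<gamma> t\<^sub>0) < \<epsilon>" if "\<epsilon> > 0" for \<epsilon> t\<^sub>0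
  proof -
    have e: "\<gamma> t - \<gamma> t\<^sub>0 = (t - t\<^sub>0) *\<^sub>R (z - j)" for t by (simp add: \<gamma>_def algebra_simps)
    show ?thesis
    proof (intro exI[of _ "\<epsilon> / (cmod (z - j) + 1)"] conjI allI impI)
      show "0 < \<epsilon> / (cmod (z - j) + 1)" using that by (simp add: add_nonneg_pos)
      fix t assume "\<bar>t - t\<^sub>0\<bar> < \<epsilon> / (cmod (z - j) + 1)"
      then have "\<bar>t - t\<^sub>0\<bar> * (cmod (z - j) + 1) < \<epsilon>"
        by (simp add: pos_less_divide_eq add_nonneg_pos)
      then have "\<bar>t - t\<^sub>0\<bar> * cmod (z - j) < \<epsilon>"
        by (simp add: distrib_left)
      then show "cmod (\<gamma> t - \<gamma> t\<^sub>0) < \<epsilon>" by (simp add: e)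
    qed
  qed
  have "g 1 \<le> 0"
  proof -
    obtain \<epsilon> where \<epsilon>: "\<epsilon> > 0" "\<And>z'. cmod (z' - j) < \<epsilon> \<Longrightarrow> \<exists>e. j \<in> tri e \<and> z' \<in> tri e"
      using disk_nbhd[OF j(2)] by metis
    obtain \<epsilon>\<^sub>1 where e1: "\<epsilon>\<^sub>1 > 0" "\<And>t. \<bar>t - 0\<bar> < \<epsilon>\<^sub>1 \<Longrightarrow> cmod (\<gamma> t - \<gamma> 0) < \<epsilon>"
      using close[OF \<epsilon>(1), of 0] by blast
    show ?thesis
    proof (rule concave_from_local_majorants[where g = g and \<epsilon>\<^sub>1 = \<epsilon>\<^sub>1])
      show "continuous_on {0..1} g"
        unfolding g_def
      proof (intro continuous_intros continuous_on_compose2[OF continuous_on_apex_dist])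
        show "continuous_on {0..1} \<gamma>" unfolding \<gamma>_def by (intro continuous_intros)
        then show "continuous_on {0..1} \<gamma>" .
      qed (use \<gamma> in auto)
      show "g 0 = 0"
        using apex_dist_tri[OF j(1)] by (simp add: g_def \<gamma>_def j_def)
      show "\<epsilon>\<^sub>1 > 0" by fact
      show "g t \<le> 0" if "0 \<le> t" "t < \<epsilon>\<^sub>1" "t \<le> 1" for t
      proof -
        have "cmod (\<gamma> t - j) < \<epsilon>" using e1(2)[of t] that by (simp add: \<gamma>_def)
        then obtain e where e: "j \<in> tri e" "\<gamma> t \<in> tri e" using \<epsilon>(2) by blast
        have "cmod (\<gamma> t - apex e) \<le> cmod (\<gamma> t - apex d)"
          using apex_dist_le[of j d e "\<gamma> t"] j e apex_not_centre by (simp add: j_def)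
        then show ?thesis
          using apex_dist_tri[OF e(2)] by (simp add: g_def j_def power_mono)
      qed
    next
      fix t\<^sub>0 :: real assume t0: "0 < t\<^sub>0" "t\<^sub>0 < 1"
      have "\<gamma> t\<^sub>0 \<in> \<D>" using \<gamma> t0 by simp
      then obtain e where e: "\<gamma> t\<^sub>0 \<in> tri e" using Union_tri by blast
      obtain \<epsilon> where \<epsilon>: "\<epsilon> > 0" "\<And>z'. cmod (z' - \<gamma> t\<^sub>0) < \<epsilon> \<Longrightarrow> \<exists>e. \<gamma> t\<^sub>0 \<in> tri e \<and> z' \<in> tri e"
        using disk_nbhd[OF \<open>\<gamma> t\<^sub>0 \<in> \<D>\<close>] by metis
      obtain \<epsilon>' where e': "\<epsilon>' > 0" "\<And>t. \<bar>t - t\<^sub>0\<bar> < \<epsilon>' \<Longrightarrow> cmod (\<gamma> t - \<gamma> t\<^sub>0) < \<epsilon>"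
        using close[OF \<epsilon>(1), of t\<^sub>0] by blast
      have nc: "\<gamma> t\<^sub>0 \<noteq> place e (rc e)" "\<gamma> t\<^sub>0 \<noteq> place e (lc e)"
        using avoid[OF t0] by (auto simp: \<gamma>_def j_def centres_def)
      \<comment> \<open>Keep the apex of one triangle \<open>e\<close> through the point fixed. Any
        other triangle there is at least as close to its own apex as to that of \<open>e\<close>, so
        this affine function is a majorant, with equality at \<open>t\<^sub>0\<close>.\<close>
      define a where "a t = (cmod (\<gamma> t - apex e))\<^sup>2 - (cmod (\<gamma> t - j))\<^sup>2" for t
      define k where "k = 2 * ((z - j) \<bullet> (j - apex e))"
      have a: "a t = a t\<^sub>0 + k * (t - t\<^sub>0)" for t
        unfolding a_def cmod_diff_sq_diff k_def \<gamma>_def inner_add_left inner_scaleR_left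
        by (simp add: algebra_simps)
      have "g t \<le> g t\<^sub>0 + k * (t - t\<^sub>0)" if t: "\<bar>t - t\<^sub>0\<bar> < \<epsilon>'" for t
      proof -
        obtain f where f: "\<gamma> t\<^sub>0 \<in> tri f" "\<gamma> t \<in> tri f"
          using e'(2)[OF t] \<epsilon>(2) by blast
        have "cmod (\<gamma> t - apex f) \<le> cmod (\<gamma> t - apex e)"
          using apex_dist_le e f nc by blast
        then have "g t \<le> a t"
          using apex_dist_tri[OF f(2)] by (simp add: g_def a_def power_mono)
        moreover have "g t\<^sub>0 = a t\<^sub>0"
          using apex_dist_tri[OF e] by (simp add: g_def a_def)
        ultimately show ?thesis using a[of t] by linarith
      qed
      then show "\<exists>k. \<exists>\<epsilon>>0. \<forall>t\<in>{0..1}. \<bar>t - t\<^sub>0\<bar> < \<epsilon> \<longrightarrow> g t \<le> g t\<^sub>0 + k * (t - t\<^sub>0)"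
        using e'(1) by blast
    qed
  qed
  then have "(apex_dist z)\<^sup>2 \<le> (cmod (z - apex d))\<^sup>2"
    by (simp add: g_def \<gamma>_def j_def)
  then show ?thesis by (rule power2_le_imp_le) simp
qed

text \<open>The circumcentres are avoided by an arbitrarily small rotation of the segment about the apex.\<close>

lemma voronoi:
  assumes z: "z \<in> \<D>"
  shows "apex_dist z \<le> cmod (z - apex d)"
proof (rule ccontr)
  assume neg: "\<not> apex_dist z \<le> cmod (z - apex d)"
  define j where "j = apex d"
  have "apex_dist j = 0" using apex_dist_tri[OF apex_in_tri[of d]] by (simp add: j_def)
  then have zj: "z \<noteq> j" using neg by (auto simp: j_def)
  \<comment> \<open>A strict violation persists on a small ball, which leaves room to turn z away
    from bad directions.\<close>
  have "continuous_on \<D> (\<lambda>z. apex_dist z - cmod (z - j))"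
    by (intro continuous_intros continuous_on_apex_dist)
  then have "open (\<D> \<inter> (\<lambda>z. apex_dist z - cmod (z - j)) -` {0<..})"
    by (intro continuous_open_preimage) auto
  moreover have "z \<in> \<D> \<inter> (\<lambda>z. apex_dist z - cmod (z - j)) -` {0<..}"
    using neg z by (simp add: j_def)
  ultimately obtain \<delta> where \<delta>: "\<delta> > 0" "ball z \<delta> \<subseteq> \<D> \<inter> (\<lambda>z. apex_dist z - cmod (z - j)) -` {0<..}"
    by (meson openE)
  define \<eta> where "\<eta> = \<delta> / cmod (z - j)"
  have "\<eta> > 0" using \<delta> zj by (simp add: \<eta>_def)
  then have "uncountable {0<..<\<eta>}" by (simp add: uncountable_open_interval)
  moreover have "countable centres"
    unfolding centres_def by (intro countable_UN countable_darts) auto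
  \<comment> \<open>The image consists of the slopes of the directions from \<open>j\<close> to the
    circumcentres, relative to \<open>z - j\<close>. Uncountably many small slopes are available and
    only countably many are bad.\<close>
  then have "countable ((\<lambda>c. Im ((c - j) / (z - j)) / Re ((c - j) / (z - j))) ` centres)"
    by (rule countable_image)
  ultimately obtain s where s: "0 < s" "s < \<eta>"
    "s \<notin> (\<lambda>c. Im ((c - j) / (z - j)) / Re ((c - j) / (z - j))) ` centres"
    by (meson countable_subset greaterThanLessThan_iff subsetI)
  define z' where "z' = z + of_real s * \<i> * (z - j)"
  have "cmod (z' - z) < \<delta>"
    using s zj by (simp add: z'_def norm_mult \<eta>_def pos_less_divide_eq)
  then have "z' \<in> ball z \<delta>" by (simp add: dist_norm norm_minus_commute)
  then have z': "z' \<in> \<D>" "apex_dist z' > cmod (z' - j)" using \<delta>(2) by auto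
  have "apex_dist z' \<le> cmod (z' - apex d)"
  proof (rule voronoi_generic)
    fix t :: real assume t: "0 < t" "t < 1"
    let ?c = "apex d + t *\<^sub>R (z' - apex d)"
    have "?c - j = t *\<^sub>R ((1 + of_real s * \<i>) * (z - j))"
      by (simp add: j_def z'_def algebra_simps)
    then have "(?c - j) / (z - j) = t *\<^sub>R (1 + of_real s * \<i>)"
      using zj by (simp add: scaleR_conv_of_real)
    then have "Im ((?c - j) / (z - j)) / Re ((?c - j) / (z - j)) = s"
      using t by simp
    then show "?c \<notin> centres"
      using s(3) rev_image_eqI[of ?c centres s "\<lambda>c. Im ((c - j) / (z - j)) / Re ((c - j) / (z - j))"]
      by auto
  qed (rule z'(1))
  then show False using z' by (simp add: j_def)
qed

text \<open>A triangle reaching close to the boundary misses a large concentric disk; by convexity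
  so does the midpoint of any chord from its apex, and the parallelogram law makes that chord
  short.\<close>

lemma apex_near_boundary:
  assumes "\<epsilon> > 0"
  obtains \<delta> where "\<delta> > 0" "\<And>z d. z \<in> tri d \<Longrightarrow> cmod z > 1 - \<delta> \<Longrightarrow> cmod (z - apex d) < \<epsilon>"
proof -
  define \<epsilon>' where "\<epsilon>' = min \<epsilon> 1"
  have \<epsilon>': "0 < \<epsilon>'" "\<epsilon>' \<le> 1" "\<epsilon>' \<le> \<epsilon>" using assms by (auto simp: \<epsilon>'_def)
  have "\<epsilon>'\<^sup>2 \<le> 1" using \<epsilon>' by (simp add: power_le_one)
  \<comment> \<open>Solves 4 (1 - r^2) = \<epsilon>'^2, the bound that the parallelogram law gives
    when both ends of the chord have norm at most 1.\<close>
  define r where "r = sqrt (1 - \<epsilon>'\<^sup>2 / 4)"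
  have r2: "r\<^sup>2 = 1 - \<epsilon>'\<^sup>2 / 4" using \<open>\<epsilon>'\<^sup>2 \<le> 1\<close> by (simp add: r_def)
  have "r\<^sup>2 < 1\<^sup>2" using \<epsilon>' by (simp add: r2)
  then have r: "0 \<le> r" "r < 1" using \<open>\<epsilon>'\<^sup>2 \<le> 1\<close> by (auto simp: r_def intro: power2_less_imp_less)
  define S where "S = {d. tri d \<inter> cball 0 r \<noteq> {}}"
  have "finite S" unfolding S_def using r by (intro finite_tri_compact) auto
  \<comment> \<open>Finitely many compact triangles, so K keeps a positive distance from the
    boundary; inserting 0 ensures that K is nonempty.\<close>
  define K where "K = insert 0 (\<Union>(tri ` S))"
  have K: "compact K" unfolding K_def using \<open>finite S\<close> compact_tri by (intro compact_insert compact_UN) auto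
  have KD: "K \<subseteq> \<D>" unfolding K_def using tri_subset by auto
  obtain y where y: "y \<in> K" "\<And>z. z \<in> K \<Longrightarrow> cmod z \<le> cmod y"
    using continuous_attains_sup[of K cmod] K continuous_on_norm_id unfolding K_def by blast
  show thesis
  proof (rule that)
    show "1 - cmod y > 0" using y KD by auto
    fix z d assume z: "z \<in> tri d" "cmod z > 1 - (1 - cmod y)"
    then have "z \<notin> K" using y(2)[of z] by auto
    then have "d \<notin> S" using z by (auto simp: K_def)
    define m where "m = (1/2) *\<^sub>R z + (1/2) *\<^sub>R apex d"
    have "m \<in> tri d" unfolding m_def
      using convexD[OF convex_tri z(1) apex_in_tri] by simp
    then have "r < cmod m" using \<open>d \<notin> S\<close> by (auto simp: S_def)
    then have "r\<^sup>2 < (cmod m)\<^sup>2" using r by (simp add: power_strict_mono)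
    moreover have "4 * (cmod m)\<^sup>2 + (cmod (z - apex d))\<^sup>2 = 2 * (cmod z)\<^sup>2 + 2 * (cmod (apex d))\<^sup>2"
      unfolding m_def power2_norm_eq_inner by (simp add: inner_add inner_diff inner_commute)
    moreover have "(cmod z)\<^sup>2 \<le> 1" "(cmod (apex d))\<^sup>2 \<le> 1"
      using z(1) apex_in_tri[of d] tri_subset[of d] by (auto simp: power_le_one subset_iff)
    ultimately have "(cmod (z - apex d))\<^sup>2 < \<epsilon>'\<^sup>2" using r2 by linarith
    then have "cmod (z - apex d) < \<epsilon>'" using \<epsilon>'(1) by (meson less_imp_le power2_less_imp_less)
    then show "cmod (z - apex d) < \<epsilon>" using \<epsilon>' by linarith
  qed
qed

lemma circumdisk_subset: "ball (place d (lc d)) (R (left_face M d)) \<subseteq> \<D>"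
proof (rule ccontr)
  let ?c = "place d (lc d)" and ?R = "R (left_face M d)"
  assume "\<not> ball ?c ?R \<subseteq> \<D>"
  then obtain y where "y \<in> ball ?c ?R" "y \<notin> \<D>" by blast
  then have y: "y \<in> ball ?c ?R" "1 \<le> cmod y" by simp_all
  have c: "?c \<in> \<D>" using lc_in_tri tri_subset by blast
  have "connected (closed_segment ?c y)" by simp
  then have "connected (cmod ` closed_segment ?c y)"
    by (intro connected_continuous_image continuous_intros)
  then have "1 \<in> cmod ` closed_segment ?c y"
    using c y(2)
    by (rule_tac connectedD_interval[of _ "cmod ?c" "cmod y"])
      (simp_all add: less_imp_le)
  then obtain \<xi> where \<xi>: "\<xi> \<in> closed_segment ?c y" "cmod \<xi> = 1" by auto
  have "\<xi> \<in> ball ?c ?R"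
    using \<xi>(1) y(1) R_pos[of d] closed_segment_subset[of ?c "ball ?c ?R" y] by auto
  then have "cmod (?c - \<xi>) < ?R" by (simp add: dist_norm)
  \<comment> \<open>Half the margin of \<xi> inside the circle: one half pays for moving \<xi> into
    the disk, the other for passing from there to an apex.\<close>
  define \<epsilon> where "\<epsilon> = (?R - cmod (?c - \<xi>)) / 2"
  have "\<epsilon> > 0" using \<open>cmod (?c - \<xi>) < ?R\<close> by (simp add: \<epsilon>_def)
  then obtain \<delta> where \<delta>: "\<delta> > 0" "\<And>z d. z \<in> tri d \<Longrightarrow> cmod z > 1 - \<delta> \<Longrightarrow> cmod (z - apex d) < \<epsilon>"
    using apex_near_boundary by metis
  define \<tau> where "\<tau> = min (\<delta> / 2) (min (1/2) \<epsilon>)"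
  have \<tau>: "0 < \<tau>" "\<tau> < \<delta>" "\<tau> \<le> \<epsilon>" "\<tau> \<le> 1/2" using \<open>\<epsilon> > 0\<close> \<delta>(1) by (auto simp: \<tau>_def)
  define z where "z = (1 - \<tau>) *\<^sub>R \<xi>"
  have z: "cmod z = 1 - \<tau>" using \<tau> \<xi> by (simp add: z_def)
  then obtain e where e: "z \<in> tri e" using Union_tri \<tau> by (metis UN_E diff_less_eq less_add_same_cancel1 mem_ball_0)
  have "cmod (\<xi> - z) = \<tau>"
  proof -
    have "\<xi> - z = \<tau> *\<^sub>R \<xi>" by (simp add: z_def algebra_simps)
    then show ?thesis using \<tau> \<xi> by simp
  qed
  moreover have "cmod (z - apex e) < \<epsilon>" using \<delta>(2)[OF e] z \<tau> by simp
  moreover have "cmod (?c - apex e) \<le> cmod (?c - \<xi>) + cmod (\<xi> - z) + cmod (z - apex e)"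
    using norm_triangle_ineq[of "?c - \<xi>" "\<xi> - apex e"] norm_triangle_ineq[of "\<xi> - z" "z - apex e"]
    by simp
  moreover have "?R = cmod (?c - \<xi>) + 2 * \<epsilon>"
    unfolding \<epsilon>_def by (simp only: times_divide_eq_right nonzero_mult_div_cancel_left zero_neq_numeral[symmetric] not_False_eq_True)
  ultimately have "cmod (?c - apex e) < ?R" using \<tau>(3) by simp
  moreover have "apex_dist ?c = ?R"
    using apex_dist_tri[OF lc_in_tri] dist_apex[of d "lc d"] by (simp add: cmod_lc)
  ultimately show False using voronoi[OF c, of e] by simp
qed

end

section \<open>Hyperbolic area of the triangles\<close>

lemma measurable_Complex [measurable]: "(\<lambda>(x, y). Complex x y) \<in> borel_measurable (lborel \<Otimes>\<^sub>M lborel)"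
proof -
  have "continuous_on UNIV (\<lambda>(x, y). Complex x y)"
    unfolding Complex_eq case_prod_beta by (intro continuous_intros)
  then have "(\<lambda>(x, y). Complex x y) \<in> borel_measurable borel"
    by (rule borel_measurable_continuous_onI)
  then show ?thesis by (simp add: lborel_prod)
qed

lemma lborel_complex: "(lborel :: complex measure) = distr (lborel \<Otimes>\<^sub>M lborel) borel (\<lambda>(x, y). Complex x y)"
proof (rule lborel_eqI)
  fix l u :: complex assume lu: "\<And>b. b \<in> Basis \<Longrightarrow> l \<bullet> b \<le> u \<bullet> b"
  then have le: "Re l \<le> Re u" "Im l \<le> Im u"
    using lu[of 1] lu[of \<i>] by (auto simp: Basis_complex_def inner_complex_def)
  have "emeasure (distr (lborel \<Otimes>\<^sub>M lborel) borel (\<lambda>(x, y). Complex x y)) (box l u)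
      = emeasure (lborel \<Otimes>\<^sub>M lborel) ((\<lambda>(x, y). Complex x y) -` box l u \<inter> space (lborel \<Otimes>\<^sub>M lborel))"
    by (rule emeasure_distr) (use measurable_Complex in auto)
  also have "(\<lambda>(x, y). Complex x y) -` box l u \<inter> space (lborel \<Otimes>\<^sub>M lborel)
      = {Re l<..<Re u} \<times> {Im l<..<Im u}"
    by (auto simp: box_def Basis_complex_def inner_complex_def space_pair_measure)
  also have "emeasure (lborel \<Otimes>\<^sub>M lborel) \<dots> = ennreal (Re u - Re l) * ennreal (Im u - Im l)"
    using le by (subst lborel.emeasure_pair_measure_Times) auto
  also have "\<dots> = (\<Prod>b\<in>Basis. (u - l) \<bullet> b)"
    using le by (simp add: Basis_complex_def inner_complex_def ennreal_mult)
  finally show "emeasure (distr (lborel \<Otimes>\<^sub>M lborel) borel (\<lambda>(x, y). Complex x y)) (box l u)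
      = (\<Prod>b\<in>Basis. (u - l) \<bullet> b)" .
qed simp

lemma nn_integral_complex:
  assumes [measurable]: "g \<in> borel_measurable borel"
  shows "(\<integral>\<^sup>+z. g z \<partial>lborel) = (\<integral>\<^sup>+x. \<integral>\<^sup>+y. g (Complex x y) \<partial>lborel \<partial>lborel)"
proof -
  have "(\<integral>\<^sup>+z. g z \<partial>lborel) = (\<integral>\<^sup>+p. g ((\<lambda>(x, y). Complex x y) p) \<partial>(lborel \<Otimes>\<^sub>M lborel))"
    by (subst lborel_complex, subst nn_integral_distr) auto
  also have "\<dots> = (\<integral>\<^sup>+x. \<integral>\<^sup>+y. g (Complex x y) \<partial>lborel \<partial>lborel)"
    by (subst lborel.nn_integral_fst[symmetric]) auto
  finally show ?thesis .
qed

text \<open>Two one-dimensional substitutions around an application of Fubini: y is replaced by t at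
  fixed x, and x by s at fixed t. Their factors \<open>D / p\<^sub>1\<close> and
  \<open>p\<^sub>1\<close> multiply to the determinant.\<close>

lemma nn_integral_plane_affine:
  fixes h :: "real \<Rightarrow> real \<Rightarrow> ennreal"
  assumes [measurable]: "(\<lambda>(x, y). h x y) \<in> borel_measurable (borel \<Otimes>\<^sub>M borel)"
    and p: "p\<^sub>1 \<noteq> 0" and D: "p\<^sub>1 * q\<^sub>2 - p\<^sub>2 * q\<^sub>1 \<noteq> 0"
  shows "(\<integral>\<^sup>+x. \<integral>\<^sup>+y. h x y \<partial>lborel \<partial>lborel) = ennreal \<bar>p\<^sub>1 * q\<^sub>2 - p\<^sub>2 * q\<^sub>1\<bar> *
    (\<integral>\<^sup>+t. \<integral>\<^sup>+s. h (x\<^sub>0 + s * p\<^sub>1 + t * q\<^sub>1) (y\<^sub>0 + s * p\<^sub>2 + t * q\<^sub>2) \<partial>lborel \<partial>lborel)"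
proof -
  define D where "D = p\<^sub>1 * q\<^sub>2 - p\<^sub>2 * q\<^sub>1"
  have D0: "D / p\<^sub>1 \<noteq> 0" using p D by (simp add: D_def)
  \<comment> \<open>Chosen so that inserting
    \<open>x = x\<^sub>0 + t * q\<^sub>1 + s * p\<^sub>1\<close> yields
    \<open>y\<^sub>0 + s * p\<^sub>2 + t * q\<^sub>2\<close>.\<close>
  define Y where "Y x t = (y\<^sub>0 + (p\<^sub>2 / p\<^sub>1) * (x - x\<^sub>0)) + (D / p\<^sub>1) * t" for x t
  have "(\<integral>\<^sup>+x. \<integral>\<^sup>+y. h x y \<partial>lborel \<partial>lborel) = (\<integral>\<^sup>+x. ennreal \<bar>D / p\<^sub>1\<bar> * (\<integral>\<^sup>+t. h x (Y x t) \<partial>lborel) \<partial>lborel)"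
    unfolding Y_def by (intro nn_integral_cong nn_integral_real_affine D0) measurable
  also have "\<dots> = ennreal \<bar>D / p\<^sub>1\<bar> * (\<integral>\<^sup>+x. \<integral>\<^sup>+t. h x (Y x t) \<partial>lborel \<partial>lborel)"
    unfolding Y_def by (rule nn_integral_cmult) measurable
  also have "(\<integral>\<^sup>+x. \<integral>\<^sup>+t. h x (Y x t) \<partial>lborel \<partial>lborel) = (\<integral>\<^sup>+t. \<integral>\<^sup>+x. h x (Y x t) \<partial>lborel \<partial>lborel)"
    unfolding Y_def by (rule lborel_pair.Fubini'[symmetric]) measurable
  also have "\<dots> = (\<integral>\<^sup>+t. ennreal \<bar>p\<^sub>1\<bar> * (\<integral>\<^sup>+s. h ((x\<^sub>0 + t * q\<^sub>1) + p\<^sub>1 * s) (Y ((x\<^sub>0 + t * q\<^sub>1) + p\<^sub>1 * s) t) \<partial>lborel) \<partial>lborel)"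
    unfolding Y_def by (intro nn_integral_cong nn_integral_real_affine p) measurable
  also have "\<dots> = ennreal \<bar>p\<^sub>1\<bar> * (\<integral>\<^sup>+t. \<integral>\<^sup>+s. h ((x\<^sub>0 + t * q\<^sub>1) + p\<^sub>1 * s) (Y ((x\<^sub>0 + t * q\<^sub>1) + p\<^sub>1 * s) t) \<partial>lborel \<partial>lborel)"
    unfolding Y_def by (rule nn_integral_cmult) measurable
  also have "(\<lambda>t s. h ((x\<^sub>0 + t * q\<^sub>1) + p\<^sub>1 * s) (Y ((x\<^sub>0 + t * q\<^sub>1) + p\<^sub>1 * s) t))
      = (\<lambda>t s. h (x\<^sub>0 + s * p\<^sub>1 + t * q\<^sub>1) (y\<^sub>0 + s * p\<^sub>2 + t * q\<^sub>2))"
  proof (intro ext arg_cong2[where f = h])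
    fix t s
    show "Y ((x\<^sub>0 + t * q\<^sub>1) + p\<^sub>1 * s) t = y\<^sub>0 + s * p\<^sub>2 + t * q\<^sub>2"
      using p by (simp add: Y_def D_def field_simps)
  qed simp
  finally have *: "(\<integral>\<^sup>+x. \<integral>\<^sup>+y. h x y \<partial>lborel \<partial>lborel) = ennreal \<bar>D / p\<^sub>1\<bar> * (ennreal \<bar>p\<^sub>1\<bar> *
    (\<integral>\<^sup>+t. \<integral>\<^sup>+s. h (x\<^sub>0 + s * p\<^sub>1 + t * q\<^sub>1) (y\<^sub>0 + s * p\<^sub>2 + t * q\<^sub>2) \<partial>lborel \<partial>lborel))" .
  have "ennreal \<bar>D / p\<^sub>1\<bar> * ennreal \<bar>p\<^sub>1\<bar> = ennreal \<bar>D\<bar>"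
    using p by (simp flip: ennreal_mult add: abs_divide)
  then show ?thesis unfolding * D_def[symmetric] by (simp flip: mult.assoc)
qed

lemma nn_integral_complex_affine:
  assumes g [measurable]: "g \<in> borel_measurable borel"
    and D: "Re p * Im q - Im p * Re q \<noteq> 0"
  shows "(\<integral>\<^sup>+z. g z \<partial>lborel) = ennreal \<bar>Re p * Im q - Im p * Re q\<bar> *
    (\<integral>\<^sup>+t. \<integral>\<^sup>+s. g (c + s *\<^sub>R p + t *\<^sub>R q) \<partial>lborel \<partial>lborel)"
proof -
  have C [measurable]: "(\<lambda>(x, y). Complex x y) \<in> borel_measurable (borel \<Otimes>\<^sub>M borel)"
    using measurable_Complex by (simp cong: measurable_cong_sets sets_pair_measure_cong)
  have m: "(\<lambda>(x, y). g (Complex x y)) \<in> borel_measurable (borel \<Otimes>\<^sub>M borel)"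
    using measurable_compose[OF C g] by (simp add: case_prod_beta)
  have m': "(\<lambda>(y, x). g (Complex x y)) \<in> borel_measurable (borel \<Otimes>\<^sub>M borel)"
    using measurable_compose[OF measurable_pair_swap' m] by (simp add: case_prod_beta)
  have c: "Complex (Re c + s * Re p + t * Re q) (Im c + s * Im p + t * Im q) = c + s *\<^sub>R p + t *\<^sub>R q" for s t
    by (simp add: complex_eq_iff)
  show ?thesis
  proof (cases "Re p = 0")
    case False
    show ?thesis
      unfolding nn_integral_complex[OF g]
      using nn_integral_plane_affine[OF m False, of "Im q" "Im p" "Re q" "Re c" "Im c"] D
      unfolding c by simp
  next
    \<comment> \<open>The substitution divides by the first component of p; when that vanishes, the
      axes are exchanged.\<close>
    case True
    then have "Im p \<noteq> 0" using D by auto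
    have "(\<integral>\<^sup>+z. g z \<partial>lborel) = (\<integral>\<^sup>+y. \<integral>\<^sup>+x. g (Complex x y) \<partial>lborel \<partial>lborel)"
      unfolding nn_integral_complex[OF g]
      by (rule lborel_pair.Fubini') (use m' in \<open>simp cong: measurable_cong_sets sets_pair_measure_cong\<close>)
    also have "\<dots> = ennreal \<bar>Im p * Re q - Re p * Im q\<bar> *
        (\<integral>\<^sup>+t. \<integral>\<^sup>+s. g (c + s *\<^sub>R p + t *\<^sub>R q) \<partial>lborel \<partial>lborel)"
      using nn_integral_plane_affine[OF m' \<open>Im p \<noteq> 0\<close>, where q\<^sub>2 = "Re q" and p\<^sub>2 = "Re p"
          and q\<^sub>1 = "Im q" and x\<^sub>0 = "Im c" and y\<^sub>0 = "Re c"] D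
      unfolding c by simp
    finally show ?thesis by (simp add: abs_minus_commute)
  qed
qed

text \<open>A quarter of the hyperbolic area density in curvature -1, matching the weight in
  \<open>hyperbolic_L2\<close>.\<close>

definition hyp_density :: "complex \<Rightarrow> real" where
  "hyp_density z = 1 / (1 - (cmod z)\<^sup>2)\<^sup>2"

lemma hyp_density_measurable [measurable]: "hyp_density \<in> borel_measurable borel"
  unfolding hyp_density_def by measurable

lemma hyp_density_nonneg [simp]: "hyp_density z \<ge> 0"
  by (simp add: hyp_density_def)

text \<open>In 1 - |z|^2 = (1 - |z|) (1 + |z|) the last factor lies between 1 and 2, whence the
  constant 1 here and 4 in \<open>hyp_density_ge\<close>.\<close>

lemma hyp_density_le:
  assumes "0 < h" "h \<le> 1 - cmod z"
  shows "hyp_density z \<le> 1 / h\<^sup>2"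
proof -
  have "1 - (cmod z)\<^sup>2 = (1 - cmod z) * (1 + cmod z)" by (simp add: power2_eq_square algebra_simps)
  then have "1 - cmod z \<le> 1 - (cmod z)\<^sup>2"
    using assms mult_left_mono[of 1 "1 + cmod z" "1 - cmod z"] by simp
  then have "h \<le> 1 - (cmod z)\<^sup>2" using assms by linarith
  then have "h\<^sup>2 \<le> (1 - (cmod z)\<^sup>2)\<^sup>2" using assms by (intro power_mono) auto
  then show ?thesis unfolding hyp_density_def using assms \<open>h \<le> 1 - (cmod z)\<^sup>2\<close>
    by (intro divide_left_mono mult_pos_pos zero_less_power) auto
qed

lemma hyp_density_ge:
  assumes "cmod z < 1" "1 - cmod z \<le> h"
  shows "hyp_density z \<ge> 1 / (4 * h\<^sup>2)"
proof -
  have "1 - (cmod z)\<^sup>2 = (1 - cmod z) * (1 + cmod z)" by (simp add: power2_eq_square algebra_simps)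
  moreover have "(1 - cmod z) * (1 + cmod z) \<le> h * 2"
    using assms by (intro mult_mono) auto
  ultimately have le: "1 - (cmod z)\<^sup>2 \<le> 2 * h" by simp
  have pos: "1 - (cmod z)\<^sup>2 > 0" using assms by (simp add: abs_square_less_1)
  have "(1 - (cmod z)\<^sup>2)\<^sup>2 \<le> (2 * h)\<^sup>2" using le pos by (intro power_mono) auto
  then have "(1 - (cmod z)\<^sup>2)\<^sup>2 \<le> 4 * h\<^sup>2" by (simp add: power_mult_distrib)
  then show ?thesis unfolding hyp_density_def using pos assms
    by (intro divide_left_mono mult_pos_pos zero_less_power) auto
qed

text \<open>The bound comes from \<open>\<integral>\<^sub>0\<^sup>1 dt / ((1 - t) r + t l)\<^sup>2 = 1 / (r l)\<close>.\<close>

lemma hyp_area_le: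
  fixes c p q :: complex
  assumes S [measurable]: "S \<in> sets borel"
    and S_tri: "\<And>s t. c + s *\<^sub>R p + t *\<^sub>R q \<in> S \<Longrightarrow> 0 < s \<and> 0 < t \<and> s + t < 1"
    and D: "Re p * Im q - Im p * Re q \<noteq> 0" "\<bar>Re p * Im q - Im p * Re q\<bar> \<le> r * l"
    and pos: "0 < r" "0 < l" "0 < \<kappa>"
    and low: "\<And>s t. 0 < s \<Longrightarrow> 0 < t \<Longrightarrow> s + t < 1 \<Longrightarrow>
        \<kappa> * ((1 - t) * r + t * l) \<le> 1 - cmod (c + s *\<^sub>R p + t *\<^sub>R q)"
  shows "(\<integral>\<^sup>+z. indicator S z * ennreal (hyp_density z) \<partial>lborel) \<le> ennreal (1 / \<kappa>\<^sup>2)"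
proof -
  define m where "m t = (1 - t) * r + t * l" for t
  have m: "m t > 0" if "t \<in> {0..1}" for t
  proof (cases "t = 0")
    case False
    then show ?thesis using that pos unfolding m_def by (intro add_nonneg_pos) auto
  qed (use pos in \<open>simp add: m_def\<close>)
  have m_meas [measurable]: "m \<in> borel_measurable borel" unfolding m_def by measurable
  define H where "H t = 1 / (\<kappa>\<^sup>2 * (m t)\<^sup>2)" for t
  have H_meas [measurable]: "H \<in> borel_measurable borel" unfolding H_def by measurable
  have H_nonneg: "0 \<le> H t" for t by (simp add: H_def)
  \<comment> \<open>The lower bound on the boundary distance does not involve s, so integrating over
    s costs only the length of the unit interval.\<close>
  have inner: "(\<integral>\<^sup>+s. indicator S (c + s *\<^sub>R p + t *\<^sub>R q) * ennreal (hyp_density (c + s *\<^sub>R p + t *\<^sub>R q)) \<partial>lborel)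
      \<le> ennreal (H t) * indicator {0..1} t" for t
  proof -
    have *: "indicator S (c + s *\<^sub>R p + t *\<^sub>R q) * ennreal (hyp_density (c + s *\<^sub>R p + t *\<^sub>R q))
        \<le> ennreal (H t) * indicator {0..1} t * indicator {0..1} s" for s :: real
    proof (cases "c + s *\<^sub>R p + t *\<^sub>R q \<in> S")
      case True
      then have st: "0 < s" "0 < t" "s + t < 1" using S_tri by blast+
      then have "0 < \<kappa> * m t" using m[of t] pos by simp
      then have "hyp_density (c + s *\<^sub>R p + t *\<^sub>R q) \<le> 1 / (\<kappa> * m t)\<^sup>2"
        using low[OF st] by (intro hyp_density_le) (auto simp: m_def)
      then have "hyp_density (c + s *\<^sub>R p + t *\<^sub>R q) \<le> H t"
        by (simp add: H_def power_mult_distrib)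
      then show ?thesis using True st by (simp add: ennreal_leI)
    qed simp
    have "(\<integral>\<^sup>+s. indicator S (c + s *\<^sub>R p + t *\<^sub>R q) * ennreal (hyp_density (c + s *\<^sub>R p + t *\<^sub>R q)) \<partial>lborel)
        \<le> (\<integral>\<^sup>+s. ennreal (H t) * indicator {0..1} t * indicator {0..1::real} s \<partial>lborel)"
      by (rule nn_integral_mono) (rule *)
    also have "\<dots> = ennreal (H t) * indicator {0..1} t"
      by (subst nn_integral_cmult_indicator) auto
    finally show ?thesis .
  qed
  \<comment> \<open>Antiderivative of \<open>H\<close>; the factor \<open>1 / (r * l)\<close> in
    \<open>F 1 - F 0\<close> cancels against the bound on the determinant.\<close>
  define F where "F t = t / (r * \<kappa>\<^sup>2 * m t)" for t
  have "(\<integral>\<^sup>+t. ennreal (H t) * indicator {0..1} t \<partial>lborel) = ennreal (F 1 - F 0)"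
  proof (rule nn_integral_FTC_Icc[OF H_meas])
    fix t :: real assume t: "t \<in> {0..1}"
    have "(F has_field_derivative
        (1 * (r * \<kappa>\<^sup>2 * m t) - t * (r * \<kappa>\<^sup>2 * (l - r))) / ((r * \<kappa>\<^sup>2 * m t) * (r * \<kappa>\<^sup>2 * m t))) (at t)"
      unfolding F_def
    proof (rule DERIV_divide)
      show "((\<lambda>x. r * \<kappa>\<^sup>2 * m x) has_real_derivative r * \<kappa>\<^sup>2 * (l - r)) (at t)"
        unfolding m_def by (auto intro!: derivative_eq_intros)
    qed (use m[OF t] pos in auto)
    moreover have "1 * (r * \<kappa>\<^sup>2 * m t) - t * (r * \<kappa>\<^sup>2 * (l - r)) = r * \<kappa>\<^sup>2 * r"
      by (simp add: m_def algebra_simps)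
    moreover have "r * \<kappa>\<^sup>2 * r / ((r * \<kappa>\<^sup>2 * m t) * (r * \<kappa>\<^sup>2 * m t)) = H t"
      using pos m[OF t] by (simp add: H_def power2_eq_square)
    ultimately show "(F has_real_derivative H t) (at t)" by simp
  qed (use H_nonneg in auto)
  also have "F 1 - F 0 = 1 / (\<kappa>\<^sup>2 * (r * l))"
    by (simp add: F_def m_def mult.commute mult.left_commute)
  finally have outer: "(\<integral>\<^sup>+t. ennreal (H t) * indicator {0..1} t \<partial>lborel) = ennreal (1 / (\<kappa>\<^sup>2 * (r * l)))" .
  have "(\<integral>\<^sup>+z. indicator S z * ennreal (hyp_density z) \<partial>lborel)
     = ennreal \<bar>Re p * Im q - Im p * Re q\<bar> *
       (\<integral>\<^sup>+t. \<integral>\<^sup>+s. indicator S (c + s *\<^sub>R p + t *\<^sub>R q) * ennreal (hyp_density (c + s *\<^sub>R p + t *\<^sub>R q)) \<partial>lborel \<partial>lborel)"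
    by (rule nn_integral_complex_affine[OF _ D(1)]) measurable
  also have "\<dots> \<le> ennreal (r * l) * (\<integral>\<^sup>+t. ennreal (H t) * indicator {0..1} t \<partial>lborel)"
    using D(2) inner by (intro mult_mono nn_integral_mono ennreal_leI) auto
  also have "\<dots> = ennreal (1 / \<kappa>\<^sup>2)"
    using pos unfolding outer by (simp flip: ennreal_mult)
  finally show ?thesis .
qed

text \<open>The set contains a parallelogram of area |det| a b on which the density is at least
  K.\<close>

lemma hyp_area_ge:
  fixes c p q :: complex
  assumes S [measurable]: "S \<in> sets borel"
    and D: "Re p * Im q - Im p * Re q \<noteq> 0"
    and pos: "0 \<le> a" "0 \<le> b" "0 \<le> K"
    and low: "\<And>s t. 0 < s \<Longrightarrow> 0 < t \<Longrightarrow> s < a \<Longrightarrow> t < b \<Longrightarrow>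
        c + s *\<^sub>R p + t *\<^sub>R q \<in> S \<and> K \<le> hyp_density (c + s *\<^sub>R p + t *\<^sub>R q)"
  shows "ennreal (\<bar>Re p * Im q - Im p * Re q\<bar> * a * b * K)
    \<le> (\<integral>\<^sup>+z. indicator S z * ennreal (hyp_density z) \<partial>lborel)"
proof -
  have "ennreal (\<bar>Re p * Im q - Im p * Re q\<bar> * a * b * K) =
     ennreal \<bar>Re p * Im q - Im p * Re q\<bar> * (ennreal K * ennreal a * ennreal b)"
    using pos by (simp add: ennreal_mult' mult.assoc mult.left_commute mult.commute)
  also have "ennreal K * ennreal a * ennreal b
     = (\<integral>\<^sup>+t. ennreal K * ennreal a * indicator {0<..<b} t \<partial>lborel)"
    using pos by (subst nn_integral_cmult_indicator) auto
  also have "\<dots> = (\<integral>\<^sup>+t. \<integral>\<^sup>+s. ennreal K * indicator {0<..<b} t * indicator {0<..<a} s \<partial>lborel \<partial>lborel)"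
  proof (rule nn_integral_cong)
    fix t
    have "(\<integral>\<^sup>+s. ennreal K * indicator {0<..<b} t * indicator {0<..<a} s \<partial>lborel)
        = ennreal K * indicator {0<..<b} t * ennreal a"
      using pos by (subst nn_integral_cmult_indicator) auto
    then show "ennreal K * ennreal a * indicator {0<..<b} t
        = (\<integral>\<^sup>+s. ennreal K * indicator {0<..<b} t * indicator {0<..<a} s \<partial>lborel)"
      by (simp add: ac_simps)
  qed
  also have "ennreal \<bar>Re p * Im q - Im p * Re q\<bar> * \<dots> \<le> ennreal \<bar>Re p * Im q - Im p * Re q\<bar> *
       (\<integral>\<^sup>+t. \<integral>\<^sup>+s. indicator S (c + s *\<^sub>R p + t *\<^sub>R q) * ennreal (hyp_density (c + s *\<^sub>R p + t *\<^sub>R q)) \<partial>lborel \<partial>lborel)"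
  proof (intro mult_left_mono nn_integral_mono)
    fix t s
    show "ennreal K * indicator {0<..<b} t * indicator {0<..<a} s
        \<le> indicator S (c + s *\<^sub>R p + t *\<^sub>R q) * ennreal (hyp_density (c + s *\<^sub>R p + t *\<^sub>R q))"
      using low[of s t] by (auto simp: indicator_def ennreal_leI)
  qed simp
  also have "\<dots> = (\<integral>\<^sup>+z. indicator S z * ennreal (hyp_density z) \<partial>lborel)"
    by (rule nn_integral_complex_affine[OF _ D, symmetric]) measurable
  finally show ?thesis .
qed

section \<open>Areas of the placed triangles\<close>

context uniformized_surface
begin

lemma place_bary_affine: "place d (B d s t) = apex d + s *\<^sub>R (rot d * rc d) + t *\<^sub>R (rot d * lc d)"
  by (simp add: place_def bary_def algebra_simps scaleR_conv_of_real)

lemma place_bary_in_otri [simp]: "place d (B d s t) \<in> otri d \<longleftrightarrow> 0 < s \<and> 0 < t \<and> s + t < 1"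
  by (simp add: otri_iff)

lemma Im_cnj_mult: "Re p * Im q - Im p * Re q = Im (cnj p * q)"
  by simp

text \<open>The determinant is the imaginary part of \<open>cnj p * q\<close>, which a common
  unimodular factor does not change. The value is twice the area of the triangle.\<close>

lemma det_corners:
  "Re (rot d * rc d) * Im (rot d * lc d) - Im (rot d * rc d) * Re (rot d * lc d)
     = R (right_face M d) * R (left_face M d) * sin (\<Theta> (edge M d))"
proof -
  have "cnj (rot d * rc d) * (rot d * lc d) = (rot d * cnj (rot d)) * (cnj (rc d) * lc d)"
    by (simp add: ac_simps)
  also have "rot d * cnj (rot d) = 1" by (simp add: complex_norm_square[symmetric])
  finally have "cnj (rot d * rc d) * (rot d * lc d) = cnj (rc d) * lc d" by simp
  then show ?thesis
    unfolding Im_cnj_mult by (simp only:) (simp add: right_corner_def left_corner_def)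
qed

lemma det_corners_pos:
  "R (right_face M d) * R (left_face M d) * sin (\<Theta> (edge M d)) > 0"
  by (simp add: R_pos R_pos_right sin_Theta_pos)

text \<open>In barycentric coordinates the boundary of a triangle meets every line t = const, except
  t = 0, in at most the points s = 0 and s = 1 - t. Countably many triangles leave only a null
  set.\<close>

lemma AE_otri: "AE z in lborel. z \<in> \<D> \<longrightarrow> (\<exists>d. z \<in> otri d)"
proof -
  have null: "AE z in lborel. z \<in> tri d \<longrightarrow> z \<in> otri d" for d
  proof -
    let ?S = "tri d - otri d"
    let ?D = "Re (rot d * rc d) * Im (rot d * lc d) - Im (rot d * rc d) * Re (rot d * lc d)"
    have [measurable]: "?S \<in> sets borel"
      using closed_tri open_otri by (intro sets.Diff) auto
    have inner: "(\<integral>\<^sup>+s. indicator ?S (place d (B d s t)) \<partial>lborel) = 0" if "t \<noteq> 0" for t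
    proof -
      have "AE s in lborel. indicator ?S (place d (B d s t)) = (0::ennreal)"
        using AE_lborel_singleton[of "0::real"] AE_lborel_singleton[of "1 - t"]
      proof eventually_elim
        case (elim s)
        then show ?case using \<open>t \<noteq> 0\<close> by (auto simp: indicator_def tri_iff)
      qed
      then have "(\<integral>\<^sup>+s. indicator ?S (place d (B d s t)) \<partial>lborel) = (\<integral>\<^sup>+s. 0 \<partial>(lborel::real measure))"
        by (rule nn_integral_cong_AE)
      then show ?thesis by simp
    qed
    have "emeasure lborel ?S = (\<integral>\<^sup>+z. indicator ?S z \<partial>lborel)" by simp
    also have "\<dots> = ennreal \<bar>?D\<bar> * (\<integral>\<^sup>+t. \<integral>\<^sup>+s. indicator ?S (place d (B d s t)) \<partial>lborel \<partial>lborel)"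
      unfolding place_bary_affine
    proof (rule nn_integral_complex_affine)
      show "?D \<noteq> 0" unfolding det_corners using det_corners_pos[of d] by (rule less_imp_neq[symmetric])
    qed measurable
    also have "(\<integral>\<^sup>+t. \<integral>\<^sup>+s. indicator ?S (place d (B d s t)) \<partial>lborel \<partial>lborel) = (\<integral>\<^sup>+t. 0 \<partial>(lborel::real measure))"
      using AE_lborel_singleton[of "0::real"] by (intro nn_integral_cong_AE) (auto elim!: eventually_mono simp: inner)
    finally have "?S \<in> null_sets lborel" by (intro null_setsI) auto
    then show ?thesis by (rule AE_I') auto
  qed
  have "AE z in lborel. \<forall>d\<in>UNIV. z \<in> tri d \<longrightarrow> z \<in> otri d"
    by (intro AE_ball_countable' null countable_darts)
  then show ?thesis
  proof eventually_elim
    case (elim z)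
    then show ?case using Union_tri by blast
  qed
qed

definition harea :: "'d \<Rightarrow> ennreal" where
  "harea d = (\<integral>\<^sup>+z. indicator (otri d) z * ennreal (hyp_density z) \<partial>lborel)"

lemma otri_borel [measurable]: "otri d \<in> sets borel"
  using open_otri by auto

lemma circumdisk_norm:
  "cmod (place d (lc d)) + R (left_face M d) \<le> 1" "cmod (place d (rc d)) + R (right_face M d) \<le> 1"
proof -
  have *: "cmod (place d (lc d)) + R (left_face M d) \<le> 1" for d
    using circumdisk_subset[of d] R_pos[of d] unfolding ball_subset_ball_iff by simp
  show "cmod (place d (lc d)) + R (left_face M d) \<le> 1" by (rule *)
  show "cmod (place d (rc d)) + R (right_face M d) \<le> 1"
    using *[of "opp M d"] by (simp add: place_opp_lc left_face_opp)
qed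

text \<open>Two circles inside the disk that meet at a point very close to its boundary are almost
  tangent to the boundary there, so they meet at a small angle.\<close>

lemma apex_boundary_dist:
  "(1 - sqrt ((1 + cos (\<Theta> (edge M d))) / 2)) * min (R (right_face M d)) (R (left_face M d))
     \<le> 1 - cmod (apex d)"
proof -
  define r l where "r = R (right_face M d)" and "l = R (left_face M d)"
  have pos: "0 < r" "0 < l" using R_pos[of d] R_pos_right[of d] by (simp_all add: r_def l_def)
  define i where "i = apex d"
  define \<eta> where "\<eta> = 1 - cmod i"
  have i: "cmod i < 1" using apex_in_tri[of d] tri_subset[of d] by (auto simp: i_def)
  \<comment> \<open>Here v leads from the apex to a centre and x is the radius. Squaring |i + v|
    \<le> 1 - x shows that the unit vector v / x has inner product at most -(1 - \<eta> / x) with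
    i.\<close>
  have key: "1 - \<eta> / x \<le> - (i \<bullet> ((1 / x) *\<^sub>R v))" if "x > 0" "cmod (i + v) + x \<le> 1" "cmod v = x" for x v
  proof -
    have "(cmod (i + v))\<^sup>2 \<le> (1 - x)\<^sup>2" using that by (intro power_mono) auto
    moreover have "(cmod (i + v))\<^sup>2 = (cmod i)\<^sup>2 + 2 * (i \<bullet> v) + x\<^sup>2"
      using that(3) by (simp add: power2_norm_eq_inner inner_add inner_commute flip: that(3))
    moreover have "(cmod i)\<^sup>2 = 1 - 2 * \<eta> + \<eta>\<^sup>2" by (simp add: \<eta>_def power2_eq_square algebra_simps)
    moreover have "(1 - x)\<^sup>2 = 1 - 2 * x + x\<^sup>2" by (simp add: power2_eq_square algebra_simps)
    ultimately have "x - \<eta> \<le> - (i \<bullet> v)" using zero_le_power2[of \<eta>] by linarith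
    then have "(x - \<eta>) / x \<le> - (i \<bullet> v) / x" using that(1) by (intro divide_right_mono) auto
    then show ?thesis using that(1) by (simp add: diff_divide_distrib)
  qed
  define e f where "e = (1 / r) *\<^sub>R (rot d * rc d)" and "f = (1 / l) *\<^sub>R (rot d * lc d)"
  have "1 - \<eta> / r \<le> - (i \<bullet> e)" unfolding e_def
    using circumdisk_norm(2)[of d] pos
    by (intro key) (auto simp: place_def i_def r_def norm_mult cmod_rc add.commute)
  moreover have "1 - \<eta> / l \<le> - (i \<bullet> f)" unfolding f_def
    using circumdisk_norm(1)[of d] pos
    by (intro key) (auto simp: place_def i_def l_def norm_mult cmod_lc add.commute)
  moreover have "- (i \<bullet> (e + f)) \<le> cmod (e + f)"
  proof -
    have "- (i \<bullet> (e + f)) \<le> cmod i * cmod (e + f)"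
      using norm_cauchy_schwarz[of "- i" "e + f"] by simp
    also have "\<dots> \<le> 1 * cmod (e + f)" using i by (intro mult_right_mono) auto
    finally show ?thesis by simp
  qed
  ultimately have A: "2 - \<eta> / r - \<eta> / l \<le> cmod (e + f)" by (simp add: inner_add_right)
  define m where "m = min r l"
  have m: "0 < m" "m \<le> r" "m \<le> l" using pos by (auto simp: m_def)
  have "\<eta> > 0" using i by (simp add: \<eta>_def)
  have "\<eta> / r \<le> \<eta> / m" "\<eta> / l \<le> \<eta> / m"
    using m pos \<open>\<eta> > 0\<close> by (auto intro!: divide_left_mono)
  \<comment> \<open>This is 2 cos(\<Theta> / 2), since e and f are unit vectors at angle \<Theta>.
    Comparison with 2 - 2 \<eta> / m bounds \<eta> from below.\<close>
  moreover have "cmod (e + f) = 2 * sqrt ((1 + cos (\<Theta> (edge M d))) / 2)"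
  proof -
    have "e + f = rot d * B d (1 / r) (1 / l)"
      by (simp add: e_def f_def bary_def algebra_simps scaleR_conv_of_real)
    then have "cmod (e + f) = cmod (B d (1 / r) (1 / l))" by (simp add: norm_mult)
    moreover have "(cmod (B d (1 / r) (1 / l)))\<^sup>2 = 2 + 2 * cos (\<Theta> (edge M d))"
      unfolding cmod_bary_sq using pos by (simp add: r_def l_def)
    moreover have c1: "0 \<le> 1 + cos (\<Theta> (edge M d))"
      using cos_ge_minus_one[of "\<Theta> (edge M d)"] by linarith
    then have "0 \<le> (1 + cos (\<Theta> (edge M d))) / 2"
      by simp
    then have "(sqrt ((1 + cos (\<Theta> (edge M d))) / 2))\<^sup>2 = (1 + cos (\<Theta> (edge M d))) / 2"
      by (rule real_sqrt_pow2)
    ultimately have "(cmod (e + f))\<^sup>2 = (2 * sqrt ((1 + cos (\<Theta> (edge M d))) / 2))\<^sup>2"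
      by (simp only: power_mult_distrib) simp
    then show ?thesis
      using c1 by (subst (asm) power2_eq_iff_nonneg) auto
  qed
  ultimately have "1 - sqrt ((1 + cos (\<Theta> (edge M d))) / 2) \<le> \<eta> / m" using A by simp
  then show ?thesis
    using m by (simp add: pos_le_divide_eq m_def r_def l_def \<eta>_def i_def)
qed

text \<open>1 - |z| is concave, and at each centre it is at least the radius because the circumdisk
  lies in the unit disk.\<close>

lemma one_minus_cmod_concave:
  assumes "0 \<le> s" "0 \<le> t" "s + t \<le> 1"
  shows "(1 - s - t) * (1 - cmod (apex d)) + s * R (right_face M d) + t * R (left_face M d)
    \<le> 1 - cmod (place d (B d s t))"
proof -
  have "cmod (place d (B d s t))
      \<le> s * cmod (place d (rc d)) + t * cmod (place d (lc d)) + (1 - s - t) * cmod (apex d)"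
    unfolding place_bary using assms by (intro norm_triangle_le add_mono) auto
  moreover have "s * cmod (place d (rc d)) \<le> s * (1 - R (right_face M d))"
    using circumdisk_norm(2)[of d] assms by (intro mult_left_mono) auto
  moreover have "t * cmod (place d (lc d)) \<le> t * (1 - R (left_face M d))"
    using circumdisk_norm(1)[of d] assms by (intro mult_left_mono) auto
  ultimately show ?thesis by (simp add: algebra_simps)
qed

text \<open>The boundary distance is at least \<kappa> min(r, l) at the apex and at least \<kappa> r
  and \<kappa> l at the centres. If r is the smaller radius, interpolating these three bounds gives
  a function of the left weight t alone, the form \<open>hyp_area_le\<close> needs; otherwise the
  corners are exchanged.\<close>

lemma harea_le:
  assumes \<kappa>: "0 < \<kappa>" "\<kappa> \<le> 1" "\<kappa> \<le> 1 - sqrt ((1 + cos (\<Theta> (edge M d))) / 2)"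
  shows "harea d \<le> ennreal (1 / \<kappa>\<^sup>2)"
proof -
  define r l where "r = R (right_face M d)" and "l = R (left_face M d)"
  have pos: "0 < r" "0 < l" using R_pos[of d] R_pos_right[of d] by (simp_all add: r_def l_def)
  let ?p = "rot d * rc d" and ?q = "rot d * lc d"
  have det: "Re ?p * Im ?q - Im ?p * Re ?q = r * l * sin (\<Theta> (edge M d))"
    by (simp only: det_corners r_def l_def)
  have det_pos: "0 < r * l * sin (\<Theta> (edge M d))" using pos sin_Theta_pos by simp
  have det_le: "r * l * sin (\<Theta> (edge M d)) \<le> r * l"
    using pos mult_left_mono[OF sin_le_one, of "r * l"] by simp
  have "\<kappa> * min r l \<le> (1 - sqrt ((1 + cos (\<Theta> (edge M d))) / 2)) * min r l"
    using \<kappa> pos by (intro mult_right_mono) auto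
  then have ap: "\<kappa> * min r l \<le> 1 - cmod (apex d)"
    using apex_boundary_dist[of d] by (simp add: r_def l_def)
  have low: "\<kappa> * ((1 - s - t) * min r l + s * r + t * l) \<le> 1 - cmod (place d (B d s t))"
    if st: "0 < s" "0 < t" "s + t < 1" for s t
  proof -
    have "\<kappa> * ((1 - s - t) * min r l + s * r + t * l)
        = (1 - s - t) * (\<kappa> * min r l) + \<kappa> * (s * r) + \<kappa> * (t * l)"
      by (simp add: algebra_simps)
    also have "\<dots> \<le> (1 - s - t) * (1 - cmod (apex d)) + 1 * (s * r) + 1 * (t * l)"
      using st pos \<kappa> ap by (intro add_mono mult_left_mono mult_right_mono) auto
    also have "\<dots> \<le> 1 - cmod (place d (B d s t))"
      using one_minus_cmod_concave[of s t d] st by (simp add: r_def l_def)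
    finally show ?thesis .
  qed
  show ?thesis
  proof (cases "r \<le> l")
    case True
    show ?thesis unfolding harea_def
    proof (rule hyp_area_le[where c = "apex d" and p = ?p and q = ?q and r = r and l = l])
      fix s t :: real assume st: "0 < s" "0 < t" "s + t < 1"
      have "(1 - t) * r + t * l = (1 - s - t) * min r l + s * r + t * l"
        using True by (simp add: algebra_simps)
      then show "\<kappa> * ((1 - t) * r + t * l) \<le> 1 - cmod (apex d + s *\<^sub>R ?p + t *\<^sub>R ?q)"
        using low[OF st] by (simp only: place_bary_affine)
    qed (use pos \<kappa> det det_pos det_le in \<open>auto simp flip: place_bary_affine\<close>)
  next
    case False
    show ?thesis unfolding harea_def
    proof (rule hyp_area_le[where c = "apex d" and p = ?q and q = ?p and r = l and l = r])
      fix s t :: real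
      have eq: "apex d + s *\<^sub>R ?q + t *\<^sub>R ?p = place d (B d t s)"
        by (simp add: place_bary_affine)
      show "0 < s \<and> 0 < t \<and> s + t < 1" if "apex d + s *\<^sub>R ?q + t *\<^sub>R ?p \<in> otri d"
        using that unfolding eq by auto
      assume st: "0 < s" "0 < t" "s + t < 1"
      have "(1 - t) * l + t * r = (1 - t - s) * min r l + t * r + s * l"
        using False by (simp add: algebra_simps)
      moreover have "\<kappa> * ((1 - t - s) * min r l + t * r + s * l) \<le> 1 - cmod (place d (B d t s))"
        using low[of t s] st by simp
      ultimately show "\<kappa> * ((1 - t) * l + t * r) \<le> 1 - cmod (apex d + s *\<^sub>R ?q + t *\<^sub>R ?p)"
        unfolding eq by (simp only:)
    next
      show "Re ?q * Im ?p - Im ?q * Re ?p \<noteq> 0" using det det_pos by (simp add: mult.commute)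
      have "Re ?q * Im ?p - Im ?q * Re ?p = - (Re ?p * Im ?q - Im ?p * Re ?q)" by simp
      then show "\<bar>Re ?q * Im ?p - Im ?q * Re ?p\<bar> \<le> l * r"
        using det det_pos det_le by (simp only: abs_minus_cancel) (simp add: mult.commute)
    qed (use pos \<kappa> in auto)
  qed
qed

text \<open>At scale m = min(r, l) a parallelogram of points within distance m of the apex fits into
  the triangle. The centre of the smaller circle is m away from the apex and at most m / c from the
  boundary, so each point of the parallelogram is at most m / c + 2 m from the boundary. All powers
  of m cancel.\<close>

lemma harea_ge:
  assumes c: "0 < c"
    and low: "\<And>d. c * (1 - cmod (place d (lc d))) \<le> R (left_face M d)"
  shows "ennreal (sin (\<Theta> (edge M d)) / (16 * (1 / c + 2)\<^sup>2)) \<le> harea d"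
proof -
  define r l where "r = R (right_face M d)" and "l = R (left_face M d)"
  have pos: "0 < r" "0 < l" using R_pos[of d] R_pos_right[of d] by (simp_all add: r_def l_def)
  let ?p = "rot d * rc d" and ?q = "rot d * lc d"
  have det: "Re ?p * Im ?q - Im ?p * Re ?q = r * l * sin (\<Theta> (edge M d))"
    by (simp only: det_corners r_def l_def)
  have det_pos: "0 < r * l * sin (\<Theta> (edge M d))" using pos sin_Theta_pos by simp
  define m where "m = min r l"
  have m: "0 < m" "m \<le> r" "m \<le> l" using pos by (auto simp: m_def)
  have "c * (1 - cmod (place d (rc d))) \<le> r"
    using low[of "opp M d"] by (simp add: place_opp_lc left_face_opp r_def)
  moreover have "c * (1 - cmod (place d (lc d))) \<le> l" using low[of d] by (simp add: l_def)
  moreover have "cmod (place d (rc d) - apex d) = r" "cmod (place d (lc d) - apex d) = l"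
    by (simp_all add: dist_apex cmod_rc cmod_lc r_def l_def)
  ultimately obtain P where P: "c * (1 - cmod P) \<le> m" "cmod (P - apex d) = m"
    unfolding m_def by (metis min_def)
  define h where "h = (1 / c + 2) * m"
  have "h > 0" unfolding h_def using c m by (intro mult_pos_pos add_pos_pos) auto
  define K where "K = 1 / (4 * h\<^sup>2)"
  have "ennreal (\<bar>Re ?p * Im ?q - Im ?p * Re ?q\<bar> * (m / (2 * r)) * (m / (2 * l)) * K) \<le> harea d"
    unfolding harea_def
  proof (rule hyp_area_ge[where c = "apex d"])
    fix s t :: real assume st: "0 < s" "0 < t" "s < m / (2 * r)" "t < m / (2 * l)"
    have sr: "s * r < m / 2" "t * l < m / 2" using st pos by (auto simp: field_simps)
    have "m / (2 * r) \<le> 1 / 2" "m / (2 * l) \<le> 1 / 2" using m pos by (auto simp: field_simps)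
    then have "s + t < 1" using st by linarith
    then have otri: "place d (B d s t) \<in> otri d" using st by simp
    then have "place d (B d s t) \<in> \<D>" using otri_subset tri_subset by blast
    then have disk: "cmod (place d (B d s t)) < 1" by simp
    have "cmod (place d (B d s t) - apex d) \<le> cmod (s *\<^sub>R rc d) + cmod (t *\<^sub>R lc d)"
      unfolding dist_apex bary_def by (rule norm_triangle_ineq)
    also have "\<dots> \<le> m" using sr st by (simp add: cmod_rc cmod_lc flip: r_def l_def)
    finally have "cmod (place d (B d s t) - apex d) \<le> m" .
    then have "cmod P \<le> cmod (place d (B d s t)) + 2 * m"
      using P(2) norm_triangle_ineq[of "P - apex d" "apex d - place d (B d s t)"]
        norm_triangle_ineq[of "P - place d (B d s t)" "place d (B d s t)"]
      by (simp add: norm_minus_commute)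
    moreover have "1 - cmod P \<le> m / c" using P(1) c by (simp add: pos_le_divide_eq mult.commute)
    ultimately have "1 - cmod (place d (B d s t)) \<le> h" by (simp add: h_def algebra_simps)
    then have "K \<le> hyp_density (place d (B d s t))"
      unfolding K_def using disk by (intro hyp_density_ge)
    then show "apex d + s *\<^sub>R ?p + t *\<^sub>R ?q \<in> otri d \<and> K \<le> hyp_density (apex d + s *\<^sub>R ?p + t *\<^sub>R ?q)"
      using otri by (simp only: place_bary_affine)
  qed (use m pos det det_pos in \<open>auto simp: K_def\<close>)
  also have "\<bar>Re ?p * Im ?q - Im ?p * Re ?q\<bar> * (m / (2 * r)) * (m / (2 * l)) * K
      = sin (\<Theta> (edge M d)) / (16 * (1 / c + 2)\<^sup>2)"
  proof -
    have "\<bar>Re ?p * Im ?q - Im ?p * Re ?q\<bar> = r * l * sin (\<Theta> (edge M d))"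
      using det det_pos by simp
    then show ?thesis
      using pos m c by (simp add: K_def h_def power_mult_distrib power2_eq_square)
  qed
  finally show ?thesis .
qed

text \<open>The open triangles are disjoint and fill the disk up to a null set, so the integral
  becomes a sum over darts. Measurability is obtained on the way: \<open>G\<close>, cut off to the
  open triangles, is Borel and agrees almost everywhere with the integrand \<open>F\<close>, which
  is then Lebesgue measurable by completeness.\<close>

lemma hyperbolic_L2_iff:
  assumes m: "\<And>d z. z \<in> otri d \<Longrightarrow> (cmod (f z))\<^sup>2 = m d"
  shows "hyperbolic_L2 f \<longleftrightarrow> (\<integral>\<^sup>+d. ennreal (m d) * harea d \<partial>count_space UNIV) < \<infinity>"
proof -
  define \<Omega> where "\<Omega> = (\<Union>d. otri d)"
  define F where "F z = indicator \<D> z *\<^sub>R ((cmod (f z))\<^sup>2 / (1 - (cmod z)\<^sup>2)\<^sup>2)" for z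
  define G where "G z = (if z \<in> \<Omega> then F z else 0)" for z
  have "open \<Omega>" unfolding \<Omega>_def using open_otri by blast
  have F_otri: "F z = m d * hyp_density z" if "z \<in> otri d" for z d
  proof -
    have "z \<in> \<D>" using that otri_subset tri_subset by blast
    then show ?thesis using m[OF that] by (simp add: F_def hyp_density_def)
  qed
  have m_nonneg: "0 \<le> m d" for d
  proof -
    have "place d (B d (1/3) (1/3)) \<in> otri d" by simp
    then show ?thesis using m by (metis zero_le_power2)
  qed
  have G_meas: "G \<in> borel_measurable lborel"
  proof (rule measurable_piecewise_restrict[where C = "insert (- \<Omega>) (range otri)"])
    show "countable (insert (- \<Omega>) (range otri))" by (simp add: countable_darts)
    show "space lborel \<subseteq> \<Union>(insert (- \<Omega>) (range otri))" by (auto simp: \<Omega>_def)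
    fix A assume A: "A \<in> insert (- \<Omega>) (range otri)"
    then show "A \<inter> space lborel \<in> sets lborel" using \<open>open \<Omega>\<close> open_otri by auto
    show "G \<in> borel_measurable (restrict_space lborel A)"
    proof (cases "A = - \<Omega>")
      case True
      then have "G \<in> borel_measurable (restrict_space lborel A) \<longleftrightarrow>
          (\<lambda>_. 0::real) \<in> borel_measurable (restrict_space lborel A)"
        by (intro measurable_cong) (auto simp: G_def space_restrict_space)
      then show ?thesis by simp
    next
      case False
      then obtain d where d: "A = otri d" using A by blast
      have "G \<in> borel_measurable (restrict_space lborel A) \<longleftrightarrow>
          (\<lambda>z. m d * hyp_density z) \<in> borel_measurable (restrict_space lborel A)"
        by (intro measurable_cong) (auto simp: G_def space_restrict_space d \<Omega>_def F_otri)
      then show ?thesis by (auto intro!: measurable_restrict_space1)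
    qed
  qed
  have FG: "AE z in lborel. F z = G z"
    using AE_otri
  proof eventually_elim
    case (elim z)
    then show ?case by (cases "z \<in> \<D>") (auto simp: G_def F_def \<Omega>_def)
  qed
  have F_meas: "F \<in> borel_measurable lebesgue"
  proof -
    have G: "G \<in> borel_measurable lebesgue" using G_meas by (rule measurable_completion)
    show ?thesis
    proof (rule measurableI)
      fix A :: "real set" assume "A \<in> sets borel"
      then have GA: "G -` A \<inter> space lebesgue \<in> sets lebesgue"
        by (rule measurable_sets[OF G])
      have "AE z in lebesgue. z \<in> G -` A \<inter> space lebesgue \<longleftrightarrow> z \<in> F -` A \<inter> space lebesgue"
        using AE_completion[OF FG] by (auto elim: eventually_mono)
      then show "F -` A \<inter> space lebesgue \<in> sets lebesgue"
        by (rule completion.in_sets_AE) (use GA in auto)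
    qed simp
  qed
  have "hyperbolic_L2 f \<longleftrightarrow> integrable lebesgue F"
    by (simp add: hyperbolic_L2_def set_integrable_def F_def [abs_def])
  also have "\<dots> \<longleftrightarrow> integrable lebesgue G"
    using F_meas G_meas AE_completion[OF FG] by (intro integrable_cong_AE) (auto intro: measurable_completion)
  also have "\<dots> \<longleftrightarrow> integrable lborel G"
    using G_meas by (rule integrable_completion)
  also have "\<dots> \<longleftrightarrow> (\<integral>\<^sup>+z. ennreal (norm (G z)) \<partial>lborel) < \<infinity>"
    using G_meas by (simp add: integrable_iff_bounded)
  also have "(\<integral>\<^sup>+z. ennreal (norm (G z)) \<partial>lborel) = (\<integral>\<^sup>+z. \<integral>\<^sup>+d. ennreal (m d) *
      (indicator (otri d) z * ennreal (hyp_density z)) \<partial>count_space UNIV \<partial>lborel)"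
  proof (rule nn_integral_cong)
    fix z
    show "ennreal (norm (G z)) = (\<integral>\<^sup>+d. ennreal (m d) *
      (indicator (otri d) z * ennreal (hyp_density z)) \<partial>count_space UNIV)"
    proof (cases "z \<in> \<Omega>")
      case True
      then obtain e where e: "z \<in> otri e" by (auto simp: \<Omega>_def)
      have "indicator (otri d) z = (indicator {e} d :: ennreal)" for d
        using e otri_disjoint[of z d e] otri_subset by (auto simp: indicator_def)
      then have "(\<integral>\<^sup>+d. ennreal (m d) * (indicator (otri d) z * ennreal (hyp_density z)) \<partial>count_space UNIV)
          = (\<integral>\<^sup>+d. ennreal (m e * hyp_density z) * indicator {e} d \<partial>count_space UNIV)"
        using m_nonneg by (intro nn_integral_cong) (auto simp: indicator_def ennreal_mult)
      also have "\<dots> = ennreal (m e * hyp_density z)"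
        by (subst nn_integral_cmult_indicator) auto
      finally show ?thesis
        using True m_nonneg by (simp add: G_def F_otri[OF e] abs_mult)
    next
      case False
      then show ?thesis by (auto simp: G_def \<Omega>_def indicator_def)
    qed
  qed
  also have "\<dots> = (\<integral>\<^sup>+d. \<integral>\<^sup>+z. ennreal (m d) *
      (indicator (otri d) z * ennreal (hyp_density z)) \<partial>lborel \<partial>count_space UNIV)"
    by (rule nn_integral_count_space_nn_integral[OF countable_darts]) measurable
  also have "\<dots> = (\<integral>\<^sup>+d. ennreal (m d) * harea d \<partial>count_space UNIV)"
    unfolding harea_def by (intro nn_integral_cong nn_integral_cmult) measurable
  finally show ?thesis .
qed

end

section \<open>Hyperbolic circles and analytic preliminaries\<close>

text \<open>With q = 1 - |p|^2 the circle is |p - z|^2 = K q (1 - |z|^2), where K = sinh^2(\<rho> /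
  2). Opposite points of the Euclidean sphere give p = N c, and (N r)^2 = K (1 + K) q^2 follows. As
  N (1 - |c|) \<le> (1 + K) q, the ratio r / (1 - |c|) is at least sqrt(K / (1 + K)) = tanh(\<rho> /
  2), which increases with \<rho>.\<close>

lemma hyperbolic_circle_euclidean_radius:
  assumes eq: "sphere c r = hyperbolic_circle p \<rho>" and r: "r > 0" and p: "p \<in> ball 0 1"
    and \<rho>: "0 < \<rho>\<^sub>0" "\<rho>\<^sub>0 \<le> \<rho>"
  defines "K\<^sub>0 \<equiv> (cosh \<rho>\<^sub>0 - 1) / 2"
  shows "sqrt (K\<^sub>0 / (1 + K\<^sub>0)) * (1 - cmod c) \<le> r"
proof -
  define K where "K = (cosh \<rho> - 1) / 2"
  define q where "q = 1 - (cmod p)\<^sup>2"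
  have q: "0 < q" using p by (simp add: q_def abs_square_less_1)
  have "cosh \<rho>\<^sub>0 \<le> cosh \<rho>" using \<rho> by (subst cosh_real_nonneg_le_iff) auto
  moreover have "1 < cosh \<rho>\<^sub>0" using \<rho> cosh_real_strict_mono[of 0 \<rho>\<^sub>0] by simp
  ultimately have K: "0 < K\<^sub>0" "K\<^sub>0 \<le> K" unfolding K_def K\<^sub>0_def by (simp_all add: divide_right_mono)
  then have "0 < K" by simp
  define N where "N = 1 + K * q"
  have N: "1 < N" using \<open>0 < K\<close> q by (simp add: N_def)
  have circ: "N * (cmod z)\<^sup>2 - 2 * (z \<bullet> p) = K * q - (cmod p)\<^sup>2" if "z \<in> sphere c r" for z
  proof -
    have z: "z \<in> ball 0 1" "poincare_dist p z = \<rho>"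
      using that unfolding eq by (auto simp: hyperbolic_circle_def)
    define y where "y = 1 - (cmod z)\<^sup>2"
    have y: "0 < y" using z(1) by (simp add: y_def abs_square_less_1)
    define x where "x = 2 * (cmod (p - z))\<^sup>2 / (q * y)"
    have "0 \<le> x" using q y by (simp add: x_def)
    have "arcosh (1 + x) = \<rho>" using z(2) by (simp add: poincare_dist_def x_def q_def y_def)
    then have "cosh \<rho> = 1 + x" using \<open>0 \<le> x\<close> cosh_arcosh_real[of "1 + x"] by simp
    then have "K = (cmod (p - z))\<^sup>2 / (q * y)" by (simp add: K_def x_def)
    then have "(cmod (p - z))\<^sup>2 = K * q * y" using q y by simp
    moreover have "(cmod (p - z))\<^sup>2 = (cmod z)\<^sup>2 - 2 * (z \<bullet> p) + (cmod p)\<^sup>2"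
      by (subst norm_minus_commute) (rule cmod_diff_sq)
    ultimately show ?thesis by (simp add: N_def y_def algebra_simps)
  qed
  have sph: "c + r *\<^sub>R e \<in> sphere c r" if "cmod e = 1" for e
    using that r by (simp add: dist_norm)
  have nsq: "(cmod (c + r *\<^sub>R e))\<^sup>2 = (cmod c)\<^sup>2 + 2 * r * (c \<bullet> e) + r\<^sup>2" if "cmod e = 1" for e
  proof -
    have "e \<bullet> e = 1" using that by (simp flip: power2_norm_eq_inner)
    then show ?thesis
      unfolding power2_norm_eq_inner by (simp add: inner_add inner_commute power2_eq_square algebra_simps)
  qed
  define v where "v = N *\<^sub>R c - p"
  have two: "N * ((cmod c)\<^sup>2 + r\<^sup>2) + 2 * r * (v \<bullet> e) - 2 * (c \<bullet> p) = K * q - (cmod p)\<^sup>2"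
    if "cmod e = 1" for e
    using circ[OF sph[OF that]] unfolding nsq[OF that]
    by (simp add: v_def inner_diff inner_add inner_commute algebra_simps)
  \<comment> \<open>The equation holds at c + r e and at c - r e; only the term odd in e survives
    subtraction.\<close>
  have ort: "v \<bullet> e = 0" if "cmod e = 1" for e
  proof -
    have "2 * r * (v \<bullet> - e) = - (2 * r * (v \<bullet> e))" by simp
    moreover have "cmod (- e) = 1" using that by simp
    ultimately have "2 * r * (v \<bullet> e) = 0" using two[OF that] two[of "- e"] by linarith
    then show ?thesis using r by simp
  qed
  have "v = 0"
  proof (rule ccontr)
    assume "v \<noteq> 0"
    then have "v \<bullet> ((1 / cmod v) *\<^sub>R v) = 0" by (intro ort) simp
    then show False using \<open>v \<noteq> 0\<close> by simp
  qed
  then have pc: "p = N *\<^sub>R c" by (simp add: v_def)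
  have "N * ((cmod c)\<^sup>2 + r\<^sup>2) - 2 * (c \<bullet> p) = K * q - (cmod p)\<^sup>2"
    using two[of 1] \<open>v = 0\<close> by simp
  moreover have "c \<bullet> p = N * (cmod c)\<^sup>2" by (simp add: pc power2_norm_eq_inner)
  ultimately have "N * r\<^sup>2 = N * (cmod c)\<^sup>2 + (K * q - (1 - q))"
    by (simp add: q_def algebra_simps)
  then have "N\<^sup>2 * r\<^sup>2 = N\<^sup>2 * (cmod c)\<^sup>2 + N * (K * q - (1 - q))"
    by (simp only: power2_eq_square[of N] mult.assoc flip: distrib_left)
  moreover have Nc: "N\<^sup>2 * (cmod c)\<^sup>2 = (cmod p)\<^sup>2" using N by (simp add: pc power_mult_distrib)
  ultimately have "N\<^sup>2 * r\<^sup>2 = (1 - q) + N * (K * q - (1 - q))" by (simp add: q_def)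
  also have "\<dots> = K * (1 + K) * q\<^sup>2" by (simp add: N_def power2_eq_square algebra_simps)
  finally have Nr: "(N * r)\<^sup>2 = K * (1 + K) * q\<^sup>2" by (simp add: power_mult_distrib)
  have "cmod p = N * cmod c" using N by (simp add: pc)
  then have "N * (1 - cmod c) = K * q + (1 - cmod p)" by (simp add: N_def algebra_simps)
  moreover have "(cmod p)\<^sup>2 \<le> cmod p" using p by (simp add: power2_eq_square mult_left_le)
  then have "1 - cmod p \<le> q" by (simp add: q_def)
  ultimately have le: "N * (1 - cmod c) \<le> (1 + K) * q" unfolding distrib_right by linarith
  have "0 \<le> 1 - cmod c"
  proof -
    have "1 * cmod c \<le> N * cmod c" using N by (intro mult_right_mono) auto
    then show ?thesis using p \<open>cmod p = N * cmod c\<close> by simp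
  qed
  define \<tau> where "\<tau> = sqrt (K\<^sub>0 / (1 + K\<^sub>0))"
  have "K\<^sub>0 / (1 + K\<^sub>0) \<le> K / (1 + K)" using K by (simp add: field_simps)
  moreover have "\<tau>\<^sup>2 = K\<^sub>0 / (1 + K\<^sub>0)" "0 \<le> \<tau>" using K(1) by (simp_all add: \<tau>_def)
  ultimately have \<tau>: "0 \<le> \<tau>" "\<tau>\<^sup>2 * (1 + K) \<le> K"
    using \<open>0 < K\<close> by (simp_all add: pos_le_divide_eq)
  have "(\<tau> * (N * (1 - cmod c)))\<^sup>2 \<le> (\<tau> * ((1 + K) * q))\<^sup>2"
    using le \<tau> N \<open>0 \<le> 1 - cmod c\<close> by (intro power_mono mult_left_mono) auto
  also have "\<dots> = \<tau>\<^sup>2 * (1 + K) * ((1 + K) * q\<^sup>2)" by (simp add: power2_eq_square)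
  also have "\<dots> \<le> K * ((1 + K) * q\<^sup>2)" using \<tau>(2) \<open>0 < K\<close> by (intro mult_right_mono) auto
  also have "\<dots> = (N * r)\<^sup>2" by (simp add: Nr)
  finally have "\<tau> * (N * (1 - cmod c)) \<le> N * r" by (rule power2_le_imp_le) (use N r in simp)
  then have "N * (\<tau> * (1 - cmod c)) \<le> N * r" by (simp add: mult.left_commute)
  then show ?thesis using N by (simp add: \<tau>_def)
qed

section \<open>Analytic criteria and elementary estimates\<close>

lemma lipschitz_imp_ac_on_interval:
  assumes L: "C-lipschitz_on {a..b} g"
  shows "ac_on_interval a b g"
  unfolding ac_on_interval_def
proof (intro allI impI)
  fix \<epsilon> :: real assume "\<epsilon> > 0"
  have C: "C \<ge> 0" using L by (rule lipschitz_on_nonneg)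
  show "\<exists>\<delta>>0. \<forall>I. finite I \<and> (\<forall>(s, t)\<in>I. a \<le> s \<and> s \<le> t \<and> t \<le> b) \<and>
        pairwise (\<lambda>(s, t) (s', t'). {s<..<t} \<inter> {s'<..<t'} = {}) I \<and>
        (\<Sum>(s, t)\<in>I. t - s) < \<delta> \<longrightarrow> (\<Sum>(s, t)\<in>I. cmod (g t - g s)) < \<epsilon>"
  \<comment> \<open>\<open>C + 1\<close> instead of \<open>C\<close> guards against a zero Lipschitz
    constant.\<close>
  proof (intro exI[of _ "\<epsilon> / (C + 1)"] conjI allI impI)
    show "0 < \<epsilon> / (C + 1)" using C \<open>\<epsilon> > 0\<close> by simp
    fix I :: "(real \<times> real) set"
    assume I: "finite I \<and> (\<forall>(s, t)\<in>I. a \<le> s \<and> s \<le> t \<and> t \<le> b) \<and>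
        pairwise (\<lambda>(s, t) (s', t'). {s<..<t} \<inter> {s'<..<t'} = {}) I \<and>
        (\<Sum>(s, t)\<in>I. t - s) < \<epsilon> / (C + 1)"
    have "(\<Sum>(s, t)\<in>I. cmod (g t - g s)) \<le> (\<Sum>(s, t)\<in>I. C * (t - s))"
    proof (rule sum_mono, clarify)
      fix s t assume "(s, t) \<in> I"
      then have "a \<le> s" "s \<le> t" "t \<le> b" using I by auto
      then show "cmod (g t - g s) \<le> C * (t - s)"
        using lipschitz_onD[OF L, of t s] by (simp add: dist_norm)
    qed
    also have "\<dots> = C * (\<Sum>(s, t)\<in>I. t - s)" by (simp add: sum_distrib_left case_prod_beta)
    also have "\<dots> \<le> C * (\<epsilon> / (C + 1))" using I C by (intro mult_left_mono) auto
    also have "\<dots> < \<epsilon>" using C \<open>\<epsilon> > 0\<close> by (simp add: field_simps)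
    finally show "(\<Sum>(s, t)\<in>I. cmod (g t - g s)) < \<epsilon>" .
  qed
qed

text \<open>The derivative along e is A e + B cnj e; the directions 1 and \<i> separate A from
  B.\<close>

lemma wirtinger_affine:
  assumes "open V" "z \<in> V" and g: "\<And>z'. z' \<in> V \<Longrightarrow> g z' = A * z' + B * cnj z' + C"
  shows "d_z g z = A" "d_zbar g z = B"
proof -
  have line: "vector_derivative (\<lambda>t. g (z + e * of_real t)) (at 0) = A * e + B * cnj e" for e
  proof (rule vector_derivative_at)
    have "open ((\<lambda>t. z + e * of_real t) -` V)"
      using \<open>open V\<close> by (intro open_vimage continuous_intros)
    have "((\<lambda>t. (A * z + B * cnj z + C) + t *\<^sub>R (A * e + B * cnj e))
        has_vector_derivative 0 + 1 *\<^sub>R (A * e + B * cnj e)) (at 0)"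
      by (intro has_vector_derivative_add has_vector_derivative_const
          has_vector_derivative_scaleR[where g = "\<lambda>_. c" and g' = 0 for c, simplified] DERIV_ident)
    moreover have "(A * z + B * cnj z + C) + t *\<^sub>R (A * e + B * cnj e)
        = A * (z + e * of_real t) + B * cnj (z + e * of_real t) + C" for t
      by (simp add: scaleR_conv_of_real algebra_simps)
    ultimately have "((\<lambda>t. A * (z + e * of_real t) + B * cnj (z + e * of_real t) + C)
        has_vector_derivative A * e + B * cnj e) (at 0)"
      by (simp only: scaleR_one add_0)
    then show "((\<lambda>t. g (z + e * of_real t)) has_vector_derivative A * e + B * cnj e) (at 0)"
    proof (rule has_vector_derivative_transform_within_open)
      show "open ((\<lambda>t. z + e * of_real t) -` V)" by fact
      show "0 \<in> (\<lambda>t. z + e * of_real t) -` V" using \<open>z \<in> V\<close> by simp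
      fix t assume "t \<in> (\<lambda>t. z + e * of_real t) -` V"
      then show "A * (z + e * of_real t) + B * cnj (z + e * of_real t) + C = g (z + e * of_real t)"
        using g[of "z + e * of_real t"] by simp
    qed
  qed
  have x: "partial_x g z = A + B" using line[of 1] by (simp add: partial_x_def)
  have y: "partial_y g z = \<i> * (A - B)"
    using line[of \<i>] by (simp add: partial_y_def algebra_simps)
  show "d_z g z = A" "d_zbar g z = B"
    unfolding d_z_def d_zbar_def x y by (simp_all add: algebra_simps flip: mult.assoc)
qed

lemma nn_integral_count_space_summable:
  fixes g :: "'a \<Rightarrow> real"
  assumes "\<And>x. x \<in> A \<Longrightarrow> 0 \<le> g x"
  shows "(\<integral>\<^sup>+x. ennreal (g x) \<partial>count_space A) < \<infinity> \<longleftrightarrow> g summable_on A"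
proof -
  have "(\<integral>\<^sup>+x. ennreal (g x) \<partial>count_space A) = (\<integral>\<^sup>+x. ennreal (norm (g x)) \<partial>count_space A)"
    using assms by (intro nn_integral_cong) auto
  then have "(\<integral>\<^sup>+x. ennreal (g x) \<partial>count_space A) < \<infinity> \<longleftrightarrow> integrable (count_space A) g"
    by (simp add: integrable_iff_bounded)
  also have "\<dots> \<longleftrightarrow> (\<lambda>x. norm (g x)) summable_on A"
    using abs_summable_equivalent[of g A] by (simp add: abs_summable_on_def)
  also have "\<dots> \<longleftrightarrow> g summable_on A"
    using assms by (intro summable_on_cong) auto
  finally show ?thesis .
qed

text \<open>The right side is 2 (cosh x - 1), which is even. For x \<ge> 0 it suffices to use the
  quadratic Taylor bound for exp x and the linear one for exp(-x).\<close>

lemma exp_sum_ge: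
  fixes x :: real
  shows "x\<^sup>2 / 2 \<le> exp x + exp (- x) - 2"
proof -
  have *: "x\<^sup>2 / 2 \<le> exp x + exp (- x) - 2" if "0 \<le> x" for x :: real
    using exp_lower_Taylor_quadratic[OF that] exp_ge_add_one_self[of "- x"] by simp
  show ?thesis using *[of x] *[of "- x"] by (cases "0 \<le> x") auto
qed

lemma exp_sum_le:
  fixes x :: real
  assumes "\<bar>x\<bar> \<le> 1"
  shows "exp x + exp (- x) - 2 \<le> 2 * x\<^sup>2"
proof -
  have *: "exp x + exp (- x) - 2 \<le> 2 * x\<^sup>2" if "0 \<le> x" "x \<le> 1" for x :: real
  proof -
    have "exp x \<le> 1 + x + x\<^sup>2" using exp_bound that by blast
    moreover have "exp (- x) \<le> 1 - x + x\<^sup>2"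
    proof -
      have "exp (- x) \<le> 1 / (1 + x)"
        unfolding exp_minus inverse_eq_divide using that exp_ge_add_one_self[of x]
        by (intro divide_left_mono) (auto intro: mult_pos_pos)
      \<comment> \<open>From 1 + x^3 = (1 + x) (1 - x + x^2): it turns 1 / (1 + x) into a quadratic
        upper bound.\<close>
      also have "1 = (1 - x + x\<^sup>2) * (1 + x) - x ^ 3" by (simp add: power2_eq_square power3_eq_cube algebra_simps)
      then have "1 \<le> (1 - x + x\<^sup>2) * (1 + x)" using that zero_le_power[of x 3] by linarith
      then have "1 / (1 + x) \<le> 1 - x + x\<^sup>2" using that by (simp add: pos_divide_le_eq)
      finally show ?thesis .
    qed
    ultimately show ?thesis by simp
  qed
  show ?thesis using *[of x] *[of "- x"] assms by (cases "0 \<le> x") auto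
qed

section \<open>The piecewise linear map\<close>

definition transfer ::
    "'d cell_map \<Rightarrow> ('d set \<Rightarrow> real) \<Rightarrow> ('d set \<Rightarrow> real) \<Rightarrow> ('d set \<Rightarrow> real) \<Rightarrow> 'd \<Rightarrow> complex \<Rightarrow> complex" where
  "transfer M \<Theta> R R' d w = bary M \<Theta> R' d (coord_r M \<Theta> R d w) (coord_l M \<Theta> R d w)"

text \<open>Generators are given by barycentric weights alone, and \<open>transfer\<close> keeps the
  weights, so it maps generators for \<open>R\<close> to generators for \<open>R'\<close>.\<close>

lemma glue_transfer:
  assumes "kite_surface M \<Theta> R" "kite_surface M \<Theta> R'" "((d, w), (e, w')) \<in> glue M \<Theta> R"
  shows "((d, transfer M \<Theta> R R' d w), (e, transfer M \<Theta> R R' e w')) \<in> glue M \<Theta> R'"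
proof -
  interpret A: kite_surface M \<Theta> R by fact
  interpret B: kite_surface M \<Theta> R' by fact
  define tr where "tr = (\<lambda>(d, w). (d, transfer M \<Theta> R R' d w))"
  let ?C = "{y. (tr (d, w), tr y) \<in> glue M \<Theta> R'}"
  have "(e, w') \<in> ?C"
    using assms(3)
  proof (rule A.glue_saturated)
    show "(d, w) \<in> ?C" by (simp add: glue_def)
    fix p q assume "A.gstep p q"
    then have "B.gstep (tr p) (tr q)"
      by cases (auto simp: tr_def transfer_def intro: B.gstep.intros)
    then have "(tr p, tr q) \<in> glue M \<Theta> R'" by (rule B.gstep_glue)
    then show "p \<in> ?C \<longleftrightarrow> q \<in> ?C"
      using equiv_glue[of M \<Theta> R'] unfolding equiv_def by (auto dest: symD transD)
  qed
  then show ?thesis by (simp add: tr_def)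
qed

lemma transfer_transfer:
  assumes "kite_surface M \<Theta> R" "kite_surface M \<Theta> R'"
  shows "transfer M \<Theta> R' R d (transfer M \<Theta> R R' d w) = w"
proof -
  interpret A: kite_surface M \<Theta> R by fact
  interpret B: kite_surface M \<Theta> R' by fact
  show ?thesis by (simp add: transfer_def)
qed

locale pattern_deformation = uniformized_surface M \<Theta> R dev
  for M :: "'d cell_map" and \<Theta> R dev +
  fixes u :: "'d set \<Rightarrow> real"
begin

abbreviation "R' \<equiv> rescale u R"

sublocale dst: kite_surface M \<Theta> "rescale u R"
  by unfold_locales (simp add: rescale_def R_pos)

abbreviation "push \<equiv> transfer M \<Theta> R R'"
abbreviation "pull \<equiv> transfer M \<Theta> R' R"
abbreviation "f \<equiv> pl_map M \<Theta> R dev u"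

lemmas kites = kite_surface_axioms dst.kite_surface_axioms

lemma pull_push [simp]: "pull d (push d w) = w" and push_pull [simp]: "push d (pull d w) = w"
  by (rule transfer_transfer; rule kites)+

lemma push_T: "w \<in> T d \<Longrightarrow> push d w \<in> dst.T d"
  by (simp add: transfer_def T_eq)

lemma pull_T: "w \<in> dst.T d \<Longrightarrow> pull d w \<in> T d"
  by (simp add: transfer_def dst.T_eq)

lemma push_T': "push d w \<in> dst.T' d \<longleftrightarrow> w \<in> T' d"
  by (simp add: transfer_def open_triangle_def)

lemma push_glue: "((d, w), (e, w')) \<in> glue M \<Theta> R \<longleftrightarrow> ((d, push d w), (e, push e w')) \<in> glue M \<Theta> R'"
  using glue_transfer[OF kites, of d w e w'] glue_transfer[OF kites(2,1), of d "push d w" e "push e w'"]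
  by auto

lemma dst_pt_push_eq_iff:
  assumes "w \<in> T d" "w' \<in> T e"
  shows "dst.pt d (push d w) = dst.pt e (push e w') \<longleftrightarrow> place d w = place e w'"
  unfolding dst.pt_eq_iff place_eq_iff[OF assms] by (rule push_glue[symmetric])

text \<open>The definite description is legitimate: two representations of a point of the disk are
  glued for the old radii, hence by \<open>push_glue\<close> their images are glued for the new
  ones.\<close>

lemma pl_map_place:
  assumes w: "w \<in> T d"
  shows "f (place d w) = dst.pt d (push d w)"
  unfolding pl_map_def
proof (rule the_equality)
  have "place d w = dev (pt d (B d (cr d w) (cl d w)))" using w by (simp add: dev_pt)
  then show "\<exists>e s t. 0 \<le> s \<and> 0 \<le> t \<and> s + t \<le> 1 \<and>
        place d w = dev (pt e (s *\<^sub>R rc e + t *\<^sub>R lc e)) \<and>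
        dst.pt d (push d w) = dst.pt e (s *\<^sub>R dst.rc e + t *\<^sub>R dst.lc e)"
    using w unfolding T_eq transfer_def bary_def by blast
next
  fix X
  assume "\<exists>e s t. 0 \<le> s \<and> 0 \<le> t \<and> s + t \<le> 1 \<and>
        place d w = dev (pt e (s *\<^sub>R rc e + t *\<^sub>R lc e)) \<and>
        X = dst.pt e (s *\<^sub>R dst.rc e + t *\<^sub>R dst.lc e)"
  then obtain e s t where st: "0 \<le> s" "0 \<le> t" "s + t \<le> 1"
    and eq: "place d w = dev (pt e (B e s t))" and X: "X = dst.pt e (dst.B e s t)"
    unfolding bary_def by blast
  have B: "B e s t \<in> T e" using st by simp
  then have "place d w = place e (B e s t)" using eq by (simp add: dev_pt)
  then have "dst.pt d (push d w) = dst.pt e (push e (B e s t))"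
    using dst_pt_push_eq_iff[OF w B] by simp
  then show "X = dst.pt d (push d w)" by (simp add: X transfer_def)
qed

lemma continuous_on_transfer:
  "continuous_on S (transfer M \<Theta> R\<^sub>1 R\<^sub>2 d)"
proof -
  have "continuous_on S (\<lambda>w. bary M \<Theta> R\<^sub>2 d (coord_r M \<Theta> R\<^sub>1 d w) (coord_l M \<Theta> R\<^sub>1 d w))"
    unfolding bary_def by (intro continuous_intros continuous_on_coord)
  then show ?thesis by (simp add: transfer_def [abs_def])
qed

lemma disk_cases:
  assumes "z \<in> \<D>"
  obtains d w where "w \<in> T d" "z = place d w"
  using assms that unfolding Union_tri[symmetric] tri_def by blast

lemma pl_map_image: "f ` \<D> = surface_carrier M \<Theta> R'"
proof
  show "f ` \<D> \<subseteq> surface_carrier M \<Theta> R'"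
  proof clarify
    fix z :: complex assume "z \<in> \<D>"
    then obtain d w where "w \<in> T d" "z = place d w" by (rule disk_cases)
    then show "f z \<in> surface_carrier M \<Theta> R'"
      by (simp add: pl_map_place dst.pt_in_carrier push_T)
  qed
  show "surface_carrier M \<Theta> R' \<subseteq> f ` \<D>"
  proof
    fix X assume "X \<in> surface_carrier M \<Theta> R'"
    then obtain d w where w: "w \<in> dst.T d" "X = dst.pt d w"
      unfolding dst.surface_carrier_eq by blast
    then have "X = f (place d (pull d w))" by (simp add: pl_map_place pull_T)
    moreover have "place d (pull d w) \<in> \<D>"
      using tri_subset[of d] pull_T[OF w(1)] unfolding tri_def by blast
    ultimately show "X \<in> f ` \<D>" by blast
  qed
qed

lemma pl_map_inj: "inj_on f \<D>"
proof (rule inj_onI)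
  fix z z' :: complex assume "z \<in> \<D>" "z' \<in> \<D>" and eq: "f z = f z'"
  obtain d w where w: "w \<in> T d" "z = place d w" using disk_cases[OF \<open>z \<in> \<D>\<close>] .
  obtain e w' where w': "w' \<in> T e" "z' = place e w'" using disk_cases[OF \<open>z' \<in> \<D>\<close>] .
  show "z = z'" using eq w w' by (simp add: pl_map_place dst_pt_push_eq_iff)
qed

lemma place_in_disk: "w \<in> T d \<Longrightarrow> place d w \<in> \<D>"
  using tri_subset unfolding tri_def by blast

text \<open>Both topologies are tested one triangle at a time, where the map is \<open>push\<close>
  with continuous inverse \<open>pull\<close>; injectivity is the equivalence of the two gluing
  relations.\<close>

lemma homeomorphic_pl_map: "homeomorphic_map (top_of_set \<D>) (surface M \<Theta> R') f"
proof (rule bijective_open_imp_homeomorphic_map)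
  show "continuous_map (top_of_set \<D>) (surface M \<Theta> R') f"
    unfolding continuous_map_def
  proof (intro conjI allI impI)
    show "f \<in> topspace (top_of_set \<D>) \<rightarrow> topspace (surface M \<Theta> R')"
      using pl_map_image by (auto simp: dst.topspace_surface)
    fix U assume U: "openin (surface M \<Theta> R') U"
    let ?V = "{z \<in> topspace (top_of_set \<D>). f z \<in> U}"
    have "openin (top_of_set (T d)) {w \<in> T d. place d w \<in> ?V}" for d
    proof -
      have "{w \<in> T d. place d w \<in> ?V} = T d \<inter> push d -` {w \<in> dst.T d. dst.pt d w \<in> U}"
        using place_in_disk push_T by (auto simp: pl_map_place)
      moreover have "openin (top_of_set (T d)) (T d \<inter> push d -` {w \<in> dst.T d. dst.pt d w \<in> U})"
      proof (rule continuous_openin_preimage[OF continuous_on_transfer])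
        show "push d \<in> T d \<rightarrow> dst.T d" using push_T by blast
        show "openin (top_of_set (dst.T d)) {w \<in> dst.T d. dst.pt d w \<in> U}"
          using U unfolding dst.openin_surface_iff by blast
      qed
      ultimately show ?thesis by simp
    qed
    then have "open ?V" by (subst open_disk_iff) auto
    moreover have "?V \<subseteq> \<D>" by auto
    ultimately show "openin (top_of_set \<D>) ?V" by (simp only: openin_open_eq[OF open_ball])
  qed
  show "open_map (top_of_set \<D>) (surface M \<Theta> R') f"
    unfolding open_map_def
  proof (intro allI impI)
    fix V assume "openin (top_of_set \<D>) V"
    then have V: "open V" "V \<subseteq> \<D>" by (auto simp: openin_open_eq)
    show "openin (surface M \<Theta> R') (f ` V)"
      unfolding dst.openin_surface_iff
    proof (intro conjI allI)
      show "f ` V \<subseteq> surface_carrier M \<Theta> R'" using V pl_map_image by blast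
      fix d
      have iff: "dst.pt d w \<in> f ` V \<longleftrightarrow> place d (pull d w) \<in> V" if "w \<in> dst.T d" for w
      proof -
        have "dst.pt d w = f (place d (pull d w))" by (simp add: pl_map_place pull_T that)
        then show ?thesis
          using inj_on_image_mem_iff[OF pl_map_inj place_in_disk[OF pull_T[OF that]] V(2)] by simp
      qed
      have "{w \<in> dst.T d. dst.pt d w \<in> f ` V} = dst.T d \<inter> pull d -` {w \<in> T d. place d w \<in> V}"
        using pull_T iff by auto
      moreover have "openin (top_of_set (dst.T d)) (dst.T d \<inter> pull d -` {w \<in> T d. place d w \<in> V})"
      proof (rule continuous_openin_preimage[OF continuous_on_transfer])
        show "pull d \<in> dst.T d \<rightarrow> T d" using pull_T by blast
        show "openin (top_of_set (T d)) {w \<in> T d. place d w \<in> V}"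
          using V open_disk_iff by blast
      qed
      ultimately show "openin (top_of_set (dst.T d)) {w \<in> dst.T d. dst.pt d w \<in> f ` V}" by simp
    qed
  qed
qed (use pl_map_image pl_map_inj in \<open>auto simp: dst.topspace_surface\<close>)

text \<open>A real-linear map \<alpha> w + \<beta> cnj w is fixed by its effect on the two corners,
  which are scaled by a and b. This is the \<beta> solving \<alpha> + \<beta> = a and \<alpha> e^(i
  \<theta>) + \<beta> e^(-i \<theta>) = b e^(i \<theta>).\<close>

definition coef_zbar :: "'d \<Rightarrow> complex" where
  "coef_zbar d = of_real (exp (u (right_face M d)) - exp (u (left_face M d))) * cis (\<Theta> (edge M d)) /
     (2 * \<i> * of_real (sin (\<Theta> (edge M d))))"

definition coef_z :: "'d \<Rightarrow> complex" where
  "coef_z d = of_real (exp (u (right_face M d))) - coef_zbar d"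

lemma push_eq: "push d w = coef_z d * w + coef_zbar d * cnj w"
proof -
  define \<theta> a b where "\<theta> = \<Theta> (edge M d)" and "a = exp (u (right_face M d))" and "b = exp (u (left_face M d))"
  define r l where "r = R (right_face M d)" and "l = R (left_face M d)"
  have s: "sin \<theta> \<noteq> 0" using sin_Theta_pos[of d] by (simp add: \<theta>_def)
  have zb: "coef_zbar d * (cis \<theta> - cnj (cis \<theta>)) = of_real (a - b) * cis \<theta>"
  proof -
    have "cis \<theta> - cnj (cis \<theta>) = 2 * \<i> * of_real (sin \<theta>)" by (simp add: complex_eq_iff)
    then show ?thesis using s by (simp add: coef_zbar_def flip: \<theta>_def a_def b_def)
  qed
  have 1: "coef_z d + coef_zbar d = of_real a" by (simp add: coef_z_def a_def)
  have 2: "coef_z d * cis \<theta> + coef_zbar d * cnj (cis \<theta>) = of_real b * cis \<theta>"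
  proof -
    have "coef_z d * cis \<theta> + coef_zbar d * cnj (cis \<theta>)
        = of_real a * cis \<theta> - coef_zbar d * (cis \<theta> - cnj (cis \<theta>))"
      by (simp add: coef_z_def a_def algebra_simps)
    then show ?thesis unfolding zb by (simp add: algebra_simps)
  qed
  obtain s t where w: "w = B d s t" by (rule bary_cases)
  have w': "w = of_real (s * r) + of_real (t * l) * cis \<theta>"
    by (simp add: w bary_def right_corner_def left_corner_def scaleR_conv_of_real r_def l_def \<theta>_def)
  have "coef_z d * w + coef_zbar d * cnj w
      = of_real (s * r) * (coef_z d + coef_zbar d)
        + of_real (t * l) * (coef_z d * cis \<theta> + coef_zbar d * cnj (cis \<theta>))"
    unfolding w' by (simp add: algebra_simps)
  also have "\<dots> = of_real (s * r) * of_real a + of_real (t * l) * (of_real b * cis \<theta>)"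
    unfolding 1 2 ..
  also have "\<dots> = dst.B d s t"
    by (simp add: bary_def right_corner_def left_corner_def scaleR_conv_of_real r_def l_def \<theta>_def
        a_def b_def rescale_def)
  also have "\<dots> = push d w" by (simp add: w transfer_def)
  finally show ?thesis by simp
qed

definition jump :: "'d \<Rightarrow> real" where
  "jump d = u (left_face M d) - u (right_face M d)"

text \<open>\<open>\<bar>\<mu>\<bar>\<^sup>2 / (1 - \<bar>\<mu>\<bar>\<^sup>2)\<close> on the triangle of \<open>d\<close>.\<close>

definition distortion :: "'d \<Rightarrow> real" where
  "distortion d = (exp (jump d) + exp (- jump d) - 2) / (4 * (sin (\<Theta> (edge M d)))\<^sup>2)"

lemma distortion_nonneg: "0 \<le> distortion d"
proof -
  have "0 \<le> (jump d)\<^sup>2 / 2" by simp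
  also have "\<dots> \<le> exp (jump d) + exp (- jump d) - 2" by (rule exp_sum_ge)
  finally show ?thesis by (simp add: distortion_def)
qed

text \<open>The Jacobian, the difference of the two squared norms, is the ratio of areas. The map
  keeps the angle at the apex and scales its sides by a and b, so the Jacobian is a b; both norms
  are expressed in this unit.\<close>

lemma coef_norms:
  "(cmod (coef_zbar d))\<^sup>2 = distortion d * exp (u (right_face M d) + u (left_face M d))"
  "(cmod (coef_z d))\<^sup>2 = (1 + distortion d) * exp (u (right_face M d) + u (left_face M d))"
proof -
  define \<theta> a b where "\<theta> = \<Theta> (edge M d)" and "a = exp (u (right_face M d))" and "b = exp (u (left_face M d))"
  have s: "sin \<theta> \<noteq> 0" using sin_Theta_pos[of d] by (simp add: \<theta>_def)
  have pos: "0 < a" "0 < b" by (simp_all add: a_def b_def)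
  have ab: "exp (u (right_face M d) + u (left_face M d)) = a * b" by (simp add: a_def b_def exp_add)
  have j: "exp (jump d) = b / a" "exp (- jump d) = a / b"
    by (simp_all add: jump_def a_def b_def exp_diff)
  have dist: "distortion d * (a * b) = (a - b)\<^sup>2 / (4 * (sin \<theta>)\<^sup>2)"
  proof -
    have "(b / a + a / b - 2) * (a * b) = (a - b)\<^sup>2"
      using pos by (simp add: field_simps power2_eq_square)
    then show ?thesis by (simp add: distortion_def j flip: \<theta>_def)
  qed
  have "cmod (coef_zbar d) = \<bar>a - b\<bar> / (2 * \<bar>sin \<theta>\<bar>)"
    by (simp add: coef_zbar_def norm_mult norm_divide flip: \<theta>_def a_def b_def of_real_diff)
  then have zb: "(cmod (coef_zbar d))\<^sup>2 = (a - b)\<^sup>2 / (4 * (sin \<theta>)\<^sup>2)"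
    by (simp add: power_divide power_mult_distrib)
  then show "(cmod (coef_zbar d))\<^sup>2 = distortion d * exp (u (right_face M d) + u (left_face M d))"
    by (simp add: dist ab)
  have Re: "Re (coef_zbar d) = (a - b) / 2"
    and Im: "Im (coef_zbar d) = - (a - b) * cos \<theta> / (2 * sin \<theta>)"
    using s by (simp_all add: coef_zbar_def Re_divide Im_divide power2_eq_square field_simps
        flip: \<theta>_def a_def b_def)
  have "(cmod (coef_z d))\<^sup>2 = (a - Re (coef_zbar d))\<^sup>2 + (Im (coef_zbar d))\<^sup>2"
    unfolding cmod_power2 by (simp add: coef_z_def flip: a_def)
  also have "\<dots> = (Re (coef_zbar d))\<^sup>2 + (Im (coef_zbar d))\<^sup>2 + a * (a - 2 * Re (coef_zbar d))"
    by (simp add: power2_eq_square algebra_simps)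
  also have "\<dots> = (cmod (coef_zbar d))\<^sup>2 + a * b"
    unfolding cmod_power2 by (simp add: Re diff_divide_distrib)
  also have "\<dots> = (1 + distortion d) * (a * b)" by (simp add: zb dist distrib_right)
  finally show "(cmod (coef_z d))\<^sup>2 = (1 + distortion d) * exp (u (right_face M d) + u (left_face M d))"
    by (simp add: ab)
qed

lemma coef_ratio: "(cmod (coef_zbar d / coef_z d))\<^sup>2 = distortion d / (1 + distortion d)"
  by (simp add: norm_divide power_divide coef_norms)

lemma coef_le_iff:
  assumes "0 \<le> k"
  shows "cmod (coef_zbar d) \<le> k * cmod (coef_z d) \<longleftrightarrow> distortion d \<le> k\<^sup>2 * (1 + distortion d)"
proof -
  have "cmod (coef_zbar d) \<le> k * cmod (coef_z d) \<longleftrightarrow> (cmod (coef_zbar d))\<^sup>2 \<le> (k * cmod (coef_z d))\<^sup>2"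
    using assms by (intro power_mono_iff[symmetric]) auto
  then show ?thesis by (simp add: power_mult_distrib coef_norms flip: mult.assoc)
qed

lemma chart_pl_map:
  assumes "isometric_chart M \<Theta> R' U \<zeta>"
  obtains a b where "cmod a = 1"
    "\<And>z. z \<in> tri d \<Longrightarrow> f z \<in> U \<Longrightarrow> \<zeta> (f z) = a * push d (unplace d z) + b"
proof -
  obtain a b where ab: "cmod a = 1"
    "\<And>w. w \<in> dst.T d \<Longrightarrow> dst.pt d w \<in> U \<Longrightarrow> \<zeta> (dst.pt d w) = a * w + b"
    using assms unfolding isometric_chart_def by metis
  have "\<zeta> (f z) = a * push d (unplace d z) + b" if "z \<in> tri d" "f z \<in> U" for z
  proof -
    have w: "unplace d z \<in> T d" using that by (simp add: tri_iff)
    then have "f z = dst.pt d (push d (unplace d z))"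
      using pl_map_place[OF w] by simp
    then show ?thesis using ab(2)[OF push_T[OF w]] that by simp
  qed
  then show thesis using ab(1) that by blast
qed

lemma open_chart_domain:
  assumes "isometric_chart M \<Theta> R' U \<zeta>"
  shows "open {z \<in> \<D>. f z \<in> U}"
proof -
  have "openin (surface M \<Theta> R') U" using assms by (simp add: isometric_chart_def)
  then have "openin (top_of_set \<D>) {z \<in> topspace (top_of_set \<D>). f z \<in> U}"
    using homeomorphic_imp_continuous_map[OF homeomorphic_pl_map] openin_continuous_map_preimage by blast
  then show ?thesis unfolding openin_open_eq[OF open_ball] by simp
qed

text \<open>On an open triangle the map in the chart is \<open>push\<close> between two rigid
  motions, which contribute only unimodular factors to the derivatives.\<close>

lemma wirtinger_pl_map:
  assumes chart: "isometric_chart M \<Theta> R' U \<zeta>" and z: "z \<in> otri d" "f z \<in> U"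
  shows "cmod (d_zbar (\<zeta> \<circ> f) z / d_z (\<zeta> \<circ> f) z) = cmod (coef_zbar d / coef_z d)"
    and "cmod (d_zbar (\<zeta> \<circ> f) z) = cmod (coef_zbar d)"
    and "cmod (d_z (\<zeta> \<circ> f) z) = cmod (coef_z d)"
proof -
  obtain a b where a: "cmod a = 1"
    and ab: "\<And>z. z \<in> tri d \<Longrightarrow> f z \<in> U \<Longrightarrow> \<zeta> (f z) = a * push d (unplace d z) + b"
    using chart_pl_map[OF chart, where d = d] by metis
  let ?V = "{z \<in> \<D>. f z \<in> U} \<inter> otri d"
  let ?A = "a * coef_z d / rot d" and ?B = "a * coef_zbar d / cnj (rot d)"
  have V: "open ?V" using open_chart_domain[OF chart] open_otri by blast
  have zV: "z \<in> ?V" using z otri_subset tri_subset by blast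
  have g: "(\<zeta> \<circ> f) z' = ?A * z' + ?B * cnj z' + (b - ?A * apex d - ?B * cnj (apex d))" if "z' \<in> ?V" for z'
  proof -
    have "z' \<in> tri d" "f z' \<in> U" using that otri_subset by auto
    then have "(\<zeta> \<circ> f) z' = a * push d (unplace d z') + b" by (simp add: ab)
    also have "\<dots> = a * coef_z d * ((z' - apex d) / rot d)
        + a * coef_zbar d * (cnj (z' - apex d) / cnj (rot d)) + b"
      by (simp add: push_eq unplace_def algebra_simps)
    also have "\<dots> = ?A * z' + ?B * cnj z' + (b - ?A * apex d - ?B * cnj (apex d))"
      by (simp add: diff_divide_distrib right_diff_distrib)
    finally show ?thesis .
  qed
  have d: "d_z (\<zeta> \<circ> f) z = ?A" "d_zbar (\<zeta> \<circ> f) z = ?B"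
    by (rule wirtinger_affine[OF V zV g]; assumption)+
  show 1: "cmod (d_zbar (\<zeta> \<circ> f) z) = cmod (coef_zbar d)"
    and 2: "cmod (d_z (\<zeta> \<circ> f) z) = cmod (coef_z d)"
    unfolding d by (simp_all add: norm_mult norm_divide a)
  show "cmod (d_zbar (\<zeta> \<circ> f) z / d_z (\<zeta> \<circ> f) z) = cmod (coef_zbar d / coef_z d)"
    unfolding norm_divide 1 2 ..
qed

text \<open>The model coordinates of a triangle form a chart on its open part. This gives the choice
  in \<open>beltrami\<close> a witness and gives \<open>quasiconformal\<close> a chart on which each
  triangle can be tested.\<close>

lemma triangle_chart:
  "\<exists>\<zeta>. isometric_chart M \<Theta> R' (f ` otri d) \<zeta>"
proof -
  let ?U = "f ` otri d"
  have sub: "otri d \<subseteq> \<D>" using otri_subset tri_subset by blast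
  obtain g where g: "homeomorphic_maps (top_of_set \<D>) (surface M \<Theta> R') f g"
    using homeomorphic_pl_map homeomorphic_map_maps by blast
  have gf: "g (f z) = z" if "z \<in> \<D>" for z
    using g that by (auto simp: homeomorphic_maps_def)
  define \<zeta> where "\<zeta> = push d \<circ> unplace d \<circ> g"
  have openU: "openin (surface M \<Theta> R') ?U"
    using homeomorphic_imp_open_map[OF homeomorphic_pl_map] sub open_otri
    unfolding open_map_def by (auto simp: openin_open_eq)
  have "homeomorphic_maps (subtopology (surface M \<Theta> R') ?U) (top_of_set (dst.T' d)) \<zeta>
      (f \<circ> place d \<circ> pull d)"
    unfolding homeomorphic_maps_def
  proof (intro conjI ballI)
    have "continuous_map (surface M \<Theta> R') euclidean g"
      using g by (auto simp: homeomorphic_maps_def continuous_map_in_subtopology)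
    then have "continuous_map (subtopology (surface M \<Theta> R') ?U) euclidean g"
      by (rule continuous_map_from_subtopology)
    moreover have "continuous_map euclidean euclidean (push d \<circ> unplace d)"
      unfolding continuous_map_iff_continuous2
      by (intro continuous_on_compose continuous_on_transfer continuous_on_unplace)
    ultimately have "continuous_map (subtopology (surface M \<Theta> R') ?U) euclidean \<zeta>"
      unfolding \<zeta>_def by (rule continuous_map_compose)
    moreover have "\<zeta> ` ?U \<subseteq> dst.T' d"
      using sub gf by (auto simp: \<zeta>_def push_T' otri_iff subset_iff)
    ultimately show "continuous_map (subtopology (surface M \<Theta> R') ?U) (top_of_set (dst.T' d)) \<zeta>"
      by (auto simp: continuous_map_in_subtopology)
    have p: "place d (pull d w) \<in> otri d" if "w \<in> dst.T' d" for w
      using that by (simp add: otri_iff flip: push_T')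
    have "continuous_map (top_of_set (dst.T' d)) (top_of_set \<D>) (place d \<circ> pull d)"
      unfolding continuous_map_in_subtopology continuous_map_iff_continuous
      using p sub by (intro conjI continuous_on_compose continuous_on_transfer continuous_on_place) auto
    then have "continuous_map (top_of_set (dst.T' d)) (surface M \<Theta> R') (f \<circ> (place d \<circ> pull d))"
      using homeomorphic_imp_continuous_map[OF homeomorphic_pl_map] by (rule continuous_map_compose)
    then show "continuous_map (top_of_set (dst.T' d)) (subtopology (surface M \<Theta> R') ?U) (f \<circ> place d \<circ> pull d)"
      using p by (auto simp: continuous_map_in_subtopology comp_assoc)
    show "(f \<circ> place d \<circ> pull d) (\<zeta> X) = X" if "X \<in> topspace (subtopology (surface M \<Theta> R') ?U)" for X
      using that sub gf by (auto simp: \<zeta>_def subset_iff)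
    show "\<zeta> ((f \<circ> place d \<circ> pull d) w) = w" if "w \<in> topspace (top_of_set (dst.T' d))" for w
      using that p[of w] sub gf by (auto simp: \<zeta>_def subset_iff)
  qed
  then have "homeomorphic_map (subtopology (surface M \<Theta> R') ?U) (top_of_set (dst.T' d)) \<zeta>"
    using homeomorphic_map_maps by blast
  moreover have "open (dst.T' d)" by (rule open_open_triangle)
  \<comment> \<open>An open triangle meets no other triangle, so \<open>e = d\<close> here and the
    required rigid motion is the identity; for other darts the condition is vacuous.\<close>
  moreover have "\<zeta> (dst.pt e w) = w" if w: "w \<in> dst.T e" "dst.pt e w \<in> ?U" for e w
  proof -
    have eq: "dst.pt e w = f (place e (pull e w))" by (simp add: pl_map_place pull_T w)
    have D: "place e (pull e w) \<in> \<D>" by (rule place_in_disk) (rule pull_T[OF w(1)])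
    have "place e (pull e w) \<in> otri d"
      using w(2) inj_on_image_mem_iff[OF pl_map_inj D sub] unfolding eq by simp
    moreover have "place e (pull e w) \<in> tri e" by (simp add: tri_def pull_T w(1))
    ultimately have "e = d" by (rule otri_disjoint)
    then show ?thesis unfolding \<zeta>_def o_def eq gf[OF D] by simp
  qed
  then have "\<forall>e. \<exists>a b. cmod a = 1 \<and> (\<forall>w\<in>dst.T e. dst.pt e w \<in> ?U \<longrightarrow> \<zeta> (dst.pt e w) = a * w + b)"
    by (intro allI exI[of _ 1] exI[of _ 0]) auto
  ultimately show ?thesis using openU unfolding isometric_chart_def by blast
qed

text \<open>Whichever chart \<open>SOME\<close> selects, \<open>wirtinger_pl_map\<close> gives the
  same modulus.\<close>

lemma beltrami_pl_map:
  assumes z: "z \<in> otri d"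
  shows "(cmod (beltrami M \<Theta> R' f z))\<^sup>2 = distortion d / (1 + distortion d)"
proof -
  define \<zeta> where "\<zeta> = (SOME \<zeta>. \<exists>U. isometric_chart M \<Theta> R' U \<zeta> \<and> f z \<in> U)"
  have "\<exists>\<zeta> U. isometric_chart M \<Theta> R' U \<zeta> \<and> f z \<in> U"
    using triangle_chart[of d] z by blast
  then have "\<exists>U. isometric_chart M \<Theta> R' U \<zeta> \<and> f z \<in> U"
    unfolding \<zeta>_def by (rule someI_ex)
  then obtain U where "isometric_chart M \<Theta> R' U \<zeta>" "f z \<in> U" by blast
  then have "cmod (d_zbar (\<zeta> \<circ> f) z / d_z (\<zeta> \<circ> f) z) = cmod (coef_zbar d / coef_z d)"
    using z by (intro wirtinger_pl_map)
  then have "cmod (beltrami M \<Theta> R' f z) = cmod (coef_zbar d / coef_z d)"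
    by (simp add: beltrami_def Let_def \<zeta>_def)
  then show ?thesis by (simp only: coef_ratio)
qed

text \<open>A segment in a compact part of the chart domain meets finitely many triangles, on each
  of which the map is affine in the chart. Lipschitz bounds on finitely many closed pieces covering
  an interval combine to one on the interval.\<close>

lemma acl_pl_map:
  assumes chart: "isometric_chart M \<Theta> R' U \<zeta>"
  shows "acl_on {z \<in> \<D>. f z \<in> U} (\<zeta> \<circ> f)"
proof -
  have ac: "ac_on_interval a b (\<lambda>x. (\<zeta> \<circ> f) (p + of_real x * e))"
    if K: "compact K" "K \<subseteq> {z \<in> \<D>. f z \<in> U}" and e: "cmod e = 1"
      and seg: "\<And>x. x \<in> {a..b} \<Longrightarrow> p + of_real x * e \<in> K" for K a b p e
  proof -
    define S where "S = {d. tri d \<inter> K \<noteq> {}}"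
    have fin: "finite S" unfolding S_def using K by (intro finite_tri_compact) auto
    \<comment> \<open>The sum dominates each of the finitely many Lipschitz constants.\<close>
    define C where "C = (\<Sum>d\<in>S. cmod (coef_z d) + cmod (coef_zbar d))"
    define X where "X d = {a..b} \<inter> (\<lambda>x. p + of_real x * e) -` tri d" for d
    have "C-lipschitz_on {a..b} (\<lambda>x. (\<zeta> \<circ> f) (p + of_real x * e))"
    proof (rule lipschitz_on_closed_Union[where U = X and I = S])
      show "finite S" by fact
      show "0 \<le> C" unfolding C_def by (intro sum_nonneg) auto
      show "{a..b} \<subseteq> (\<Union>d\<in>S. X d)"
      proof
        fix x assume x: "x \<in> {a..b}"
        then have xK: "p + of_real x * e \<in> K" by (rule seg)
        then have "p + of_real x * e \<in> \<D>" using K by blast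
        then obtain d where "p + of_real x * e \<in> tri d" unfolding Union_tri[symmetric] by blast
        then show "x \<in> (\<Union>d\<in>S. X d)" using x xK by (auto simp: S_def X_def)
      qed
      fix d assume d: "d \<in> S"
      show "closed (X d)"
        unfolding X_def using closed_tri by (intro closed_Int closed_vimage continuous_intros) auto
      obtain \<alpha> \<beta> where \<alpha>: "cmod \<alpha> = 1"
        and \<alpha>\<beta>: "\<And>z. z \<in> tri d \<Longrightarrow> f z \<in> U \<Longrightarrow> \<zeta> (f z) = \<alpha> * push d (unplace d z) + \<beta>"
        using chart_pl_map[OF chart, where d = d] by metis
      show "C-lipschitz_on (X d) (\<lambda>x. (\<zeta> \<circ> f) (p + of_real x * e))"
      proof (rule lipschitz_onI)
        show "0 \<le> C" by fact
        fix x y assume xy: "x \<in> X d" "y \<in> X d"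
        let ?x = "p + of_real x * e" and ?y = "p + of_real y * e"
        have "?x \<in> tri d" "?y \<in> tri d" "f ?x \<in> U" "f ?y \<in> U"
          using xy seg K by (auto simp: X_def)
        then have "\<zeta> (f ?x) - \<zeta> (f ?y) = \<alpha> * (push d (unplace d ?x) - push d (unplace d ?y))"
          by (simp add: \<alpha>\<beta> algebra_simps)
        also have "push d (unplace d ?x) - push d (unplace d ?y)
            = coef_z d * (unplace d ?x - unplace d ?y) + coef_zbar d * cnj (unplace d ?x - unplace d ?y)"
          by (simp add: push_eq algebra_simps)
        finally have "cmod (\<zeta> (f ?x) - \<zeta> (f ?y))
            \<le> cmod (coef_z d) * cmod (unplace d ?x - unplace d ?y)
              + cmod (coef_zbar d) * cmod (unplace d ?x - unplace d ?y)"
          using norm_triangle_ineq[of "coef_z d * (unplace d ?x - unplace d ?y)"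
              "coef_zbar d * cnj (unplace d ?x - unplace d ?y)"]
          by (simp only: norm_mult \<alpha> complex_mod_cnj mult_1_left)
        also have "cmod (unplace d ?x - unplace d ?y) = \<bar>x - y\<bar>"
        proof -
          have "unplace d ?x - unplace d ?y = of_real (x - y) * e / rot d"
            by (simp add: unplace_def algebra_simps flip: diff_divide_distrib)
          then show ?thesis by (simp add: norm_divide norm_mult e del: of_real_diff)
        qed
        also have "cmod (coef_z d) * \<bar>x - y\<bar> + cmod (coef_zbar d) * \<bar>x - y\<bar>
            = (cmod (coef_z d) + cmod (coef_zbar d)) * \<bar>x - y\<bar>" by (simp add: distrib_right)
        also have "\<dots> \<le> C * \<bar>x - y\<bar>"
          unfolding C_def using d fin by (intro mult_right_mono member_le_sum) auto
        finally show "dist ((\<zeta> \<circ> f) ?x) ((\<zeta> \<circ> f) ?y) \<le> C * dist x y"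
          by (simp add: dist_norm)
      qed
    qed
    then show ?thesis by (rule lipschitz_imp_ac_on_interval)
  qed
  show ?thesis
    unfolding acl_on_def
  proof (intro allI impI conjI AE_I2)
    fix a b a' b' y :: real
    assume sub: "cbox (Complex a a') (Complex b b') \<subseteq> {z \<in> \<D>. f z \<in> U}" and "y \<in> {a'..b'}"
    then have "Complex 0 y + of_real x * 1 \<in> cbox (Complex a a') (Complex b b')" if "x \<in> {a..b}" for x
      using that by (auto simp: in_cbox_complex_iff)
    then have "ac_on_interval a b (\<lambda>x. (\<zeta> \<circ> f) (Complex 0 y + of_real x * 1))"
      using sub by (intro ac[OF compact_cbox]) auto
    moreover have "Complex 0 y + of_real x * 1 = Complex x y" for x by (simp add: complex_eq_iff)
    ultimately show "ac_on_interval a b (\<lambda>x. (\<zeta> \<circ> f) (Complex x y))" by simp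
  next
    fix a b a' b' x :: real
    assume sub: "cbox (Complex a a') (Complex b b') \<subseteq> {z \<in> \<D>. f z \<in> U}" and "x \<in> {a..b}"
    then have "Complex x 0 + of_real y * \<i> \<in> cbox (Complex a a') (Complex b b')" if "y \<in> {a'..b'}" for y
      using that by (auto simp: in_cbox_complex_iff)
    then have "ac_on_interval a' b' (\<lambda>y. (\<zeta> \<circ> f) (Complex x 0 + of_real y * \<i>))"
      using sub by (intro ac[OF compact_cbox]) auto
    moreover have "Complex x 0 + of_real y * \<i> = Complex x y" for y by (simp add: complex_eq_iff)
    ultimately show "ac_on_interval a' b' (\<lambda>y. (\<zeta> \<circ> f) (Complex x y))" by simp
  qed
qed

text \<open>The dilatation is constant on each open triangle, a nonempty open set, so an inequality
  valid almost everywhere holds on every one of them. Conversely, the open triangles exhaust the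
  disk up to a null set.\<close>

lemma quasiconformal_iff_distortion:
  "quasiconformal M \<Theta> R' f \<longleftrightarrow> (\<exists>k. 0 \<le> k \<and> k < 1 \<and> (\<forall>d. distortion d \<le> k\<^sup>2 * (1 + distortion d)))"
proof
  assume "quasiconformal M \<Theta> R' f"
  then obtain k where k: "0 \<le> k" "k < 1"
    and dil: "\<And>U \<zeta>. isometric_chart M \<Theta> R' U \<zeta> \<Longrightarrow> AE z in lborel. z \<in> \<D> \<and> f z \<in> U \<longrightarrow>
              cmod (d_zbar (\<zeta> \<circ> f) z) \<le> k * cmod (d_z (\<zeta> \<circ> f) z)"
    unfolding quasiconformal_def by blast
  have "distortion d \<le> k\<^sup>2 * (1 + distortion d)" for d
  proof (rule ccontr)
    assume neg: "\<not> distortion d \<le> k\<^sup>2 * (1 + distortion d)"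
    obtain \<zeta> where chart: "isometric_chart M \<Theta> R' (f ` otri d) \<zeta>"
      using triangle_chart by blast
    have "AE z in lebesgue. z \<in> otri d \<longrightarrow> z \<in> {}"
      using AE_completion[OF dil[OF chart]]
    proof eventually_elim
      case (elim z)
      show ?case
      proof
        assume z: "z \<in> otri d"
        then have "z \<in> \<D>" using otri_subset tri_subset by blast
        then have "cmod (coef_zbar d) \<le> k * cmod (coef_z d)"
          using elim z wirtinger_pl_map(2,3)[OF chart z] by auto
        then show "z \<in> {}" using neg coef_le_iff k by blast
      qed
    qed
    moreover have "place d (B d (1/3) (1/3)) \<in> otri d" by simp
    ultimately have "place d (B d (1/3) (1/3)) \<in> ({} :: complex set)"
      by (intro mem_closed_if_AE_lebesgue_open[OF open_otri closed_empty])
    then show False by blast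
  qed
  then show "\<exists>k. 0 \<le> k \<and> k < 1 \<and> (\<forall>d. distortion d \<le> k\<^sup>2 * (1 + distortion d))" using k by blast
next
  assume "\<exists>k. 0 \<le> k \<and> k < 1 \<and> (\<forall>d. distortion d \<le> k\<^sup>2 * (1 + distortion d))"
  then obtain k where k: "0 \<le> k" "k < 1" "\<And>d. distortion d \<le> k\<^sup>2 * (1 + distortion d)" by blast
  have "AE z in lborel. z \<in> \<D> \<and> f z \<in> U \<longrightarrow> cmod (d_zbar (\<zeta> \<circ> f) z) \<le> k * cmod (d_z (\<zeta> \<circ> f) z)"
    if chart: "isometric_chart M \<Theta> R' U \<zeta>" for U \<zeta>
    using AE_otri
  proof eventually_elim
    case (elim z)
    show ?case
    proof
      assume z: "z \<in> \<D> \<and> f z \<in> U"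
      then obtain d where d: "z \<in> otri d" using elim by blast
      have "cmod (coef_zbar d) \<le> k * cmod (coef_z d)" using k coef_le_iff by blast
      then show "cmod (d_zbar (\<zeta> \<circ> f) z) \<le> k * cmod (d_z (\<zeta> \<circ> f) z)"
        using wirtinger_pl_map(2,3)[OF chart d] z by simp
    qed
  qed
  then show "quasiconformal M \<Theta> R' f"
    unfolding quasiconformal_def using k homeomorphic_pl_map acl_pl_map by blast
qed

section \<open>Comparing the distortion with the jumps of u\<close>

lemma jump_sq_le: "(jump d)\<^sup>2 \<le> 8 * distortion d"
proof -
  have s: "0 < (sin (\<Theta> (edge M d)))\<^sup>2" "(sin (\<Theta> (edge M d)))\<^sup>2 \<le> 1"
    using sin_Theta_pos[of d] abs_sin_le_one by (auto simp: abs_square_le_1)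
  have "(jump d)\<^sup>2 / 2 \<le> exp (jump d) + exp (- jump d) - 2" by (rule exp_sum_ge)
  also have "\<dots> = 4 * (sin (\<Theta> (edge M d)))\<^sup>2 * distortion d"
    using s(1) by (simp add: distortion_def)
  also have "\<dots> \<le> 4 * distortion d"
    using s distortion_nonneg[of d] mult_right_mono[OF s(2), of "distortion d"] by simp
  finally show ?thesis by simp
qed

lemma quasiconformal_iff_jump:
  assumes \<epsilon>: "\<epsilon> > 0" "\<And>d. \<epsilon> \<le> sin (\<Theta> (edge M d))"
  shows "quasiconformal M \<Theta> R' f \<longleftrightarrow> (\<exists>C. \<forall>d. \<bar>jump d\<bar> \<le> C)"
  unfolding quasiconformal_iff_distortion
proof
  assume "\<exists>k. 0 \<le> k \<and> k < 1 \<and> (\<forall>d. distortion d \<le> k\<^sup>2 * (1 + distortion d))"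
  then obtain k where k: "0 \<le> k" "k < 1" "\<And>d. distortion d \<le> k\<^sup>2 * (1 + distortion d)" by blast
  have k2: "k\<^sup>2 < 1" using k by (simp add: abs_square_less_1)
  have "\<bar>jump d\<bar> \<le> sqrt (8 * (k\<^sup>2 / (1 - k\<^sup>2)))" for d
  proof (rule real_le_rsqrt)
    have "distortion d * (1 - k\<^sup>2) \<le> k\<^sup>2" using k(3)[of d] by (simp add: algebra_simps)
    then have "distortion d \<le> k\<^sup>2 / (1 - k\<^sup>2)" using k2 by (simp add: pos_le_divide_eq)
    then show "\<bar>jump d\<bar>\<^sup>2 \<le> 8 * (k\<^sup>2 / (1 - k\<^sup>2))" using jump_sq_le[of d] by simp
  qed
  then show "\<exists>C. \<forall>d. \<bar>jump d\<bar> \<le> C" by blast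
next
  assume "\<exists>C. \<forall>d. \<bar>jump d\<bar> \<le> C"
  then obtain C where C: "\<And>d. \<bar>jump d\<bar> \<le> C" by blast
  \<comment> \<open>Bound for the distortion: each exponential is at most exp C and the sine at
    least \<epsilon>. The matching k^2 = P / (1 + P) comes from the monotonicity of t / (1 +
    t).\<close>
  define P where "P = 2 * exp C / (4 * \<epsilon>\<^sup>2)"
  have "P > 0" using \<epsilon> by (simp add: P_def)
  have "distortion d \<le> P" for d
  proof -
    have "exp (jump d) \<le> exp C" "exp (- jump d) \<le> exp C" using C[of d] by auto
    then have "exp (jump d) + exp (- jump d) - 2 \<le> 2 * exp C" by linarith
    moreover have "0 < 4 * \<epsilon>\<^sup>2" "4 * \<epsilon>\<^sup>2 \<le> 4 * (sin (\<Theta> (edge M d)))\<^sup>2"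
      using \<epsilon> by (auto intro!: power_mono)
    ultimately show ?thesis unfolding distortion_def P_def by (intro frac_le) auto
  qed
  then have "distortion d \<le> (sqrt (P / (1 + P)))\<^sup>2 * (1 + distortion d)" for d
  proof -
    have "distortion d * (1 + P) \<le> P * (1 + distortion d)" using \<open>distortion d \<le> P\<close> by (simp add: algebra_simps)
    then have "distortion d \<le> P * (1 + distortion d) / (1 + P)" using \<open>P > 0\<close> by (simp add: pos_le_divide_eq)
    then show ?thesis using \<open>P > 0\<close> by simp
  qed
  moreover have "0 \<le> sqrt (P / (1 + P))" "sqrt (P / (1 + P)) < 1" using \<open>P > 0\<close> by auto
  ultimately show "\<exists>k. 0 \<le> k \<and> k < 1 \<and> (\<forall>d. distortion d \<le> k\<^sup>2 * (1 + distortion d))" by blast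
qed

lemma hyperbolic_L2_beltrami:
  "hyperbolic_L2 (beltrami M \<Theta> R' f) \<longleftrightarrow>
    (\<integral>\<^sup>+d. ennreal (distortion d / (1 + distortion d)) * harea d \<partial>count_space UNIV) < \<infinity>"
  by (rule hyperbolic_L2_iff) (rule beltrami_pl_map)

text \<open>Uniformly bounded areas reduce the claim to bounding |\<mu>|^2 by a multiple of the
  squared jump. Small jumps use the quadratic bound on the distortion; for large ones |\<mu>|^2
  \<le> 1 is already enough.\<close>

lemma hyperbolic_L2_if_jump_summable:
  assumes \<epsilon>: "0 < \<epsilon>" "\<And>d. \<epsilon> \<le> \<Theta> (edge M d)" "\<And>d. \<epsilon> \<le> sin (\<Theta> (edge M d))"
    and sum: "(\<lambda>d. (jump d)\<^sup>2) summable_on UNIV"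
  shows "hyperbolic_L2 (beltrami M \<Theta> R' f)"
proof -
  \<comment> \<open>Truncated to the range where cos decreases from 1 to 0, so that \<kappa> = 1 -
    cos(\<epsilon>' / 2) is positive and serves all edges.\<close>
  define \<epsilon>' where "\<epsilon>' = min \<epsilon> (pi / 2)"
  have \<epsilon>': "0 < \<epsilon>'" "\<epsilon>' \<le> \<epsilon>" "\<epsilon>' \<le> pi / 2" using \<epsilon>(1) by (auto simp: \<epsilon>'_def)
  define \<kappa> where "\<kappa> = 1 - sqrt ((1 + cos \<epsilon>') / 2)"
  have c: "0 \<le> cos \<epsilon>'" "cos \<epsilon>' < 1"
    using \<epsilon>' cos_monotone_0_pi[of 0 \<epsilon>'] by (auto intro!: cos_ge_zero)
  have \<kappa>: "0 < \<kappa>" "\<kappa> \<le> 1" using c by (auto simp: \<kappa>_def)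
  have area: "harea d \<le> ennreal (1 / \<kappa>\<^sup>2)" for d
  proof (rule harea_le[OF \<kappa>])
    have "cos (\<Theta> (edge M d)) \<le> cos \<epsilon>'"
      using \<epsilon>' \<epsilon>(2)[of d] Theta_less_pi[of d] by (intro cos_monotone_0_pi_le) auto
    then show "\<kappa> \<le> 1 - sqrt ((1 + cos (\<Theta> (edge M d))) / 2)"
      by (simp add: \<kappa>_def divide_right_mono)
  qed
  \<comment> \<open>The summand 1 serves jumps larger than 1, the other summand the remaining
    ones.\<close>
  define C where "C = 1 + 1 / (2 * \<epsilon>\<^sup>2)"
  have C: "1 \<le> C" using \<epsilon> by (simp add: C_def)
  have \<mu>: "distortion d / (1 + distortion d) \<le> C * (jump d)\<^sup>2" for d
  proof (cases "\<bar>jump d\<bar> \<le> 1")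
    case True
    have "distortion d / (1 + distortion d) \<le> distortion d / 1"
      using distortion_nonneg[of d] by (intro divide_left_mono) auto
    also have "\<dots> \<le> 2 * (jump d)\<^sup>2 / (4 * \<epsilon>\<^sup>2)"
      unfolding distortion_def div_by_1 using exp_sum_le[OF True] \<epsilon>(1) \<epsilon>(3)[of d]
      by (intro frac_le mult_left_mono power_mono) auto
    also have "\<dots> = 1 / (2 * \<epsilon>\<^sup>2) * (jump d)\<^sup>2" using \<epsilon>(1) by (simp add: field_simps)
    also have "\<dots> \<le> C * (jump d)\<^sup>2" unfolding C_def by (intro mult_right_mono) auto
    finally show ?thesis .
  next
    case False
    then have "1 \<le> (jump d)\<^sup>2" using one_le_power[of "\<bar>jump d\<bar>" 2] by simp
    moreover have "distortion d / (1 + distortion d) \<le> 1"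
      using distortion_nonneg[of d] by (simp add: pos_divide_le_eq)
    moreover have "1 * (jump d)\<^sup>2 \<le> C * (jump d)\<^sup>2" using C by (intro mult_right_mono) auto
    ultimately show ?thesis by simp
  qed
  have "(\<integral>\<^sup>+d. ennreal (distortion d / (1 + distortion d)) * harea d \<partial>count_space UNIV)
      \<le> (\<integral>\<^sup>+d. ennreal (C * (jump d)\<^sup>2 * (1 / \<kappa>\<^sup>2)) \<partial>count_space UNIV)"
  proof (rule nn_integral_mono)
    fix d
    have "ennreal (distortion d / (1 + distortion d)) * harea d \<le> ennreal (C * (jump d)\<^sup>2) * ennreal (1 / \<kappa>\<^sup>2)"
      using \<mu> area by (intro mult_mono ennreal_leI) auto
    then show "ennreal (distortion d / (1 + distortion d)) * harea d \<le> ennreal (C * (jump d)\<^sup>2 * (1 / \<kappa>\<^sup>2))"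
      using C by (subst ennreal_mult) auto
  qed
  also have "\<dots> < \<infinity>"
    using C sum by (subst nn_integral_count_space_summable)
      (auto intro!: summable_on_cmult_left summable_on_cmult_right simp del: times_divide_eq_right)
  finally show ?thesis unfolding hyperbolic_L2_beltrami .
qed

text \<open>Areas bounded below make |\<mu>|^2 summable over the darts, so it exceeds 1/2 only
  finitely often. Elsewhere the distortion is at most 2 |\<mu>|^2, and \<open>jump_sq_le\<close>
  applies.\<close>

lemma jump_summable_if_hyperbolic_L2:
  assumes c: "0 < c" "\<And>d. ennreal c \<le> harea d"
    and L2: "hyperbolic_L2 (beltrami M \<Theta> R' f)"
  shows "(\<lambda>d. (jump d)\<^sup>2) summable_on UNIV"
proof -
  define m where "m d = distortion d / (1 + distortion d)" for d
  have m0: "0 \<le> m d" for d using distortion_nonneg[of d] by (simp add: m_def)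
  have "(\<integral>\<^sup>+d. ennreal (m d * c) \<partial>count_space UNIV)
      \<le> (\<integral>\<^sup>+d. ennreal (m d) * harea d \<partial>count_space UNIV)"
    using m0 c by (intro nn_integral_mono) (auto simp: ennreal_mult intro!: mult_left_mono)
  also have "\<dots> < \<infinity>" using L2 unfolding hyperbolic_L2_beltrami m_def .
  finally have "(\<lambda>d. m d * c) summable_on UNIV"
    using m0 c by (subst (asm) nn_integral_count_space_summable) auto
  then have "(\<lambda>d. m d * c * (1 / c)) summable_on UNIV" by (rule summable_on_cmult_left)
  then have m: "m summable_on UNIV" using c by simp
  have fin: "finite {d. 1 / 2 < m d}"
  proof (rule ccontr)
    assume inf: "infinite {d. 1 / 2 < m d}"
    have "m summable_on {d. 1 / 2 < m d}"
      using m by (rule summable_on_subset_banach) auto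
    then have "(\<lambda>_. 1 / 2 :: real) summable_on {d. 1 / 2 < m d}"
      by (rule summable_on_comparison_test) auto
    then have "(\<integral>\<^sup>+d. ennreal (1 / 2) \<partial>count_space {d. 1 / 2 < m d}) < \<infinity>"
      by (subst nn_integral_count_space_summable) auto
    then show False using inf by (simp add: ennreal_mult_eq_top_iff)
  qed
  have "(\<lambda>d. (jump d)\<^sup>2) summable_on (- {d. 1 / 2 < m d})"
  proof (rule summable_on_comparison_test)
    show "(\<lambda>d. 16 * m d) summable_on (- {d. 1 / 2 < m d})"
      using m by (intro summable_on_cmult_right) (auto intro: summable_on_subset_banach)
    fix d assume "d \<in> - {d. 1 / 2 < m d}"
    then have "m d \<le> 1 / 2" by simp
    moreover have "distortion d = m d * (1 + distortion d)"
      using distortion_nonneg[of d] by (simp add: m_def)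
    ultimately have "distortion d \<le> 2 * m d"
      using mult_right_mono[of "m d" "1 / 2" "distortion d"] distortion_nonneg[of d]
      by (simp add: algebra_simps)
    then show "(jump d)\<^sup>2 \<le> 16 * m d" using jump_sq_le[of d] by simp
  qed auto
  then have "(\<lambda>d. (jump d)\<^sup>2) summable_on (- {d. 1 / 2 < m d} \<union> {d. 1 / 2 < m d})"
    using fin by (intro summable_on_Un_disjoint) auto
  then show ?thesis by simp
qed

section \<open>From darts to edges, and the lower area bound\<close>

lemma dual_diff_edge: "dual_diff M u (edge M d) = \<bar>jump d\<bar>"
proof -
  define e where "e = (SOME e. e \<in> edge M d)"
  have "e \<in> edge M d" unfolding e_def by (rule someI_ex) (auto simp: edge_def)
  then have "e = d \<or> e = opp M d" by (auto simp: edge_def)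
  then have "\<bar>u (left_face M e) - u (right_face M e)\<bar> = \<bar>jump d\<bar>"
    by (auto simp: jump_def left_face_opp abs_minus_commute)
  then show ?thesis by (simp add: dual_diff_def Let_def e_def)
qed

lemma dual_diff_bdd_above: "bdd_above (dual_diff M u ` edges M) \<longleftrightarrow> (\<exists>C. \<forall>d. \<bar>jump d\<bar> \<le> C)"
  unfolding bdd_above_def edges_def by (auto simp: dual_diff_edge)

text \<open>The two darts of an edge have opposite jumps, so summability over one representative per
  edge carries over to the images under \<open>opp\<close>; together these exhaust the
  darts.\<close>

lemma finite_dirichlet_energy_iff:
  "finite_dirichlet_energy M u \<longleftrightarrow> (\<lambda>d. (jump d)\<^sup>2) summable_on UNIV"
proof -
  define rep where "rep e = (SOME d. d \<in> e)" for e :: "'d set"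
  have rep: "rep (edge M d) = d \<or> rep (edge M d) = opp M d" for d
  proof -
    have "rep (edge M d) \<in> edge M d" unfolding rep_def by (rule someI_ex) (auto simp: edge_def)
    then show ?thesis by (auto simp: edge_def)
  qed
  have edge_rep: "edge M (rep e) = e" if e: "e \<in> edges M" for e
  proof -
    obtain d where "e = edge M d" using e unfolding edges_def by blast
    then show ?thesis using rep[of d] by auto
  qed
  have inj: "inj_on rep (edges M)" by (metis edge_rep inj_onI)
  have jump_opp: "jump (opp M d) = - jump d" for d
    by (simp add: jump_def left_face_opp)
  have "finite_dirichlet_energy M u \<longleftrightarrow> (\<lambda>e. (jump (rep e))\<^sup>2) summable_on edges M"
    unfolding finite_dirichlet_energy_def
  proof (rule summable_on_cong)
    fix e assume "e \<in> edges M"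
    then show "(dual_diff M u e)\<^sup>2 = (jump (rep e))\<^sup>2"
      using dual_diff_edge[of "rep e"] by (simp add: edge_rep)
  qed
  also have "\<dots> \<longleftrightarrow> (\<lambda>d. (jump d)\<^sup>2) summable_on rep ` edges M"
    using summable_on_reindex[OF inj, of "\<lambda>d. (jump d)\<^sup>2"] by (simp add: o_def)
  also have "\<dots> \<longleftrightarrow> (\<lambda>d. (jump d)\<^sup>2) summable_on UNIV"
  proof
    assume sum: "(\<lambda>d. (jump d)\<^sup>2) summable_on rep ` edges M"
    then have "((\<lambda>d. (jump d)\<^sup>2) \<circ> opp M) summable_on rep ` edges M"
      by (simp add: o_def jump_opp)
    then have sum': "(\<lambda>d. (jump d)\<^sup>2) summable_on opp M ` rep ` edges M"
      using summable_on_reindex[of "opp M" "rep ` edges M" "\<lambda>d. (jump d)\<^sup>2"] inj_opp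
      by (meson inj_on_subset subset_UNIV)
    have cover: "rep ` edges M \<union> (opp M ` rep ` edges M - rep ` edges M) = UNIV"
    proof -
      have "d \<in> rep ` edges M \<union> opp M ` rep ` edges M" for d
      proof -
        have "edge M d \<in> edges M" by (simp add: edges_def)
        then show ?thesis using rep[of d] by (metis UnCI imageI opp_opp)
      qed
      then show ?thesis by blast
    qed
    have "(\<lambda>d. (jump d)\<^sup>2) summable_on opp M ` rep ` edges M - rep ` edges M"
      using sum' by (rule summable_on_subset_banach) auto
    then have "(\<lambda>d. (jump d)\<^sup>2) summable_on (rep ` edges M \<union> (opp M ` rep ` edges M - rep ` edges M))"
      using sum by (intro summable_on_Un_disjoint) auto
    then show "(\<lambda>d. (jump d)\<^sup>2) summable_on UNIV" unfolding cover .
  next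
    assume "(\<lambda>d. (jump d)\<^sup>2) summable_on UNIV"
    then show "(\<lambda>d. (jump d)\<^sup>2) summable_on rep ` edges M"
      by (rule summable_on_subset_banach) auto
  qed
  finally show ?thesis .
qed

text \<open>A lower bound on hyperbolic radii becomes a linear lower bound of each Euclidean radius
  by the boundary distance of its centre, which is the hypothesis of
  \<open>harea_ge\<close>.\<close>

lemma harea_lower_bound:
  assumes \<epsilon>: "0 < \<epsilon>" "\<And>d. \<epsilon> \<le> sin (\<Theta> (edge M d))"
    and rad: "hyperbolic_radii_bounded_below M \<Theta> R dev"
  obtains c where "0 < c" "\<And>d. ennreal c \<le> harea d"
proof -
  obtain \<rho>\<^sub>0 where \<rho>: "0 < \<rho>\<^sub>0" and
    circ: "\<And>d. \<exists>p\<in>\<D>. \<exists>\<rho>\<ge>\<rho>\<^sub>0. pattern_circle M \<Theta> R dev d = hyperbolic_circle p \<rho>"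
    using rad unfolding hyperbolic_radii_bounded_below_def by blast
  define K where "K = (cosh \<rho>\<^sub>0 - 1) / 2"
  have "0 < K" using \<rho> cosh_real_strict_mono[of 0 \<rho>\<^sub>0] by (simp add: K_def)
  define \<tau> where "\<tau> = sqrt (K / (1 + K))"
  have "0 < \<tau>" using \<open>0 < K\<close> by (simp add: \<tau>_def)
  have low: "\<tau> * (1 - cmod (place d (lc d))) \<le> R (left_face M d)" for d
  proof -
    have "lc d \<in> T d" by (simp add: lc_bary)
    then have "pattern_circle M \<Theta> R dev d = sphere (place d (lc d)) (R (left_face M d))"
      by (simp add: pattern_circle_def dev_pt)
    then obtain p \<rho> where "p \<in> \<D>" "\<rho>\<^sub>0 \<le> \<rho>"
      "sphere (place d (lc d)) (R (left_face M d)) = hyperbolic_circle p \<rho>"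
      using circ[of d] by metis
    then show ?thesis
      using hyperbolic_circle_euclidean_radius[of "place d (lc d)" "R (left_face M d)" p \<rho> \<rho>\<^sub>0]
        R_pos \<rho> by (simp add: \<tau>_def K_def)
  qed
  show thesis
  proof (rule that)
    show "0 < \<epsilon> / (16 * (1 / \<tau> + 2)\<^sup>2)"
      using \<epsilon> \<open>0 < \<tau>\<close> by (intro divide_pos_pos mult_pos_pos zero_less_power add_pos_pos) auto
    fix d
    have "ennreal (\<epsilon> / (16 * (1 / \<tau> + 2)\<^sup>2)) \<le> ennreal (sin (\<Theta> (edge M d)) / (16 * (1 / \<tau> + 2)\<^sup>2))"
      using \<epsilon> by (intro ennreal_leI divide_right_mono) auto
    also have "\<dots> \<le> harea d" by (rule harea_ge[OF \<open>0 < \<tau>\<close> low])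
    finally show "ennreal (\<epsilon> / (16 * (1 / \<tau> + 2)\<^sup>2)) \<le> harea d" .
  qed
qed

end

theorem theorem1p12:
  fixes M :: "'d cell_map"
    and \<Theta> R u :: "'d set \<Rightarrow> real"
    and \<epsilon>\<^sub>0 :: real
    and dev :: "('d \<times> complex) set \<Rightarrow> complex"
  assumes "cell_decomposition_of_disk M"
    and "one_ended M"
    and "bounded_degrees M"
    and "transient M"
    and "\<epsilon>\<^sub>0 > 0"
    and "admissible_angles M \<epsilon>\<^sub>0 \<Theta>"
    and "R \<in> pattern_radii M \<Theta>"
    and "uniformizing M \<Theta> R dev"
    and "rescale u R \<in> pattern_radii M \<Theta>"
  shows "(quasiconformal M \<Theta> (rescale u R) (pl_map M \<Theta> R dev u) \<longleftrightarrow>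
            bdd_above (dual_diff M u ` edges M)) \<and>
         (finite_dirichlet_energy M u \<longrightarrow>
            hyperbolic_L2 (beltrami M \<Theta> (rescale u R) (pl_map M \<Theta> R dev u))) \<and>
         (hyperbolic_L2 (beltrami M \<Theta> (rescale u R) (pl_map M \<Theta> R dev u)) \<and>
          hyperbolic_radii_bounded_below M \<Theta> R dev \<longrightarrow>
            finite_dirichlet_energy M u)"
proof -
  have \<Theta>: "\<epsilon>\<^sub>0 < \<Theta> (edge M d)" "\<Theta> (edge M d) < pi - \<epsilon>\<^sub>0" for d
    using assms(6) by (auto simp: admissible_angles_def edges_def)
  interpret pattern_deformation M \<Theta> R dev u
  proof unfold_locales
    fix d
    show "opp M (opp M d) = d" "bij (nxt M)"
      using assms(1) by (auto simp: cell_decomposition_of_disk_def)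
    show "finite (origin M d)" "finite (left_face M d)"
      using assms(3) by (auto simp: bounded_degrees_def vertices_def faces_def)
    show "0 < \<Theta> (edge M d)" "\<Theta> (edge M d) < pi"
      using \<Theta>[of d] assms(5) by linarith+
    show "R (left_face M d) > 0"
      using assms(7) by (auto simp: pattern_radii_def faces_def)
    show "uniformizing M \<Theta> R dev" by fact
  qed
  \<comment> \<open>One constant for two purposes: \<open>sin \<epsilon>\<^sub>0\<close> bounds the
    sine from below on the admissible range of angles, and it is at most
    \<open>\<epsilon>\<^sub>0\<close>, hence below every angle.\<close>
  define \<epsilon> where "\<epsilon> = sin \<epsilon>\<^sub>0"
  \<comment> \<open>Types are inhabited: the angle of an arbitrary dart shows that the admissible
    interval is nonempty.\<close>
  have "\<epsilon>\<^sub>0 < pi / 2"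
    using \<Theta>[of undefined] by linarith
  then have "0 < \<epsilon>" "\<epsilon> \<le> \<epsilon>\<^sub>0"
    using assms(5) sin_x_le_x by (auto simp: \<epsilon>_def intro!: sin_gt_zero)
  have \<Theta>1: "\<epsilon> \<le> \<Theta> (edge M d)" for d using \<Theta>(1)[of d] \<open>\<epsilon> \<le> \<epsilon>\<^sub>0\<close> by linarith
  have \<Theta>2: "\<epsilon> \<le> sin (\<Theta> (edge M d))" for d
  proof (cases "\<Theta> (edge M d) \<le> pi / 2")
    case True
    then show ?thesis unfolding \<epsilon>_def
      using \<Theta>(1)[of d] assms(5) by (intro sin_monotone_2pi_le) linarith+
  next
    case False
    then have "sin \<epsilon>\<^sub>0 \<le> sin (pi - \<Theta> (edge M d))"
      using \<Theta>(2)[of d] assms(5) by (intro sin_monotone_2pi_le) linarith+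
    then show ?thesis by (simp add: \<epsilon>_def)
  qed
  show ?thesis
  proof (intro conjI impI)
    show "quasiconformal M \<Theta> (rescale u R) (pl_map M \<Theta> R dev u) \<longleftrightarrow> bdd_above (dual_diff M u ` edges M)"
      unfolding dual_diff_bdd_above by (rule quasiconformal_iff_jump[OF \<open>0 < \<epsilon>\<close> \<Theta>2])
    assume "finite_dirichlet_energy M u"
    then show "hyperbolic_L2 (beltrami M \<Theta> (rescale u R) (pl_map M \<Theta> R dev u))"
      unfolding finite_dirichlet_energy_iff
      by (rule hyperbolic_L2_if_jump_summable[OF \<open>0 < \<epsilon>\<close> \<Theta>1 \<Theta>2])
  next
    assume *: "hyperbolic_L2 (beltrami M \<Theta> (rescale u R) (pl_map M \<Theta> R dev u)) \<and>
        hyperbolic_radii_bounded_below M \<Theta> R dev"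
    obtain c where "0 < c" "\<And>d. ennreal c \<le> harea d"
      using harea_lower_bound[OF \<open>0 < \<epsilon>\<close> \<Theta>2] * by metis
    then show "finite_dirichlet_energy M u"
      unfolding finite_dirichlet_energy_iff using * jump_summable_if_hyperbolic_L2 by blast
  qed
qed

end
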